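(* Let $\Gamma$ be a finitely generated group, with a fixed epimorphism $\pi\colon F_S\to\Gamma$ from the free group on a finite set $S$, and let $\nu\colon\mathbb{R}_{>0}\times\mathbb{N}\to\mathbb{N}\cup\{0,\infty\}$ be monotone non-decreasing in the first argument. (1) $\Gamma$ is stable (resp. $\nu$-flexibly stable) if and only if every stability challenge for $\Gamma$ has a solution (resp. $\nu$-flexible solution). (2) $\Gamma$ is BS-rigid (resp. $\nu$-flexibly BS-rigid) if and only if every BS-rigidity challenge for $\Gamma$ has a solution (resp. $\nu$-flexible solution). (3) $\Gamma$ is weakly stable (resp. $\nu$-flexibly weakly stable) if and only if every sofic approximation for $\Gamma$ has a solution (resp. $\nu$-flexible solution).
   Context: Invariant random subgroups: for a finitely generated group $\Delta$, $\mathrm{Sub}(\Delta)$ is the space of subgroups of $\Delta$ with the topology induced from the product topology on $\{0,1\}^\Delta$. $\mathrm{IRS}(\Delta)$ is the space of conjugation-invariant Borel regular probability measures on $\mathrm{Sub}(\Delta)$, with the weak-$*$ topology. A measure $\mu\in\mathrm{IRS}(\Delta)$ is co-sofic (in $\Delta$) if it is the limit of a sequence of elements of $\mathrm{IRS}(\Delta)$ supported on finite-index subgroups. The map $H\mapsto\pi^{-1}(H)$ embeds $\mathrm{Sub}(\Gamma)$ in $\mathrm{Sub}(F_S)$ and $\mathrm{IRS}(\Gamma)$ in $\mathrm{IRS}(F_S)$ as a closed subspace; $\mathrm{IRS}(\Gamma)$ is viewed as a subspace of $\mathrm{IRS}(F_S)$ in this way. A $\Delta$-set is a set with an action of $\Delta$;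 a $\Gamma$-set is also an $F_S$-set via $\pi$. For a finite $\Delta$-set $X$, $\mu_X\in\mathrm{IRS}(\Delta)$ is the law of the stabilizer of a uniformly random point of $X$. A sequence $(X_n)$ of finite $\Delta$-sets is convergent, $X_n\to\mu$, if $\mu_{X_n}\to\mu$. For finite $F_S$-sets $X,Y$ with $|X|\le|Y|$, $$d_S(X,Y)=d_S(Y,X)=\min_{f}\frac1{|X|}\sum_{s\in S}\sum_{x\in X}\mathbf{1}_{f(sx)\ne sf(x)},$$ the minimum over all injections $f\colon X\to Y$. Let $(X_n)_{n=1}^\infty$ be a convergent sequence of finite $F_S$-sets, $X_n\to\mu\in\mathrm{IRS}(F_S)$. It is a stability challenge for $\Gamma$ if $\mu\in\mathrm{IRS}(\Gamma)$; a BS-rigidity challenge for $\Gamma$ if $\mu\in\mathrm{IRS}(\Gamma)$ and $\mu$ is co-sofic in $\Gamma$; a sofic approximation for $\Gamma$ if $\mu\in\mathrm{IRS}(\Gamma)$ is the Dirac measure at the trivial subgroup of $\Gamma$. A sequence $(Y_n)_{n=1}^\infty$ of finite $\Gamma$-sets is a $\nu$-flexible solution for $(X_n)$ if $d_S(X_n,Y_n)\to0$ and there are positive reals $\varepsilon_n\to0$ with $|X_n|\le|Y_n|\le|X_n|+\nu(\varepsilon_n,|X_n|)$ for all $n$; it is a solution if this holds with $\nu=0$. Stability notions: write $[n]=\{1,\dots,n\}$ and $\mathrm{Sym}(n)$ for the symmetric group on $[n]$. For $\sigma\in\mathrm{Sym}(n)$, $\tau\in\mathrm{Sym}(M)$ with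 $M\ge n$, $d(\sigma,\tau)=d(\tau,\sigma)=\frac1n|\{x\in[n]\mid\sigma x\neq\tau x\}|$. For $f\colon\Gamma\to\mathrm{Sym}(n)$ and finite $Q\subset\Gamma$, $N_{f,Q}$ is the distribution on $2^Q$ of $\{\gamma\in Q\mid f(\gamma)x=x\}$ with $x$ uniform in $[n]$; $d_{\mathrm{TV}}$ is total variation distance. Call $(f_\ell\colon\Gamma\to\mathrm{Sym}(n_\ell))_{\ell=1}^\infty$, $n_\ell\to\infty$, an asymptotic homomorphism if $d(f_\ell(\gamma_1\gamma_2),f_\ell(\gamma_1)f_\ell(\gamma_2))\to0$ for all $\gamma_1,\gamma_2\in\Gamma$; call it $\nu$-correctable if there are positive reals $\varepsilon_\ell\to0$ and homomorphisms $h_\ell\colon\Gamma\to\mathrm{Sym}(N_\ell)$ with $n_\ell\le N_\ell\le n_\ell+\nu(\varepsilon_\ell,n_\ell)$ and $d(f_\ell(\gamma),h_\ell(\gamma))\to0$ for all $\gamma\in\Gamma$. $\Gamma$ is $\nu$-flexibly stable if every asymptotic homomorphism is $\nu$-correctable; $\nu$-flexibly BS-rigid if every asymptotic homomorphism $(f_\ell)$ admitting homomorphisms $g_\ell\colon\Gamma\to\mathrm{Sym}(n_\ell)$ with $d_{\mathrm{TV}}(N_{f_\ell,Q},N_{g_\ell,Q})\to0$ for every finite $Q\subset\Gamma$ is $\nu$-correctable; $\nu$-flexibly weakly stable if every asymptotic homomorphism $(f_\ell)$ with $d(f_\ell(\gamma),1_{\mathrm{Sym}(n_\ell)})\to1$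 for all $\gamma\ne1_\Gamma$ is $\nu$-correctable. Stable, BS-rigid, weakly stable mean these with $\nu=0$. *)

theory Defs
  imports
    "HOL-Algebra.Group_Action"
    "HOL-Algebra.Sym_Groups"
    "HOL-Probability.Probability"
    "HOL-Library.Extended_Nat"
    "HOL-Library.Infinite_Typeclass"
begin

section \<open>Free groups\<close>

text \<open>Elements are reduced words; the letter \<open>(s, True)\<close> is the generator \<open>s\<close> and
  \<open>(s, False)\<close> its inverse.  The product is concatenation followed by free reduction.\<close>

type_synonym 's word = "('s \<times> bool) list"

fun red_cons :: "'s \<times> bool \<Rightarrow> 's word \<Rightarrow> 's word" where
  "red_cons x [] = [x]"
| "red_cons x (y # w) = (if fst x = fst y \<and> snd x \<noteq> snd y then w else x # y # w)"

definition reduced :: "'s word \<Rightarrow> bool" where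
  "reduced = successively (\<lambda>x y. \<not> (fst x = fst y \<and> snd x \<noteq> snd y))"

definition free_group :: "'s set \<Rightarrow> 's word monoid" where
  "free_group S = \<lparr>carrier = {w. reduced w \<and> fst ` set w \<subseteq> S},
                   monoid.mult = foldr red_cons, one = []\<rparr>"

definition gen :: "'s \<Rightarrow> 's word" where
  "gen s = [(s, True)]"

lemma gen_in_carrier: "s \<in> S \<Longrightarrow> gen s \<in> carrier (free_group S)"
  by (simp add: gen_def free_group_def reduced_def)

lemma reduced_red_cons: "reduced w \<Longrightarrow> reduced (red_cons x w)"
  by (cases w) (auto simp: reduced_def successively_Cons)

lemma reduced_foldr: "reduced w \<Longrightarrow> reduced (foldr red_cons u w)"
  by (induction u) (auto intro: reduced_red_cons)

lemma set_red_cons: "set (red_cons x w) \<subseteq> insert x (set w)"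
  by (cases w) auto

lemma set_foldr_red_cons: "set (foldr red_cons u w) \<subseteq> set u \<union> set w"
proof (induction u)
  case (Cons x u)
  then show ?case using set_red_cons[of x "foldr red_cons u w"] by auto
qed simp

lemma red_cons_cancel:
  assumes "reduced w" shows "red_cons (s, b) (red_cons (s, \<not> b) w) = w"
proof (cases w)
  case (Cons y v)
  then show ?thesis using assms
    by (cases v; cases y) (auto simp: reduced_def successively_Cons)
qed simp

lemma foldr_red_cons:
  assumes "reduced w"
  shows "foldr red_cons (red_cons x u) w = red_cons x (foldr red_cons u w)"
proof (cases u)
  case (Cons y v)
  obtain s a where x: "x = (s, a)" by (cases x)
  obtain t b where y: "y = (t, b)" by (cases y)
  have r: "reduced (foldr red_cons v w)" using assms by (rule reduced_foldr)
  show ?thesis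
  proof (cases "s = t \<and> a \<noteq> b")
    case True
    then have "y = (s, \<not> a)" using y by auto
    then show ?thesis using Cons x True red_cons_cancel[OF r, of s a] by simp
  next
    case False
    then show ?thesis using Cons x y by auto
  qed
qed simp

lemma foldr_assoc:
  assumes "reduced w"
  shows "foldr red_cons (foldr red_cons u v) w = foldr red_cons u (foldr red_cons v w)"
  by (induction u) (auto simp: foldr_red_cons[OF assms])

lemma foldr_Nil: "reduced u \<Longrightarrow> foldr red_cons u [] = u"
proof (induction u)
  case (Cons x u)
  then show ?case by (cases u) (auto simp: reduced_def successively_Cons)
qed simp

lemma foldr_inverse:
  assumes "reduced w"
  shows "foldr red_cons (rev (map (\<lambda>(s, b). (s, \<not> b)) u)) (foldr red_cons u w) = w"
proof (induction u)
  case (Cons x u)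
  obtain s b where x: "x = (s, b)" by (cases x)
  have "red_cons (s, \<not> b) (red_cons (s, b) (foldr red_cons u w)) = foldr red_cons u w"
    using red_cons_cancel[OF reduced_foldr[OF assms], of s "\<not> b"] by simp
  then show ?case using Cons x by simp
qed simp

lemma group_free_group: "group (free_group S)"
proof (rule groupI)
  fix x assume x: "x \<in> carrier (free_group S)"
  let ?u = "rev (map (\<lambda>(s, b). (s, \<not> b)) x)"
  let ?y = "foldr red_cons ?u []"
  have nil: "reduced []" by (simp add: reduced_def)
  have rx: "reduced x" "fst ` set x \<subseteq> S" using x by (auto simp: free_group_def)
  have "reduced ?y" by (rule reduced_foldr[OF nil])
  moreover have "fst ` set ?y \<subseteq> S"
    using set_foldr_red_cons[of ?u "[]"] rx(2) by fastforce
  moreover have "foldr red_cons ?y x = []"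
    using foldr_assoc[OF rx(1), of ?u "[]"] foldr_inverse[OF nil, of x] foldr_Nil[OF rx(1)]
    by simp
  ultimately show "\<exists>y\<in>carrier (free_group S). y \<otimes>\<^bsub>free_group S\<^esub> x = \<one>\<^bsub>free_group S\<^esub>"
    by (intro bexI[of _ ?y]) (auto simp: free_group_def)
next
  fix x y assume "x \<in> carrier (free_group S)" "y \<in> carrier (free_group S)"
  then show "x \<otimes>\<^bsub>free_group S\<^esub> y \<in> carrier (free_group S)"
    using set_foldr_red_cons[of x y] by (auto simp: free_group_def reduced_foldr) force
qed (auto simp: free_group_def foldr_assoc, auto simp: reduced_def)


section \<open>Invariant random subgroups\<close>

definition Sub :: "('g, 'b) monoid_scheme \<Rightarrow> 'g set topology" where
  "Sub G = pullback_topology {H. subgroup H G} (\<lambda>H. \<lambda>g\<in>carrier G. g \<in> H)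
     (product_topology (\<lambda>_. discrete_topology (UNIV :: bool set)) (carrier G))"

lemma topspace_Sub: "topspace (Sub G) = {H. subgroup H G}"
  by (auto simp: Sub_def topspace_pullback_topology)

definition borel_of :: "'a topology \<Rightarrow> 'a measure" where
  "borel_of X = sigma (topspace X) {U. openin X U}"

definition regular_measure :: "'a topology \<Rightarrow> 'a measure \<Rightarrow> bool" where
  "regular_measure X M \<longleftrightarrow>
     (\<forall>A\<in>sets M. emeasure M A = (INF U\<in>{U. openin X U \<and> A \<subseteq> U}. emeasure M U)) \<and>
     (\<forall>A\<in>sets M. emeasure M A = (SUP K\<in>{K. compactin X K \<and> K \<subseteq> A}. emeasure M K))"

definition IRS :: "('g, 'b) monoid_scheme \<Rightarrow> 'g set measure set" where
  "IRS G = {\<mu>. prob_space \<mu> \<and> sets \<mu> = sets (borel_of (Sub G)) \<and> regular_measure (Sub G) \<mu> \<and>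
     (\<forall>g\<in>carrier G. distr \<mu> (borel_of (Sub G)) (\<lambda>H. g <#\<^bsub>G\<^esub> H #>\<^bsub>G\<^esub> inv\<^bsub>G\<^esub> g) = \<mu>)}"

text \<open>The weak-* topology: the coarsest one making \<open>\<mu> \<mapsto> \<integral>f d\<mu>\<close> continuous for every continuous
  \<open>f\<close> on \<open>Sub G\<close> (which is compact, so such \<open>f\<close> are bounded).\<close>

definition IRS_topology :: "('g, 'b) monoid_scheme \<Rightarrow> 'g set measure topology" where
  "IRS_topology G =
     (let C = {f. continuous_map (Sub G) euclideanreal f}
      in pullback_topology (IRS G) (\<lambda>\<mu>. \<lambda>f\<in>C. integral\<^sup>L \<mu> f)
           (product_topology (\<lambda>_. euclideanreal) C))"

lemma topspace_IRS_topology: "topspace (IRS_topology G) = IRS G"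
  by (auto simp: IRS_topology_def Let_def topspace_pullback_topology)

definition co_sofic :: "('g, 'b) monoid_scheme \<Rightarrow> 'g set measure \<Rightarrow> bool" where
  "co_sofic G \<mu> \<longleftrightarrow> (\<exists>\<mu>s. (\<forall>n. \<mu>s n \<in> IRS G \<and> (AE H in \<mu>s n. finite (rcosets\<^bsub>G\<^esub> H))) \<and>
     limitin (IRS_topology G) \<mu>s \<mu> sequentially)"

text \<open>The map \<open>IRS(G) \<rightarrow> IRS(F)\<close> induced by \<open>H \<mapsto> \<pi>\<^sup>-\<^sup>1(H)\<close>.\<close>

definition IRS_embed ::
  "('f, 'a) monoid_scheme \<Rightarrow> ('f \<Rightarrow> 'g) \<Rightarrow> 'g set measure \<Rightarrow> 'f set measure" where
  "IRS_embed F \<pi> \<mu> = distr \<mu> (borel_of (Sub F)) (\<lambda>H. \<pi> -` H \<inter> carrier F)"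

definition dirac_trivial :: "('g, 'b) monoid_scheme \<Rightarrow> 'g set measure" where
  "dirac_trivial G = return (borel_of (Sub G)) {\<one>\<^bsub>G\<^esub>}"


section \<open>Finite sets with a group action\<close>

text \<open>A \<open>G\<close>-set is a carrier \<open>E\<close> together with an action \<open>\<alpha>\<close> such that \<open>group_action G E \<alpha>\<close>.
  Random points are drawn from \<open>E\<close>, so the finite \<open>G\<close>-sets below are nonempty.\<close>

definition finite_gset :: "('g, 'b) monoid_scheme \<Rightarrow> 'x set \<Rightarrow> ('g \<Rightarrow> 'x \<Rightarrow> 'x) \<Rightarrow> bool" where
  "finite_gset G E \<alpha> \<longleftrightarrow> finite E \<and> E \<noteq> {} \<and> group_action G E \<alpha>"

definition stab_law ::
  "('g, 'b) monoid_scheme \<Rightarrow> 'x set \<Rightarrow> ('g \<Rightarrow> 'x \<Rightarrow> 'x) \<Rightarrow> 'g set measure" where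
  "stab_law G E \<alpha> = distr (uniform_count_measure E) (borel_of (Sub G)) (stabilizer G \<alpha>)"

definition converges_to ::
  "('g, 'b) monoid_scheme \<Rightarrow> (nat \<Rightarrow> 'x set) \<Rightarrow> (nat \<Rightarrow> 'g \<Rightarrow> 'x \<Rightarrow> 'x) \<Rightarrow> 'g set measure \<Rightarrow> bool"
where
  "converges_to G E \<alpha> \<mu> \<longleftrightarrow> (\<forall>n. finite_gset G (E n) (\<alpha> n)) \<and>
     limitin (IRS_topology G) (\<lambda>n. stab_law G (E n) (\<alpha> n)) \<mu> sequentially"

definition inj_defect ::
  "'s set \<Rightarrow> 'x set \<Rightarrow> ('s word \<Rightarrow> 'x \<Rightarrow> 'x) \<Rightarrow> 'y set \<Rightarrow> ('s word \<Rightarrow> 'y \<Rightarrow> 'y) \<Rightarrow> real" where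
  "inj_defect S X \<alpha> Y \<beta> =
     Min ((\<lambda>f. 1 / real (card X) *
                (\<Sum>s\<in>S. \<Sum>x\<in>X. of_bool (f (\<alpha> (gen s) x) \<noteq> \<beta> (gen s) (f x)))) `
          {f \<in> X \<rightarrow>\<^sub>E Y. inj_on f X})"

definition gset_dist ::
  "'s set \<Rightarrow> 'x set \<Rightarrow> ('s word \<Rightarrow> 'x \<Rightarrow> 'x) \<Rightarrow> 'y set \<Rightarrow> ('s word \<Rightarrow> 'y \<Rightarrow> 'y) \<Rightarrow> real" where
  "gset_dist S X \<alpha> Y \<beta> =
     (if card X \<le> card Y then inj_defect S X \<alpha> Y \<beta> else inj_defect S Y \<beta> X \<alpha>)"


section \<open>Challenges and solutions\<close>

definition stability_challenge ::
  "'s set \<Rightarrow> ('g, 'b) monoid_scheme \<Rightarrow> ('s word \<Rightarrow> 'g) \<Rightarrow>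
    (nat \<Rightarrow> 'x set) \<Rightarrow> (nat \<Rightarrow> 's word \<Rightarrow> 'x \<Rightarrow> 'x) \<Rightarrow> bool" where
  "stability_challenge S G \<pi> E \<alpha> \<longleftrightarrow>
     (\<exists>\<mu>\<in>IRS G. converges_to (free_group S) E \<alpha> (IRS_embed (free_group S) \<pi> \<mu>))"

definition BS_rigidity_challenge ::
  "'s set \<Rightarrow> ('g, 'b) monoid_scheme \<Rightarrow> ('s word \<Rightarrow> 'g) \<Rightarrow>
    (nat \<Rightarrow> 'x set) \<Rightarrow> (nat \<Rightarrow> 's word \<Rightarrow> 'x \<Rightarrow> 'x) \<Rightarrow> bool" where
  "BS_rigidity_challenge S G \<pi> E \<alpha> \<longleftrightarrow>
     (\<exists>\<mu>\<in>IRS G. co_sofic G \<mu> \<and>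
        converges_to (free_group S) E \<alpha> (IRS_embed (free_group S) \<pi> \<mu>))"

definition sofic_approximation ::
  "'s set \<Rightarrow> ('g, 'b) monoid_scheme \<Rightarrow> ('s word \<Rightarrow> 'g) \<Rightarrow>
    (nat \<Rightarrow> 'x set) \<Rightarrow> (nat \<Rightarrow> 's word \<Rightarrow> 'x \<Rightarrow> 'x) \<Rightarrow> bool" where
  "sofic_approximation S G \<pi> E \<alpha> \<longleftrightarrow>
     converges_to (free_group S) E \<alpha> (IRS_embed (free_group S) \<pi> (dirac_trivial G))"

text \<open>The \<open>G\<close>-set \<open>(Y, \<beta>)\<close> is viewed as a set with an action of the free group via \<open>\<beta> \<circ> \<pi>\<close>.\<close>

definition flexible_solution ::
  "(real \<Rightarrow> nat \<Rightarrow> enat) \<Rightarrow> 's set \<Rightarrow> ('g, 'b) monoid_scheme \<Rightarrow> ('s word \<Rightarrow> 'g) \<Rightarrow>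
    (nat \<Rightarrow> 'x set) \<Rightarrow> (nat \<Rightarrow> 's word \<Rightarrow> 'x \<Rightarrow> 'x) \<Rightarrow>
    (nat \<Rightarrow> 'y set) \<Rightarrow> (nat \<Rightarrow> 'g \<Rightarrow> 'y \<Rightarrow> 'y) \<Rightarrow> bool" where
  "flexible_solution \<nu> S G \<pi> X \<alpha> Y \<beta> \<longleftrightarrow>
     (\<forall>n. finite_gset G (Y n) (\<beta> n)) \<and>
     (\<lambda>n. gset_dist S (X n) (\<alpha> n) (Y n) (\<beta> n \<circ> \<pi>)) \<longlonglongrightarrow> 0 \<and>
     (\<exists>\<epsilon>. (\<forall>n. 0 < \<epsilon> n) \<and> \<epsilon> \<longlonglongrightarrow> 0 \<and>
        (\<forall>n. card (X n) \<le> card (Y n) \<and>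
             enat (card (Y n)) \<le> enat (card (X n)) + \<nu> (\<epsilon> n) (card (X n))))"

abbreviation "solution \<equiv> flexible_solution (\<lambda>_ _. 0)"


section \<open>Stability notions\<close>

definition perm_dist :: "nat \<Rightarrow> nat \<Rightarrow> (nat \<Rightarrow> nat) \<Rightarrow> (nat \<Rightarrow> nat) \<Rightarrow> real" where
  "perm_dist n M \<sigma> \<tau> = real (card {x \<in> {1..min n M}. \<sigma> x \<noteq> \<tau> x}) / real (min n M)"

definition fix_law :: "nat \<Rightarrow> ('g \<Rightarrow> nat \<Rightarrow> nat) \<Rightarrow> 'g set \<Rightarrow> 'g set pmf" where
  "fix_law n f Q = map_pmf (\<lambda>x. {\<gamma> \<in> Q. f \<gamma> x = x}) (pmf_of_set {1..n})"

definition tv_dist :: "'a pmf \<Rightarrow> 'a pmf \<Rightarrow> real" where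
  "tv_dist p q = (SUP A. \<bar>measure_pmf.prob p A - measure_pmf.prob q A\<bar>)"

definition asymptotic_hom ::
  "('g, 'b) monoid_scheme \<Rightarrow> (nat \<Rightarrow> nat) \<Rightarrow> (nat \<Rightarrow> 'g \<Rightarrow> nat \<Rightarrow> nat) \<Rightarrow> bool" where
  "asymptotic_hom G n f \<longleftrightarrow>
     (\<forall>l. n l \<ge> 1 \<and> f l \<in> carrier G \<rightarrow> carrier (sym_group (n l))) \<and>
     filterlim n at_top sequentially \<and>
     (\<forall>g\<in>carrier G. \<forall>h\<in>carrier G.
        (\<lambda>l. perm_dist (n l) (n l) (f l (g \<otimes>\<^bsub>G\<^esub> h)) (f l g \<otimes>\<^bsub>sym_group (n l)\<^esub> f l h))
          \<longlonglongrightarrow> 0)"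

definition correctable ::
  "(real \<Rightarrow> nat \<Rightarrow> enat) \<Rightarrow> ('g, 'b) monoid_scheme \<Rightarrow>
    (nat \<Rightarrow> nat) \<Rightarrow> (nat \<Rightarrow> 'g \<Rightarrow> nat \<Rightarrow> nat) \<Rightarrow> bool" where
  "correctable \<nu> G n f \<longleftrightarrow>
     (\<exists>\<epsilon> N h. (\<forall>l. 0 < \<epsilon> l) \<and> \<epsilon> \<longlonglongrightarrow> 0 \<and>
        (\<forall>l. h l \<in> hom G (sym_group (N l)) \<and>
             n l \<le> N l \<and> enat (N l) \<le> enat (n l) + \<nu> (\<epsilon> l) (n l)) \<and>
        (\<forall>g\<in>carrier G. (\<lambda>l. perm_dist (n l) (N l) (f l g) (h l g)) \<longlonglongrightarrow> 0))"

definition flexibly_stable :: "(real \<Rightarrow> nat \<Rightarrow> enat) \<Rightarrow> ('g, 'b) monoid_scheme \<Rightarrow> bool" where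
  "flexibly_stable \<nu> G \<longleftrightarrow> (\<forall>n f. asymptotic_hom G n f \<longrightarrow> correctable \<nu> G n f)"

definition flexibly_BS_rigid :: "(real \<Rightarrow> nat \<Rightarrow> enat) \<Rightarrow> ('g, 'b) monoid_scheme \<Rightarrow> bool" where
  "flexibly_BS_rigid \<nu> G \<longleftrightarrow>
     (\<forall>n f. asymptotic_hom G n f \<and>
        (\<exists>g. (\<forall>l. g l \<in> hom G (sym_group (n l))) \<and>
             (\<forall>Q. finite Q \<and> Q \<subseteq> carrier G \<longrightarrow>
                (\<lambda>l. tv_dist (fix_law (n l) (f l) Q) (fix_law (n l) (g l) Q)) \<longlonglongrightarrow> 0))
        \<longrightarrow> correctable \<nu> G n f)"

definition flexibly_weakly_stable :: "(real \<Rightarrow> nat \<Rightarrow> enat) \<Rightarrow> ('g, 'b) monoid_scheme \<Rightarrow> bool"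
where
  "flexibly_weakly_stable \<nu> G \<longleftrightarrow>
     (\<forall>n f. asymptotic_hom G n f \<and>
        (\<forall>g\<in>carrier G - {\<one>\<^bsub>G\<^esub>}.
           (\<lambda>l. perm_dist (n l) (n l) (f l g) \<one>\<^bsub>sym_group (n l)\<^esub>) \<longlonglongrightarrow> 1)
        \<longrightarrow> correctable \<nu> G n f)"

abbreviation "stable_group \<equiv> flexibly_stable (\<lambda>_ _. 0)"
abbreviation "BS_rigid \<equiv> flexibly_BS_rigid (\<lambda>_ _. 0)"
abbreviation "weakly_stable \<equiv> flexibly_weakly_stable (\<lambda>_ _. 0)"

end

theory Submission
  imports Defs
begin

text \<open>All convergence is measured by the inclusion probabilities \<open>\<mu> {H. Q \<subseteq> H}\<close> for finite \<open>Q\<close>: they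
  determine an invariant random subgroup and its weak-* topology, and for the law of a stabilizer they
  are fractions of common fixed points.  Both sides of each equivalence then say the same thing about
  actions \<open>\<alpha>\<^sub>l\<close> of the free group on \<open>n\<^sub>l\<close> points: an asymptotic homomorphism restricts to such
  actions through the generators, and a challenge gives back an asymptotic homomorphism by composing
  with a section of \<open>\<pi>\<close>.  Solvability and correctability are both the condition that for every \<open>\<delta>\<close>,
  eventually, \<open>\<alpha>\<^sub>l\<close> is \<open>\<delta>\<close>-close to an action of \<open>\<Gamma>\<close>; it may be refuted along subsequences, so
  compactness of the space of invariant random subgroups produces the limit that an asymptotic
  homomorphism need not have.\<close>

section \<open>The space of subgroups\<close>

text \<open>Three mismatches between the formulations need work. Challenges may have bounded
  cardinalities, while the degrees of an asymptotic homomorphism tend to infinity: a refuting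
  subsequence either has degrees tending to infinity, where stability applies, or has a further
  subsequence of bounded degree. BS-rigidity asks for comparison actions on exactly
  \<open>n l\<close> points, while co-soficity supplies only random subgroups of finite index: the
  weights of their atoms are rounded to multiplicities of coset spaces, and fixed points fill up the
  degree. Finally, solutions carry a rate \<epsilon>: monotonicity of \<nu> replaces a rate by a
  fixed \<delta>, a slow diagonal choice recovers a rate, and the finitely many indices without a
  good action receive the trivial one of the same degree. Whole finite sets \<open>Q\<close> enter,
  not only single elements, because the probabilities of single memberships do not determine the law
  of a random subgroup, whereas the events \<open>above G Q\<close> are closed under
  intersection.\<close>

definition above :: "('g, 'b) monoid_scheme \<Rightarrow> 'g set \<Rightarrow> 'g set set" where
  "above G Q = {H. subgroup H G \<and> Q \<subseteq> H}"

lemma above_insert: "above G (insert q Q) = above G {q} \<inter> above G Q"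
  by (auto simp: above_def)

lemma above_Un: "above G (P \<union> Q) = above G P \<inter> above G Q"
  by (auto simp: above_def)

text \<open>Taking both values of \<open>b\<close>, membership of a fixed element is a clopen
  condition on subgroups.\<close>

lemma openin_Sub_mem:
  assumes "g \<in> carrier G"
  shows "openin (Sub G) {H. subgroup H G \<and> (g \<in> H \<longleftrightarrow> b)}"
proof -
  let ?T = "product_topology (\<lambda>_. discrete_topology (UNIV :: bool set)) (carrier G)"
  have "continuous_map ?T (discrete_topology UNIV) (\<lambda>x. x g)"
    using assms by (rule continuous_map_product_projection)
  then have "openin ?T {x \<in> topspace ?T. x g \<in> {b}}"
    by (rule openin_continuous_map_preimage) simp
  then show ?thesis unfolding Sub_def openin_pullback_topology
    using assms by (intro exI[of _ "{x \<in> topspace ?T. x g \<in> {b}}"]) auto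
qed

text \<open>A basic open set of the product restricts only finitely many coordinates; these
  coordinates form \<open>Q\<close>.\<close>

lemma openin_Sub_cylinder:
  assumes "openin (Sub G) U" "H \<in> U"
  obtains Q where "finite Q" "Q \<subseteq> carrier G" "{K. subgroup K G \<and> K \<inter> Q = H \<inter> Q} \<subseteq> U"
proof -
  let ?T = "product_topology (\<lambda>_. discrete_topology (UNIV :: bool set)) (carrier G)"
  let ?f = "\<lambda>H. \<lambda>g\<in>carrier G. g \<in> H"
  obtain V where V: "openin ?T V" "U = ?f -` V \<inter> {H. subgroup H G}"
    using assms(1) by (auto simp: Sub_def openin_pullback_topology)
  then have "?f H \<in> V" using assms by auto
  then obtain W where W: "finite {i \<in> carrier G. W i \<noteq> UNIV}" "?f H \<in> Pi\<^sub>E (carrier G) W"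
      "Pi\<^sub>E (carrier G) W \<subseteq> V"
    using V(1) by (auto simp: openin_product_topology_alt)
  have PiW: "?f K \<in> Pi\<^sub>E (carrier G) W"
    if "subgroup K G" "K \<inter> {i \<in> carrier G. W i \<noteq> UNIV} = H \<inter> {i \<in> carrier G. W i \<noteq> UNIV}" for K
  proof (rule PiE_I)
    fix g assume g: "g \<in> carrier G"
    show "?f K g \<in> W g"
    proof (cases "W g = UNIV")
      case False
      then have "g \<in> K \<longleftrightarrow> g \<in> H" using that(2) g by blast
      moreover have "?f H g \<in> W g" using W(2) g by (rule PiE_mem)
      ultimately show ?thesis using g by simp
    qed simp
  qed simp
  have "{K. subgroup K G \<and> K \<inter> {i \<in> carrier G. W i \<noteq> UNIV} = H \<inter> {i \<in> carrier G. W i \<noteq> UNIV}} \<subseteq> U"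
    (is "?C \<subseteq> U")
  proof
    fix K assume K: "K \<in> ?C"
    then have "?f K \<in> V" using PiW W(3) by (simp only: mem_Collect_eq subset_iff)
    then show "K \<in> U" using K V(2) by (simp only: Int_iff vimage_eq mem_Collect_eq)
  qed
  then show thesis using W(1) by (intro that) auto
qed

text \<open>By Tychonoff the full power set is compact, and the subgroups form a closed subset,
  since each subgroup axiom involves at most three coordinates. Open covers of \<open>Sub G\<close>
  are preimages of open families in the product, so compactness comes back along the
  pullback.\<close>

lemma (in group) compact_space_Sub: "compact_space (Sub G)"
proof -
  let ?T = "product_topology (\<lambda>_. discrete_topology (UNIV :: bool set)) (carrier G)"
  let ?f = "\<lambda>H. \<lambda>g\<in>carrier G. g \<in> H"
  have T: "compact_space ?T"
    by (simp add: compact_space_product_topology compact_space_discrete_topology)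
  have op: "openin ?T {x \<in> topspace ?T. x g \<longleftrightarrow> b}" if "g \<in> carrier G" for g b
  proof -
    have "openin ?T {x \<in> topspace ?T. x g \<in> {b}}"
      using that by (intro openin_continuous_map_preimage[OF continuous_map_product_projection]) auto
    then show ?thesis by simp
  qed
  \<comment> \<open>The ways to fail the one-step subgroup test: omitting the identity, or
    containing \<open>g\<close> and \<open>h\<close> but not \<open>g \<otimes> inv h\<close>. Each
    is an open condition.\<close>
  let ?B = "{{x \<in> topspace ?T. \<not> x \<one>}} \<union>
    {{x \<in> topspace ?T. x g} \<inter> {x \<in> topspace ?T. x h} \<inter> {x \<in> topspace ?T. \<not> x (g \<otimes> inv h)}
       | g h. g \<in> carrier G \<and> h \<in> carrier G}"
  have "openin ?T (\<Union>?B)"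
  proof (rule openin_Union)
    fix B assume "B \<in> ?B"
    then show "openin ?T B"
      using op[of _ True] op[of _ False] by (auto intro!: openin_Int)
  qed
  then have cl: "closedin ?T (topspace ?T - \<Union>?B)"
    by (rule closedin_diff[OF closedin_topspace])
  have eq: "?f ` {H. subgroup H G} = topspace ?T - \<Union>?B"
  proof (intro equalityI subsetI)
    fix x assume "x \<in> topspace ?T - \<Union>?B"
    then have x: "x \<in> extensional (carrier G)" "x \<one>"
      "\<And>g h. g \<in> carrier G \<Longrightarrow> h \<in> carrier G \<Longrightarrow> x g \<Longrightarrow> x h \<Longrightarrow> x (g \<otimes> inv h)"
      by (auto simp: PiE_def)
    have "subgroup {g \<in> carrier G. x g} G"
    proof (rule subgroupI)
      fix g assume "g \<in> {g \<in> carrier G. x g}"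
      then show "inv g \<in> {g \<in> carrier G. x g}" using x(2) x(3)[of \<one> g] by auto
    next
      fix g h assume "g \<in> {g \<in> carrier G. x g}" "h \<in> {g \<in> carrier G. x g}"
      then show "g \<otimes> h \<in> {g \<in> carrier G. x g}"
        using x(2) x(3)[of \<one> h] x(3)[of g "inv h"] by auto
    qed (use x(2) in auto)
    moreover have "x = ?f {g \<in> carrier G. x g}"
      using x(1) by (auto simp: fun_eq_iff extensional_def)
    ultimately show "x \<in> ?f ` {H. subgroup H G}" by blast
  qed (auto simp: PiE_iff subgroup.one_closed subgroup.m_closed subgroup.m_inv_closed)
  have "closedin ?T (?f ` {H. subgroup H G})"
    unfolding eq by (rule cl)
  then have comp: "compactin ?T (?f ` {H. subgroup H G})"
    using T by (rule closedin_compact_space[rotated])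
  show ?thesis unfolding compact_space_def compactin_def
  proof (intro conjI allI impI)
    fix \<U> assume A: "Ball \<U> (openin (Sub G)) \<and> topspace (Sub G) \<subseteq> \<Union>\<U>"
    then have ex: "\<forall>U\<in>\<U>. \<exists>V. openin ?T V \<and> U = ?f -` V \<inter> {H. subgroup H G}"
      by (auto simp: Sub_def openin_pullback_topology)
    then obtain V where V: "\<And>U. U \<in> \<U> \<Longrightarrow> openin ?T (V U)"
        "\<And>U. U \<in> \<U> \<Longrightarrow> U = ?f -` V U \<inter> {H. subgroup H G}"
      by metis
    have "?f ` {H. subgroup H G} \<subseteq> \<Union>(V ` \<U>)"
    proof
      fix x assume "x \<in> ?f ` {H. subgroup H G}"
      then obtain H where H: "subgroup H G" "x = ?f H" by blast
      then obtain U where U: "U \<in> \<U>" "H \<in> U" using A by (auto simp: topspace_Sub)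
      then have "H \<in> ?f -` V U \<inter> {H. subgroup H G}" using V(2) by metis
      then have "x \<in> V U" using H(2) by (simp only: Int_iff vimage_eq)
      then show "x \<in> \<Union>(V ` \<U>)" using U(1) by blast
    qed
    then obtain \<F> where F: "finite \<F>" "\<F> \<subseteq> V ` \<U>" "?f ` {H. subgroup H G} \<subseteq> \<Union>\<F>"
      using V(1) compactinD[OF comp, of "V ` \<U>"] by blast
    then obtain \<U>' where U': "\<U>' \<subseteq> \<U>" "finite \<U>'" "\<F> = V ` \<U>'"
      using finite_subset_image by metis
    have "topspace (Sub G) \<subseteq> \<Union>\<U>'"
    proof
      fix H assume "H \<in> topspace (Sub G)"
      then have H: "subgroup H G" by (simp add: topspace_Sub)
      then obtain U where "U \<in> \<U>'" "?f H \<in> V U" using F(3) U'(3) by blast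
      moreover have "U = ?f -` V U \<inter> {H. subgroup H G}" using V(2) U'(1) calculation by blast
      ultimately show "H \<in> \<Union>\<U>'" using H by blast
    qed
    then show "\<exists>\<F>. finite \<F> \<and> \<F> \<subseteq> \<U> \<and> topspace (Sub G) \<subseteq> \<Union>\<F>"
      using U' by blast
  qed simp
qed

section \<open>Borel sets of the space of subgroups\<close>

lemma space_borel_of: "space (borel_of X) = topspace X"
  unfolding borel_of_def by (rule space_measure_of) (auto dest: openin_subset)

lemma sets_borel_of: "sets (borel_of X) = sigma_sets (topspace X) {U. openin X U}"
  unfolding borel_of_def by (rule sets_measure_of) (auto dest: openin_subset)

lemma openin_sets_borel_of: "openin X U \<Longrightarrow> U \<in> sets (borel_of X)"
  by (simp add: sets_borel_of)

lemma openin_above: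
  assumes "finite Q" "Q \<subseteq> carrier G"
  shows "openin (Sub G) (above G Q)"
  using assms
proof (induction Q)
  case empty
  have "above G {} = topspace (Sub G)" by (simp add: above_def topspace_Sub)
  then show ?case by simp
next
  case (insert q Q)
  have "openin (Sub G) (above G {q})"
    using openin_Sub_mem[of q G True] insert by (simp add: above_def)
  then show ?case using insert by (subst above_insert) (auto intro: openin_Int)
qed

lemma above_sets [measurable]:
  "finite Q \<Longrightarrow> Q \<subseteq> carrier G \<Longrightarrow> above G Q \<in> sets (borel_of (Sub G))"
  by (intro openin_sets_borel_of openin_above)

text \<open>A countable group has only countably many cylinders, so every open set is a countable
  union of them, and a cylinder is a finite Boolean combination of sets
  \<open>above G Q\<close>.\<close>

lemma sets_borel_of_Sub:
  assumes "countable (carrier G)"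
  shows "sets (borel_of (Sub G)) =
    sigma_sets {H. subgroup H G} {above G Q |Q. finite Q \<and> Q \<subseteq> carrier G}" (is "_ = ?\<Sigma>")
proof
  have "{above G Q |Q. finite Q \<and> Q \<subseteq> carrier G} \<subseteq> sets (borel_of (Sub G))"
    using above_sets by blast
  then show "?\<Sigma> \<subseteq> sets (borel_of (Sub G))"
    using sets.sigma_sets_subset[of _ "borel_of (Sub G)"]
    by (simp add: space_borel_of topspace_Sub)
next
  interpret \<Sigma>: sigma_algebra "{H. subgroup H G}" ?\<Sigma>
    by (rule sigma_algebra_sigma_sets) (auto simp: above_def)
  have ab: "above G Q \<in> ?\<Sigma>" if "finite Q" "Q \<subseteq> carrier G" for Q
    using that by (intro sigma_sets.Basic) auto
  have cyl: "{K. subgroup K G \<and> K \<inter> Q = R} \<in> ?\<Sigma>"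
    if "finite Q" "Q \<subseteq> carrier G" "R \<subseteq> Q" for Q R
  proof -
    have "(\<Union>q\<in>Q - R. above G {q}) \<in> ?\<Sigma>"
      using that by (intro \<Sigma>.finite_UN ab) auto
    moreover have "{K. subgroup K G \<and> K \<inter> Q = R} = above G R - (\<Union>q\<in>Q - R. above G {q})"
      using that by (auto simp: above_def)
    ultimately show ?thesis using that ab[of R] by (auto intro: finite_subset)
  qed
  have "U \<in> ?\<Sigma>" if U: "openin (Sub G) U" for U
  proof -
    let ?I = "{(Q, R). finite Q \<and> Q \<subseteq> carrier G \<and> R \<subseteq> Q \<and> {K. subgroup K G \<and> K \<inter> Q = R} \<subseteq> U}"
    have "countable {Q. finite Q \<and> Q \<subseteq> carrier G}"
      using countable_Collect_finite_subset[OF assms] by (simp add: conj_commute)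
    then have "countable ({Q. finite Q \<and> Q \<subseteq> carrier G} \<times> {Q. finite Q \<and> Q \<subseteq> carrier G})"
      by (intro countable_SIGMA)
    then have "countable ?I"
      by (rule countable_subset[rotated]) (auto intro: finite_subset)
    then have "(\<Union>(Q, R)\<in>?I. {K. subgroup K G \<and> K \<inter> Q = R}) \<in> ?\<Sigma>"
      by (intro \<Sigma>.countable_UN') (auto intro: cyl)
    moreover have "(\<Union>(Q, R)\<in>?I. {K. subgroup K G \<and> K \<inter> Q = R}) = U"
    proof (intro equalityI subsetI)
      fix H assume H: "H \<in> U"
      then have sH: "subgroup H G" using openin_subset[OF U] by (auto simp: topspace_Sub)
      obtain Q where "finite Q" "Q \<subseteq> carrier G" "{K. subgroup K G \<and> K \<inter> Q = H \<inter> Q} \<subseteq> U"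
        using openin_Sub_cylinder[OF U H] by blast
      then have "(Q, H \<inter> Q) \<in> ?I" by auto
      then show "H \<in> (\<Union>(Q, R)\<in>?I. {K. subgroup K G \<and> K \<inter> Q = R})" using sH by blast
    qed auto
    ultimately show ?thesis by simp
  qed
  then show "sets (borel_of (Sub G)) \<subseteq> ?\<Sigma>"
    unfolding sets_borel_of topspace_Sub by (intro \<Sigma>.sigma_sets_subset) auto
qed

text \<open>The generators \<open>above G Q\<close> are finite intersections of single membership
  events, so a random subgroup is measurable as soon as those events are.\<close>

lemma measurable_borel_of_Sub:
  assumes "countable (carrier G)"
    and "\<And>x. x \<in> space M \<Longrightarrow> subgroup (f x) G"
    and "\<And>g. g \<in> carrier G \<Longrightarrow> {x \<in> space M. g \<in> f x} \<in> sets M"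
  shows "f \<in> measurable M (borel_of (Sub G))"
proof (rule measurable_sigma_sets[OF sets_borel_of_Sub[OF assms(1)]])
  fix A assume "A \<in> {above G Q |Q. finite Q \<and> Q \<subseteq> carrier G}"
  then obtain Q where Q: "A = above G Q" "finite Q" "Q \<subseteq> carrier G" by blast
  have "f -` A \<inter> space M = {x \<in> space M. \<forall>q\<in>Q. q \<in> f x}"
    using assms(2) Q by (auto simp: above_def)
  also have "\<dots> \<in> sets M"
    using Q assms(3) by (intro sets.sets_Collect_finite_All) auto
  finally show "f -` A \<inter> space M \<in> sets M" .
qed (use assms in \<open>auto simp: above_def\<close>)

text \<open>By \<open>above_Un\<close> the generators are stable under intersection, so the
  uniqueness theorem for measures applies.\<close>

lemma measure_eq_above:
  assumes "countable (carrier G)" "prob_space \<mu>" "prob_space \<mu>'"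
    and "sets \<mu> = sets (borel_of (Sub G))" "sets \<mu>' = sets (borel_of (Sub G))"
    and "\<And>Q. finite Q \<Longrightarrow> Q \<subseteq> carrier G \<Longrightarrow> measure \<mu> (above G Q) = measure \<mu>' (above G Q)"
  shows "\<mu> = \<mu>'"
proof -
  interpret \<mu>: prob_space \<mu> by fact
  interpret \<mu>': prob_space \<mu>' by fact
  let ?E = "{above G Q |Q. finite Q \<and> Q \<subseteq> carrier G}"
  have top: "{H. subgroup H G} = above G {}" by (simp add: above_def)
  show ?thesis
  proof (rule measure_eqI_generator_eq[where E = ?E and \<Omega> = "{H. subgroup H G}" and A = "\<lambda>_. above G {}"])
    show "Int_stable ?E"
    proof (rule Int_stableI)
      fix A B assume "A \<in> ?E" "B \<in> ?E"
      then obtain P Q where "A = above G P" "B = above G Q" "finite (P \<union> Q)" "P \<union> Q \<subseteq> carrier G"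
        by auto
      then show "A \<inter> B \<in> ?E" by (metis (mono_tags, lifting) above_Un mem_Collect_eq)
    qed
    show "sets \<mu> = sigma_sets {H. subgroup H G} ?E" "sets \<mu>' = sigma_sets {H. subgroup H G} ?E"
      using assms sets_borel_of_Sub[OF assms(1)] by simp_all
    show "\<And>X. X \<in> ?E \<Longrightarrow> emeasure \<mu> X = emeasure \<mu>' X"
      using assms(6) by (auto simp: \<mu>.emeasure_eq_measure \<mu>'.emeasure_eq_measure)
  qed (auto simp: above_def intro!: exI[of _ "{}"])
qed

section \<open>Conjugation, regularity and invariance\<close>

lemma (in group) inv_mult_cancel_left:
  assumes "g \<in> carrier G" "h \<in> carrier G"
  shows "inv g \<otimes> (g \<otimes> h) = h" "g \<otimes> (inv g \<otimes> h) = h"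
  using assms by (simp_all flip: m_assoc)

lemma (in group) mem_conjugate_iff:
  assumes "H \<subseteq> carrier G" "g \<in> carrier G" "x \<in> carrier G"
  shows "x \<in> g <# H #> inv g \<longleftrightarrow> inv g \<otimes> x \<otimes> g \<in> H"
proof
  assume "x \<in> g <# H #> inv g"
  then obtain h where h: "h \<in> H" "x = g \<otimes> h \<otimes> inv g" by (auto simp: l_coset_def r_coset_def)
  then have "inv g \<otimes> x \<otimes> g = h"
    using assms by (simp add: subset_iff m_assoc inv_mult_cancel_left)
  then show "inv g \<otimes> x \<otimes> g \<in> H" using h assms by (simp add: subset_iff)
next
  assume h: "inv g \<otimes> x \<otimes> g \<in> H"
  have "x = g \<otimes> (inv g \<otimes> x \<otimes> g) \<otimes> inv g"
    using assms by (simp add: m_assoc inv_mult_cancel_left)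
  then show "x \<in> g <# H #> inv g" using h by (auto simp: l_coset_def r_coset_def)
qed

lemma (in group) conjugate_subset:
  assumes "H \<subseteq> carrier G" "g \<in> carrier G"
  shows "g <# H #> inv g \<subseteq> carrier G"
  using assms by (auto simp: l_coset_def r_coset_def)

lemma (in group) subgroup_conjugate:
  assumes H: "subgroup H G" and g: "g \<in> carrier G"
  shows "subgroup (g <# H #> inv g) G"
proof -
  have HG: "H \<subseteq> carrier G" using H by (rule subgroup.subset)
  note mem = mem_conjugate_iff[OF HG g]
  note sub = conjugate_subset[OF HG g]
  show ?thesis
  proof (rule subgroupI)
    have "\<one> \<in> g <# H #> inv g"
      using mem[of \<one>] g H by (simp add: subgroup.one_closed)
    then show "g <# H #> inv g \<noteq> {}" by blast
    fix a assume a: "a \<in> g <# H #> inv g"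
    then have aG: "a \<in> carrier G" using sub by blast
    then have "inv g \<otimes> inv a \<otimes> g = inv (inv g \<otimes> a \<otimes> g)"
      using g by (simp add: inv_mult_group m_assoc)
    then show "inv a \<in> g <# H #> inv g"
      using mem[of a] mem[of "inv a"] a aG H by (simp add: subgroup.m_inv_closed)
    fix b assume b: "b \<in> g <# H #> inv g"
    then have bG: "b \<in> carrier G" using sub by blast
    have "inv g \<otimes> (a \<otimes> b) \<otimes> g = (inv g \<otimes> a \<otimes> g) \<otimes> (inv g \<otimes> b \<otimes> g)"
      using g aG bG by (simp add: m_assoc inv_mult_cancel_left)
    then show "a \<otimes> b \<in> g <# H #> inv g"
      using mem[of a] mem[of b] mem[of "a \<otimes> b"] a b aG bG H by (simp add: subgroup.m_closed)
  qed (rule sub)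
qed

lemma continuous_map_of_bool:
  assumes "openin X {x \<in> topspace X. P x}" "openin X {x \<in> topspace X. \<not> P x}"
  shows "continuous_map X euclideanreal (\<lambda>x. of_bool (P x))"
proof (rule continuous_map[THEN iffD2], intro conjI allI impI)
  fix U :: "real set"
  have "{x \<in> topspace X. of_bool (P x) \<in> U} =
    (if 1 \<in> U then {x \<in> topspace X. P x} else {}) \<union> (if 0 \<in> U then {x \<in> topspace X. \<not> P x} else {})"
    by auto
  then show "openin X {x \<in> topspace X. of_bool (P x) \<in> U}" using assms by auto
qed auto

text \<open>Regularity is inherited from sequence space. An enumeration of the group turns a
  subgroup into a 0-1 sequence; finite Borel measures on the Polish space of real sequences are
  regular, and both kinds of approximation pull back along the continuous coding
  \<open>E\<close>.\<close>

lemma (in group) regular_measure_Sub: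
  assumes "countable (carrier G)" "prob_space \<mu>" and sets: "sets \<mu> = sets (borel_of (Sub G))"
  shows "regular_measure (Sub G) \<mu>"
proof -
  interpret prob_space \<mu> by fact
  define e where "e = from_nat_into (carrier G)"
  have e: "e i \<in> carrier G" "\<And>g. g \<in> carrier G \<Longrightarrow> \<exists>i. e i = g" for i
    unfolding e_def using assms(1) one_closed
    by (auto intro: from_nat_into from_nat_into_surj)
  define E :: "'a set \<Rightarrow> nat \<Rightarrow> real" where "E = (\<lambda>H i. of_bool (e i \<in> H))"
  define \<Omega> where "\<Omega> = {H. subgroup H G}"
  have sp: "space \<mu> = \<Omega>"
    using sets_eq_imp_space_eq[OF sets] by (simp add: space_borel_of topspace_Sub \<Omega>_def)
  have "continuous_map (Sub G) euclidean (\<lambda>H. E H)"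
    unfolding euclidean_product_topology[symmetric] continuous_map_componentwise_UNIV E_def
    using openin_Sub_mem[OF e(1), of _ True] openin_Sub_mem[OF e(1), of _ False]
    by (intro allI continuous_map_of_bool) (auto simp: topspace_Sub)
  then have opV: "openin (Sub G) (E -` V \<inter> \<Omega>)" if "open V" for V
    using that openin_continuous_map_preimage[of "Sub G" euclidean E V]
    by (simp add: topspace_Sub \<Omega>_def Collect_conj_eq Int_commute vimage_def)
  have mE: "E \<in> borel_measurable \<mu>"
  proof (rule borel_measurableI)
    fix V :: "(nat \<Rightarrow> real) set" assume "open V"
    then show "E -` V \<inter> space \<mu> \<in> sets \<mu>"
      unfolding sp sets by (intro openin_sets_borel_of opV)
  qed
  \<comment> \<open>Containing a finite set is read off from finitely many coordinates of
    \<open>E\<close>, so the generators, and with them all measurable sets, are preimages of Borel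
    sets.\<close>
  have "sets \<mu> \<subseteq> sets (vimage_algebra \<Omega> E borel)"
    unfolding sets sets_borel_of_Sub[OF assms(1)]
  proof -
    have "above G Q \<in> sets (vimage_algebra \<Omega> E borel)" if Q: "finite Q" "Q \<subseteq> carrier G" for Q
    proof -
      have "\<forall>q\<in>Q. \<exists>i. e i = q" using e(2) Q by blast
      then obtain i where i: "\<And>q. q \<in> Q \<Longrightarrow> e (i q) = q" by metis
      have "above G Q = E -` {x. \<forall>q\<in>Q. x (i q) = 1} \<inter> \<Omega>"
        using i by (auto simp: above_def \<Omega>_def E_def)
      moreover have "{x \<in> space borel. \<forall>q\<in>Q. x (i q) = (1::real)} \<in> sets borel"
        using Q by (intro sets.sets_Collect_finite_All) auto
      ultimately show ?thesis using in_vimage_algebra[of "{x. \<forall>q\<in>Q. x (i q) = 1}" borel E \<Omega>] by simp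
    qed
    then show "sigma_sets {H. subgroup H G} {above G Q |Q. finite Q \<and> Q \<subseteq> carrier G}
        \<subseteq> sets (vimage_algebra \<Omega> E borel)"
      using sets.sigma_sets_subset[of "{above G Q |Q. finite Q \<and> Q \<subseteq> carrier G}" "vimage_algebra \<Omega> E borel"]
      unfolding \<Omega>_def space_vimage_algebra by blast
  qed
  then have ex: "\<exists>B\<in>sets borel. A = E -` B \<inter> \<Omega>" if "A \<in> sets \<mu>" for A
    using that by (subst (asm) sets_vimage_algebra2) auto
  define N where "N = distr \<mu> borel E"
  interpret N: prob_space N unfolding N_def by (rule prob_space_distr[OF mE])
  have N: "emeasure N B = emeasure \<mu> (E -` B \<inter> \<Omega>)" if "B \<in> sets borel" for B
    using that by (simp add: N_def emeasure_distr mE sp)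
  have Ns: "sets N = sets borel" by (simp add: N_def)
  show ?thesis unfolding regular_measure_def
  proof (intro conjI ballI)
    fix A assume "A \<in> sets \<mu>"
    then obtain B where B: "B \<in> sets borel" "A = E -` B \<inter> \<Omega>" using ex by blast
    show "emeasure \<mu> A = (INF U\<in>{U. openin (Sub G) U \<and> A \<subseteq> U}. emeasure \<mu> U)"
    proof (rule antisym)
      show "emeasure \<mu> A \<le> (INF U\<in>{U. openin (Sub G) U \<and> A \<subseteq> U}. emeasure \<mu> U)"
        by (rule INF_greatest) (auto intro!: emeasure_mono simp: sets openin_sets_borel_of)
      have "(INF U\<in>{U. openin (Sub G) U \<and> A \<subseteq> U}. emeasure \<mu> U)
          \<le> (INF V\<in>{V. B \<subseteq> V \<and> open V}. emeasure N V)"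
      proof (rule INF_mono)
        fix V assume V: "V \<in> {V. B \<subseteq> V \<and> open V}"
        then show "\<exists>U\<in>{U. openin (Sub G) U \<and> A \<subseteq> U}. emeasure \<mu> U \<le> emeasure N V"
          using B opV by (intro bexI[of _ "E -` V \<inter> \<Omega>"]) (auto simp: N)
      qed
      also have "\<dots> = emeasure N B"
        using outer_regular[of N B] B(1) Ns by simp
      also have "\<dots> = emeasure \<mu> A" using B by (simp add: N)
      finally show "(INF U\<in>{U. openin (Sub G) U \<and> A \<subseteq> U}. emeasure \<mu> U) \<le> emeasure \<mu> A" .
    qed
    show "emeasure \<mu> A = (SUP K\<in>{K. compactin (Sub G) K \<and> K \<subseteq> A}. emeasure \<mu> K)"
    proof (rule antisym)
      show "(SUP K\<in>{K. compactin (Sub G) K \<and> K \<subseteq> A}. emeasure \<mu> K) \<le> emeasure \<mu> A"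
        using \<open>A \<in> sets \<mu>\<close> by (intro SUP_least emeasure_mono) auto
      have "emeasure \<mu> A = emeasure N B" using B by (simp add: N)
      also have "\<dots> = (SUP K\<in>{K. K \<subseteq> B \<and> compact K}. emeasure N K)"
        using inner_regular[of N B] B(1) Ns by simp
      also have "\<dots> \<le> (SUP K\<in>{K. compactin (Sub G) K \<and> K \<subseteq> A}. emeasure \<mu> K)"
      proof (rule SUP_mono)
        fix K assume K: "K \<in> {K. K \<subseteq> B \<and> compact K}"
        then have cl: "closed K" by (simp add: compact_imp_closed)
        \<comment> \<open>The preimage of a compact set is closed, and closed subsets of the compact
          space \<open>Sub G\<close> are compact.\<close>
        have "E -` K \<inter> \<Omega> = topspace (Sub G) - (E -` (- K) \<inter> \<Omega>)"
          by (auto simp: topspace_Sub \<Omega>_def)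
        then have "closedin (Sub G) (E -` K \<inter> \<Omega>)"
          using opV[of "- K"] cl closedin_diff[OF closedin_topspace] by (simp add: open_Compl)
        then have "compactin (Sub G) (E -` K \<inter> \<Omega>)"
          by (rule closedin_compact_space[OF compact_space_Sub])
        then show "\<exists>K'\<in>{K. compactin (Sub G) K \<and> K \<subseteq> A}. emeasure N K \<le> emeasure \<mu> K'"
          using K B cl by (intro bexI[of _ "E -` K \<inter> \<Omega>"]) (auto simp: N)
      qed
      finally show "emeasure \<mu> A \<le> (SUP K\<in>{K. compactin (Sub G) K \<and> K \<subseteq> A}. emeasure \<mu> K)" .
    qed
  qed
qed

lemma (in group) measurable_conjugate:
  assumes "countable (carrier G)" "g \<in> carrier G"
  shows "(\<lambda>H. g <# H #> inv g) \<in> measurable (borel_of (Sub G)) (borel_of (Sub G))"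
proof (rule measurable_borel_of_Sub[OF assms(1)])
  fix H assume "H \<in> space (borel_of (Sub G))"
  then show "subgroup (g <# H #> inv g) G"
    using assms by (auto simp: space_borel_of topspace_Sub intro: subgroup_conjugate)
next
  fix x assume x: "x \<in> carrier G"
  have "{H \<in> space (borel_of (Sub G)). x \<in> g <# H #> inv g} = above G {inv g \<otimes> x \<otimes> g}"
    using assms x by (auto simp: space_borel_of topspace_Sub above_def mem_conjugate_iff[OF subgroup.subset])
  then show "{H \<in> space (borel_of (Sub G)). x \<in> g <# H #> inv g} \<in> sets (borel_of (Sub G))"
    using assms x by simp
qed

lemma (in group) conjugate_vimage_above:
  assumes "g \<in> carrier G" "Q \<subseteq> carrier G"
  shows "(\<lambda>H. g <# H #> inv g) -` above G Q \<inter> {H. subgroup H G} =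
    above G ((\<lambda>q. inv g \<otimes> q \<otimes> g) ` Q)"
  using assms
  by (auto simp: above_def mem_conjugate_iff[OF subgroup.subset] subset_iff subgroup_conjugate)

lemma space_eq_subgroups:
  "sets \<mu> = sets (borel_of (Sub G)) \<Longrightarrow> space \<mu> = {H. subgroup H G}"
  using sets_eq_imp_space_eq[of \<mu>] by (simp add: space_borel_of topspace_Sub)

text \<open>Conjugation pulls \<open>above G Q\<close> back to \<open>above\<close> of a conjugate
  of \<open>Q\<close>, and these sets determine the measure. Invariance thus becomes a family of
  equations between inclusion probabilities, a form that passes to limits.\<close>

lemma (in group) IRS_iff:
  assumes "countable (carrier G)"
  shows "\<mu> \<in> IRS G \<longleftrightarrow> prob_space \<mu> \<and> sets \<mu> = sets (borel_of (Sub G)) \<and>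
    (\<forall>g\<in>carrier G. \<forall>Q. finite Q \<and> Q \<subseteq> carrier G \<longrightarrow>
       measure \<mu> (above G ((\<lambda>q. inv g \<otimes> q \<otimes> g) ` Q)) = measure \<mu> (above G Q))"
proof -
  have "distr \<mu> (borel_of (Sub G)) (\<lambda>H. g <# H #> inv g) = \<mu> \<longleftrightarrow>
     (\<forall>Q. finite Q \<and> Q \<subseteq> carrier G \<longrightarrow>
       measure \<mu> (above G ((\<lambda>q. inv g \<otimes> q \<otimes> g) ` Q)) = measure \<mu> (above G Q))" (is "?D = \<mu> \<longleftrightarrow> _")
    if g: "g \<in> carrier G" and \<mu>: "prob_space \<mu>" and sets: "sets \<mu> = sets (borel_of (Sub G))" for g
  proof -
    interpret prob_space \<mu> by fact
    note sp = space_eq_subgroups[OF sets]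
    have m: "(\<lambda>H. g <# H #> inv g) \<in> measurable \<mu> (borel_of (Sub G))"
      using measurable_conjugate[OF assms g] sets by (simp cong: measurable_cong_sets)
    have D: "measure ?D (above G Q) = measure \<mu> (above G ((\<lambda>q. inv g \<otimes> q \<otimes> g) ` Q))"
      if "finite Q" "Q \<subseteq> carrier G" for Q
      using that conjugate_vimage_above[OF g, of Q] by (simp add: measure_distr[OF m] sp)
    show ?thesis
    proof
      assume "?D = \<mu>" then show "\<forall>Q. finite Q \<and> Q \<subseteq> carrier G \<longrightarrow>
       measure \<mu> (above G ((\<lambda>q. inv g \<otimes> q \<otimes> g) ` Q)) = measure \<mu> (above G Q)"
        using D by metis
    next
      assume "\<forall>Q. finite Q \<and> Q \<subseteq> carrier G \<longrightarrow>
       measure \<mu> (above G ((\<lambda>q. inv g \<otimes> q \<otimes> g) ` Q)) = measure \<mu> (above G Q)"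
      then show "?D = \<mu>"
        by (intro measure_eq_above[OF assms] prob_space_distr m \<mu>) (auto simp: D sets)
    qed
  qed
  then show ?thesis unfolding IRS_def using regular_measure_Sub[OF assms] by auto
qed

section \<open>Weak-* convergence as convergence of inclusion probabilities\<close>

lemma limitin_pullback:
  "limitin (pullback_topology A f T) s l F \<longleftrightarrow>
     l \<in> A \<and> eventually (\<lambda>n. s n \<in> A) F \<and> limitin T (f \<circ> s) (f l) F"
proof safe
  assume L: "limitin (pullback_topology A f T) s l F"
  then have l: "l \<in> A" "f l \<in> topspace T"
    by (auto simp: limitin_def topspace_pullback_topology)
  then show "l \<in> A" by simp
  have top: "openin (pullback_topology A f T) (f -` U \<inter> A)" if "openin T U" for U
    using that by (auto simp: openin_pullback_topology)
  have "eventually (\<lambda>n. s n \<in> f -` topspace T \<inter> A) F"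
    using L top[OF openin_topspace] l by (auto simp: limitin_def)
  then show "eventually (\<lambda>n. s n \<in> A) F" by (rule eventually_mono) simp
  show "limitin T (f \<circ> s) (f l) F"
    unfolding limitin_def
  proof (intro conjI allI impI)
    fix U assume "openin T U \<and> f l \<in> U"
    then have "eventually (\<lambda>n. s n \<in> f -` U \<inter> A) F"
      using L top[of U] l by (auto simp: limitin_def)
    then show "eventually (\<lambda>n. (f \<circ> s) n \<in> U) F" by (rule eventually_mono) simp
  qed (use l in simp)
next
  assume A: "l \<in> A" "eventually (\<lambda>n. s n \<in> A) F" "limitin T (f \<circ> s) (f l) F"
  show "limitin (pullback_topology A f T) s l F"
    unfolding limitin_def
  proof (intro conjI allI impI)
    show "l \<in> topspace (pullback_topology A f T)"
      using A by (auto simp: topspace_pullback_topology limitin_def)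
    fix U assume "openin (pullback_topology A f T) U \<and> l \<in> U"
    then obtain V where V: "openin T V" "U = f -` V \<inter> A" "f l \<in> V"
      by (auto simp: openin_pullback_topology)
    then have "eventually (\<lambda>n. f (s n) \<in> V) F" using A(3) by (auto simp: limitin_def)
    with A(2) show "eventually (\<lambda>n. s n \<in> U) F"
      by eventually_elim (use V in auto)
  qed
qed

lemma limitin_IRS_iff_integral:
  "limitin (IRS_topology G) \<mu>s \<mu> sequentially \<longleftrightarrow>
     \<mu> \<in> IRS G \<and> eventually (\<lambda>n. \<mu>s n \<in> IRS G) sequentially \<and>
     (\<forall>f. continuous_map (Sub G) euclideanreal f \<longrightarrow>
        (\<lambda>n. integral\<^sup>L (\<mu>s n) f) \<longlonglongrightarrow> integral\<^sup>L \<mu> f)"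
  unfolding IRS_topology_def Let_def limitin_pullback limitin_componentwise
  by (auto simp: comp_def)

lemma openin_Sub_cylinder_set:
  assumes "finite Q" "Q \<subseteq> carrier G"
  shows "openin (Sub G) {K. subgroup K G \<and> K \<inter> Q = H \<inter> Q}"
proof (cases "Q = {}")
  case True
  then show ?thesis using openin_topspace[of "Sub G"] by (simp add: topspace_Sub)
next
  case False
  have "openin (Sub G) (\<Inter>q\<in>Q. {K. subgroup K G \<and> (q \<in> K \<longleftrightarrow> q \<in> H)})"
  proof (rule openin_Inter)
    fix U assume "U \<in> (\<lambda>q. {K. subgroup K G \<and> (q \<in> K \<longleftrightarrow> q \<in> H)}) ` Q"
    then obtain q where "q \<in> Q" "U = {K. subgroup K G \<and> (q \<in> K \<longleftrightarrow> q \<in> H)}" by blast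
    then show "openin (Sub G) U" using openin_Sub_mem[of q G "q \<in> H"] assms by auto
  qed (use assms False in auto)
  moreover have "(\<Inter>q\<in>Q. {K. subgroup K G \<and> (q \<in> K \<longleftrightarrow> q \<in> H)}) =
      {K. subgroup K G \<and> K \<inter> Q = H \<inter> Q}"
    using False by auto
  ultimately show ?thesis by simp
qed

text \<open>Each subgroup has a cylinder on which \<open>f\<close> stays within \<epsilon>/2 of its
  value there. Finitely many of these cylinders cover the compact space, and the union of their
  windows works for all subgroups.\<close>

lemma (in group) uniformly_continuous_Sub:
  assumes f: "continuous_map (Sub G) euclideanreal f" and "\<epsilon> > 0"
  shows "\<exists>Q. finite Q \<and> Q \<subseteq> carrier G \<and>
    (\<forall>H K. subgroup H G \<longrightarrow> subgroup K G \<longrightarrow> H \<inter> Q = K \<inter> Q \<longrightarrow> \<bar>f H - f K\<bar> < \<epsilon>)"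
proof -
  define C where "C H Q = {K. subgroup K G \<and> K \<inter> Q = H \<inter> Q}" for H Q
  define D where "D H = {K \<in> topspace (Sub G). f K \<in> ball (f H) (\<epsilon> / 2)}" for H
  have "\<forall>H\<in>{H. subgroup H G}. \<exists>Q. finite Q \<and> Q \<subseteq> carrier G \<and> C H Q \<subseteq> D H"
  proof
    fix H assume "H \<in> {H. subgroup H G}"
    then have H: "subgroup H G" by simp
    have op: "openin (Sub G) (D H)"
      unfolding D_def by (rule openin_continuous_map_preimage[OF f]) simp
    have "H \<in> D H"
      using H \<open>\<epsilon> > 0\<close> by (simp add: topspace_Sub D_def)
    from openin_Sub_cylinder[OF op this]
    obtain Q where "finite Q" "Q \<subseteq> carrier G" "C H Q \<subseteq> D H" unfolding C_def .
    then show "\<exists>Q. finite Q \<and> Q \<subseteq> carrier G \<and> C H Q \<subseteq> D H"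
      by (intro exI conjI)
  qed
  from bchoice[OF this] obtain Q where
    Q0: "\<forall>H\<in>{H. subgroup H G}. finite (Q H) \<and> Q H \<subseteq> carrier G \<and> C H (Q H) \<subseteq> D H" ..
  then have Q: "finite (Q H)" "Q H \<subseteq> carrier G" "C H (Q H) \<subseteq> D H" if "subgroup H G" for H
    using that by simp_all
  have "\<exists>\<F>. finite \<F> \<and> \<F> \<subseteq> (\<lambda>H. C H (Q H)) ` {H. subgroup H G} \<and> topspace (Sub G) \<subseteq> \<Union>\<F>"
  proof (rule compactinD[OF compact_space_Sub[unfolded compact_space_def]])
    fix U assume "U \<in> (\<lambda>H. C H (Q H)) ` {H. subgroup H G}"
    then obtain H where "subgroup H G" "U = C H (Q H)" by blast
    then show "openin (Sub G) U" using openin_Sub_cylinder_set[OF Q(1,2), of H H] by (simp add: C_def)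
  qed (auto simp: topspace_Sub C_def)
  then obtain \<F> where F: "finite \<F>" "\<F> \<subseteq> (\<lambda>H. C H (Q H)) ` {H. subgroup H G}" "topspace (Sub G) \<subseteq> \<Union>\<F>"
    by blast
  obtain \<H> where H: "finite \<H>" "\<H> \<subseteq> {H. subgroup H G}" "\<F> = (\<lambda>H. C H (Q H)) ` \<H>"
    using finite_subset_image[OF F(1,2)] by blast
  show ?thesis
  proof (intro exI[of _ "\<Union>(Q ` \<H>)"] conjI allI impI)
    fix K L assume KL: "subgroup K G" "subgroup L G" "K \<inter> \<Union>(Q ` \<H>) = L \<inter> \<Union>(Q ` \<H>)"
    then have "K \<in> topspace (Sub G)" by (simp add: topspace_Sub)
    then obtain H where "H \<in> \<H>" and K: "K \<in> C H (Q H)" using H(3) F(3) by blast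
    have "K \<inter> Q H = L \<inter> Q H" using KL(3) \<open>H \<in> \<H>\<close> by auto
    then have "L \<in> C H (Q H)" using KL(2) K by (simp add: C_def)
    moreover have "C H (Q H) \<subseteq> D H" using Q(3) H(2) \<open>H \<in> \<H>\<close> by auto
    ultimately have "K \<in> D H" "L \<in> D H" using K by auto
    then have "\<bar>f H - f K\<bar> < \<epsilon> / 2" "\<bar>f H - f L\<bar> < \<epsilon> / 2"
      by (simp_all add: D_def dist_real_def)
    then show "\<bar>f K - f L\<bar> < \<epsilon>" by linarith
  next
    show "finite (\<Union>(Q ` \<H>))" using H(1,2) Q(1) by auto
    show "\<Union>(Q ` \<H>) \<subseteq> carrier G" using H(2) Q(2) by auto
  qed
qed

text \<open>One direction tests against the indicator of \<open>above G Q\<close>, which is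
  continuous because the set is clopen. Conversely, inclusion-exclusion gives convergence on all
  cylinders, and every continuous function is uniformly close to a finite combination of cylinder
  indicators.\<close>

lemma (in group) limitin_IRS_iff:
  assumes "countable (carrier G)"
  shows "limitin (IRS_topology G) \<mu>s \<mu> sequentially \<longleftrightarrow>
    \<mu> \<in> IRS G \<and> eventually (\<lambda>n. \<mu>s n \<in> IRS G) sequentially \<and>
    (\<forall>Q. finite Q \<and> Q \<subseteq> carrier G \<longrightarrow>
       (\<lambda>n. measure (\<mu>s n) (above G Q)) \<longlonglongrightarrow> measure \<mu> (above G Q))" (is "?L \<longleftrightarrow> ?R")
proof
  assume L: ?L
  note L' = L[unfolded limitin_IRS_iff_integral]
  note L1 = conjunct1[OF L'] and L2 = conjunct1[OF conjunct2[OF L']] and L3 = conjunct2[OF conjunct2[OF L']]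
  have L4: "(\<lambda>n. measure (\<mu>s n) (above G Q)) \<longlonglongrightarrow> measure \<mu> (above G Q)"
    if Q: "finite Q" "Q \<subseteq> carrier G" for Q
  proof -
    have cl: "openin (Sub G) {H \<in> topspace (Sub G). \<not> Q \<subseteq> H}"
    proof -
      have "{H \<in> topspace (Sub G). \<not> Q \<subseteq> H} = (\<Union>q\<in>Q. {H. subgroup H G \<and> (q \<in> H \<longleftrightarrow> False)})"
        by (auto simp: topspace_Sub)
      also have "openin (Sub G) \<dots>"
        using Q openin_Sub_mem[of _ G False] by (intro openin_Union) auto
      finally show ?thesis .
    qed
    have "openin (Sub G) {H \<in> topspace (Sub G). Q \<subseteq> H}"
      using openin_above[OF Q] by (simp add: above_def topspace_Sub)
    then have cont: "continuous_map (Sub G) euclideanreal (\<lambda>H. of_bool (Q \<subseteq> H))"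
      using cl by (rule continuous_map_of_bool)
    have lim: "(\<lambda>n. integral\<^sup>L (\<mu>s n) (\<lambda>H. of_bool (Q \<subseteq> H) :: real)) \<longlonglongrightarrow> integral\<^sup>L \<mu> (\<lambda>H. of_bool (Q \<subseteq> H) :: real)"
      using L3[rule_format, OF cont] .
    have int: "integral\<^sup>L \<nu> (\<lambda>H. of_bool (Q \<subseteq> H) :: real) = measure \<nu> (above G Q)" if "\<nu> \<in> IRS G" for \<nu> :: "'a set measure"
    proof -
      have sets: "sets \<nu> = sets (borel_of (Sub G))" using that by (simp add: IRS_def)
      have "integral\<^sup>L \<nu> (\<lambda>H. of_bool (Q \<subseteq> H) :: real) = integral\<^sup>L \<nu> (indicator (above G Q))"
        by (rule Bochner_Integration.integral_cong)
           (auto simp: space_eq_subgroups[OF sets] above_def indicator_def)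
      also have "\<dots> = measure \<nu> (above G Q)"
        using space_eq_subgroups[OF sets] by (simp add: above_def Int_absorb2 subset_iff)
      finally show ?thesis .
    qed
    have "eventually (\<lambda>n. integral\<^sup>L (\<mu>s n) (\<lambda>H. of_bool (Q \<subseteq> H) :: real) = measure (\<mu>s n) (above G Q)) sequentially"
      using L2 by (rule eventually_mono) (rule int)
    then have "(\<lambda>n. measure (\<mu>s n) (above G Q)) \<longlonglongrightarrow> integral\<^sup>L \<mu> (\<lambda>H. of_bool (Q \<subseteq> H) :: real)"
      using lim by (rule Lim_transform_eventually[rotated])
    then show ?thesis
      by (simp add: int[OF L1])
  qed
  show ?R using L1 L2 L4 by blast
next
  assume R: ?R
  \<comment> \<open>The measures lie in \<open>IRS G\<close> only eventually; the shifted sequence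
    \<open>ms\<close> lies there throughout, so that every cylinder below is measurable.\<close>
  then obtain n0 where n0: "\<And>n. n \<ge> n0 \<Longrightarrow> \<mu>s n \<in> IRS G" by (auto simp: eventually_sequentially)
  define ms where "ms n = \<mu>s (n + n0)" for n
  have ms: "ms n \<in> IRS G" for n using n0 by (simp add: ms_def)
  define B where "B S T = {H. subgroup H G \<and> S \<subseteq> H \<and> H \<inter> T = {}}" for S T
  let ?P = "\<lambda>\<nu> S T. measure \<nu> (B S T)"
  have meas: "B S T \<in> sets \<nu>"
    if "\<nu> \<in> IRS G" "finite S" "finite T" "S \<subseteq> carrier G" "T \<subseteq> carrier G" for \<nu> S T
  proof -
    have "B S T = above G S - (\<Union>t\<in>T. above G {t})"
      by (auto simp: above_def B_def)
    also have "\<dots> \<in> sets (borel_of (Sub G))"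
      using that by (intro sets.Diff sets.finite_UN) auto
    finally show ?thesis using that by (simp add: IRS_def)
  qed
  \<comment> \<open>An excluded element is traded for two cylinders with one exclusion fewer.
    Induction on \<open>T\<close> then starts from the hypothesis on \<open>above\<close>.\<close>
  have step: "?P \<nu> S (insert t T) = ?P \<nu> S T - ?P \<nu> (insert t S) T"
    if "\<nu> \<in> IRS G" "finite S" "finite T" "S \<subseteq> carrier G" "T \<subseteq> carrier G" "t \<in> carrier G" for \<nu> S T t
  proof -
    interpret prob_space \<nu> using that by (simp add: IRS_def)
    have "?P \<nu> S T = measure \<nu> (B S (insert t T) \<union> B (insert t S) T)"
      by (rule arg_cong[of _ _ "measure \<nu>"]) (auto simp: B_def)
    also have "\<dots> = ?P \<nu> S (insert t T) + ?P \<nu> (insert t S) T"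
      using that by (intro finite_measure_Union meas) (auto simp: B_def)
    finally show ?thesis by simp
  qed
  have "(\<lambda>n. ?P (ms n) S T) \<longlonglongrightarrow> ?P \<mu> S T"
    if "finite T" "finite S" "S \<subseteq> carrier G" "T \<subseteq> carrier G" for S T
    using that
  proof (induction T arbitrary: S)
    case empty
    then have "(\<lambda>n. measure (\<mu>s n) (above G S)) \<longlonglongrightarrow> measure \<mu> (above G S)" using R by simp
    moreover have "B S {} = above G S" by (simp add: above_def B_def)
    ultimately show ?case
      unfolding ms_def using LIMSEQ_ignore_initial_segment[of "\<lambda>n. measure (\<mu>s n) (above G S)" _ n0] by simp
  next
    case (insert t T)
    have "(\<lambda>n. ?P (ms n) S T - ?P (ms n) (insert t S) T) \<longlonglongrightarrow> ?P \<mu> S T - ?P \<mu> (insert t S) T"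
      using insert by (intro tendsto_diff insert.IH) auto
    then show ?case using insert ms R by (simp add: step)
  qed
  note cyl = this
  have lim: "(\<lambda>n. integral\<^sup>L (ms n) f) \<longlonglongrightarrow> integral\<^sup>L \<mu> f" if f: "continuous_map (Sub G) euclideanreal f" for f
  proof (rule LIMSEQ_I)
    fix \<epsilon> :: real assume "\<epsilon> > 0"
    \<comment> \<open>Three errors of this size are added at the end: two from replacing
      \<open>f\<close> by a step function, under \<open>ms n\<close> and under \<mu>, and one from
      the convergence of finitely many cylinder probabilities.\<close>
    then have "\<epsilon> / 4 > 0" by simp
    from uniformly_continuous_Sub[OF f this] obtain Q where Q: "finite Q" "Q \<subseteq> carrier G"
      "\<forall>H K. subgroup H G \<longrightarrow> subgroup K G \<longrightarrow> H \<inter> Q = K \<inter> Q \<longrightarrow> \<bar>f H - f K\<bar> < \<epsilon> / 4"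
      by (elim exE conjE)
    \<comment> \<open>The value of \<open>f\<close> at an arbitrary subgroup with trace
      \<open>R\<close> on \<open>Q\<close>. If there is none, the choice is arbitrary, but then the
      corresponding cylinder is empty.\<close>
    define c where "c R = f (SOME H. subgroup H G \<and> H \<inter> Q = R)" for R
    define g where "g H = (\<Sum>R\<in>Pow Q. c R * indicator (B R (Q - R)) H)" for H
    have c: "\<bar>f H - c (H \<inter> Q)\<bar> < \<epsilon> / 4" if "subgroup H G" for H
    proof -
      let ?K = "SOME K. subgroup K G \<and> K \<inter> Q = H \<inter> Q"
      have "subgroup ?K G \<and> ?K \<inter> Q = H \<inter> Q" by (rule someI[of _ H]) (simp add: that)
      then show ?thesis unfolding c_def using Q(3) that by simp
    qed
    have g: "g H = c (H \<inter> Q)" if "subgroup H G" for H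
    proof -
      have "g H = (\<Sum>R\<in>Pow Q. if R = H \<inter> Q then c R else 0)"
        unfolding g_def using that by (intro sum.cong) (auto simp: indicator_def B_def)
      then show ?thesis using Q(1) by (simp add: sum.delta)
    qed
    have int: "\<bar>integral\<^sup>L \<nu> f - (\<Sum>R\<in>Pow Q. c R * ?P \<nu> R (Q - R))\<bar> \<le> \<epsilon> / 4" if "\<nu> \<in> IRS G" for \<nu>
    proof -
      interpret prob_space \<nu> using that by (simp add: IRS_def)
      have sets: "sets \<nu> = sets (borel_of (Sub G))" using that by (simp add: IRS_def)
      note sp = space_eq_subgroups[OF sets]
      have [measurable]: "f \<in> borel_measurable \<nu>"
      proof (rule borel_measurableI)
        fix V :: "real set" assume "open V"
        then have "openin (Sub G) {x \<in> topspace (Sub G). f x \<in> V}"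
          by (intro openin_continuous_map_preimage[OF f]) simp
        moreover have "{x \<in> topspace (Sub G). f x \<in> V} = f -` V \<inter> space \<nu>"
          by (auto simp: topspace_Sub sp)
        ultimately show "f -` V \<inter> space \<nu> \<in> sets \<nu>" using openin_sets_borel_of sets by metis
      qed
      have mg: "integrable \<nu> (\<lambda>H. c R * indicator (B R (Q - R)) H)"
        if "R \<in> Pow Q" for R
        using that Q \<open>\<nu> \<in> IRS G\<close> meas[of \<nu> R "Q - R"]
        by (auto intro!: integrable_mult_right integrable_real_indicator simp: finite_subset emeasure_eq_measure)
      then have ig: "integrable \<nu> g" unfolding g_def by (intro Bochner_Integration.integrable_sum)
      have Ig: "integral\<^sup>L \<nu> g = (\<Sum>R\<in>Pow Q. c R * ?P \<nu> R (Q - R))"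
        unfolding g_def
        by (subst Bochner_Integration.integral_sum) (use mg in \<open>auto simp: sp B_def intro!: sum.cong arg_cong[of _ _ "measure \<nu>"]\<close>)
      have d: "\<bar>f H - g H\<bar> \<le> \<epsilon> / 4" if "H \<in> space \<nu>" for H
        using that c[of H] g[of H] by (simp add: sp)
      have "integrable \<nu> (\<lambda>H. f H - g H)"
        using d ig by (intro integrable_const_bound[of _ "\<epsilon> / 4"]) auto
      then have "integrable \<nu> f" using ig Bochner_Integration.integrable_add[of \<nu> "\<lambda>H. f H - g H" g] by simp
      then have "integral\<^sup>L \<nu> f - integral\<^sup>L \<nu> g = (\<integral>H. f H - g H \<partial>\<nu>)" using ig by simp
      also have "\<bar>\<dots>\<bar> \<le> (\<integral>H. \<bar>f H - g H\<bar> \<partial>\<nu>)" by (rule integral_abs_bound)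
      also have "\<dots> \<le> (\<integral>H. \<epsilon> / 4 \<partial>\<nu>)"
        using \<open>integrable \<nu> (\<lambda>H. f H - g H)\<close> d by (intro integral_mono) auto
      also have "\<dots> = \<epsilon> / 4" by (simp add: prob_space)
      finally show ?thesis unfolding Ig by simp
    qed
    have "(\<lambda>n. \<Sum>R\<in>Pow Q. c R * ?P (ms n) R (Q - R)) \<longlonglongrightarrow> (\<Sum>R\<in>Pow Q. c R * ?P \<mu> R (Q - R))"
      using Q by (intro tendsto_sum tendsto_mult_left cyl) (auto intro: finite_subset)
    from LIMSEQ_D[OF this, of "\<epsilon> / 4"] \<open>\<epsilon> > 0\<close> obtain n1 where n1: "\<And>n. n \<ge> n1 \<Longrightarrow>
      \<bar>(\<Sum>R\<in>Pow Q. c R * ?P (ms n) R (Q - R)) - (\<Sum>R\<in>Pow Q. c R * ?P \<mu> R (Q - R))\<bar> < \<epsilon> / 4" by auto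
    have "norm (integral\<^sup>L (ms n) f - integral\<^sup>L \<mu> f) < \<epsilon>" if "n \<ge> n1" for n
      unfolding real_norm_def
      using n1[OF that] int[OF ms[of n]] int[OF conjunct1[OF R]] \<open>\<epsilon> > 0\<close> by linarith
    then show "\<exists>n1. \<forall>n\<ge>n1. norm (integral\<^sup>L (ms n) f - integral\<^sup>L \<mu> f) < \<epsilon>" by blast
  qed
  have lim': "(\<lambda>n. integral\<^sup>L (\<mu>s n) f) \<longlonglongrightarrow> integral\<^sup>L \<mu> f" if "continuous_map (Sub G) euclideanreal f" for f
    by (rule LIMSEQ_offset[of _ n0]) (rule lim[OF that, unfolded ms_def])
  show ?L unfolding limitin_IRS_iff_integral
    using conjunct1[OF R] conjunct1[OF conjunct2[OF R]] lim' by (intro conjI allI impI)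
qed

section \<open>Sequential compactness of invariant random subgroups\<close>

text \<open>The ternary Cantor code. The digits 0 and 2 leave gaps between the codes of sets that
  differ at a given index; a binary expansion would not.\<close>

definition cantor :: "nat set \<Rightarrow> real" where
  "cantor A = (\<Sum>i. (if i \<in> A then 2 else 0) / 3 ^ Suc i)"

lemma cantor_sums_one: "(\<lambda>i. 2 / 3 ^ Suc i :: real) sums 1"
proof -
  have "(\<lambda>i. 2 / 3 * (1 / 3 :: real) ^ i) sums (2 / 3 * (1 / (1 - 1 / 3)))"
    by (intro sums_mult geometric_sums) simp
  then show ?thesis by (simp add: power_divide)
qed

lemma cantor_summable: "summable (\<lambda>i. (if i \<in> A then 2 else 0) / 3 ^ Suc i :: real)"
  by (rule summable_comparison_test'[OF sums_summable[OF cantor_sums_one], of 0]) auto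

lemma cantor_nonneg: "0 \<le> cantor A"
  unfolding cantor_def by (intro suminf_nonneg cantor_summable) auto

lemma cantor_le_1: "cantor A \<le> 1"
proof -
  have "cantor A \<le> (\<Sum>i. 2 / 3 ^ Suc i)"
    unfolding cantor_def
    by (intro suminf_le cantor_summable sums_summable[OF cantor_sums_one]) auto
  then show ?thesis using sums_unique[OF cantor_sums_one] by simp
qed

lemma cantor_step: "cantor A = ((if 0 \<in> A then 2 else 0) + cantor {i. Suc i \<in> A}) / 3"
proof -
  have "cantor A = (\<Sum>i. (if Suc i \<in> A then 2 else 0) / 3 ^ Suc (Suc i)) + (if 0 \<in> A then 2 else 0) / 3"
    unfolding cantor_def using suminf_split_head[OF cantor_summable[of A]] by simp
  also have "(\<Sum>i. (if Suc i \<in> A then 2 else 0) / 3 ^ Suc (Suc i) :: real) =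
      (\<Sum>i. (if i \<in> {i. Suc i \<in> A} then 2 else 0) / 3 ^ Suc i / 3)"
    by (intro suminf_cong) simp
  also have "\<dots> = cantor {i. Suc i \<in> A} / 3"
    unfolding cantor_def by (rule suminf_divide[OF cantor_summable])
  finally show ?thesis by (simp add: field_simps)
qed

text \<open>Leading digits that differ contribute 2/3, of which the tails can take back at most 1/3;
  leading digits that agree reduce the claim to the shifted sets, scaled by 1/3.\<close>

lemma cantor_separates: "i \<in> A \<Longrightarrow> i \<notin> B \<Longrightarrow> 1 / 3 ^ Suc i \<le> \<bar>cantor A - cantor B\<bar>"
proof (induction i arbitrary: A B)
  case 0
  then show ?case
    using cantor_step[of A] cantor_step[of B] cantor_nonneg[of "{i. Suc i \<in> A}"] cantor_le_1[of "{i. Suc i \<in> B}"]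
    by simp
next
  case (Suc i)
  show ?case
  proof (cases "0 \<in> A \<longleftrightarrow> 0 \<in> B")
    case True
    have sep: "1 / 3 ^ Suc i \<le> \<bar>cantor {i. Suc i \<in> A} - cantor {i. Suc i \<in> B}\<bar>"
      using Suc by simp
    have "cantor A - cantor B = (cantor {i. Suc i \<in> A} - cantor {i. Suc i \<in> B}) / 3"
      using True by (subst (1 2) cantor_step) (simp add: field_simps)
    then have "\<bar>cantor A - cantor B\<bar> = \<bar>cantor {i. Suc i \<in> A} - cantor {i. Suc i \<in> B}\<bar> / 3"
      by (simp only: abs_divide abs_numeral)
    then show ?thesis using divide_right_mono[OF sep, of 3] by (simp only: power_Suc) simp
  next
    case False
    have "1 / 3 ^ Suc (Suc i) \<le> (1 / 3 :: real)"
      using one_le_power[of "3 :: real" "Suc i"] by (simp add: field_simps)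
    also have "1 / 3 \<le> \<bar>cantor A - cantor B\<bar>"
      using False cantor_step[of A] cantor_step[of B]
        cantor_nonneg[of "{i. Suc i \<in> A}"] cantor_le_1[of "{i. Suc i \<in> A}"]
        cantor_nonneg[of "{i. Suc i \<in> B}"] cantor_le_1[of "{i. Suc i \<in> B}"]
      by (auto split: if_splits)
    finally show ?thesis .
  qed
qed

text \<open>A tent whose slope matches the gap of \<open>cantor_separates\<close>: it equals 1 on
  codes with digit \<open>i\<close> set and has already dropped to 0 at all other codes. It is
  defined on the whole line because a weak limit is at first only a distribution on the
  reals.\<close>

definition cantor_digit :: "nat \<Rightarrow> real \<Rightarrow> real" where
  "cantor_digit i x = max 0 (1 - 3 ^ Suc i * infdist x (cantor ` {A. i \<in> A}))"

lemma continuous_on_cantor_digit: "continuous_on UNIV (cantor_digit i)"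
  unfolding cantor_digit_def[abs_def] by (intro continuous_intros)

lemma cantor_digit_bounds: "0 \<le> cantor_digit i x" "cantor_digit i x \<le> 1"
  by (simp_all add: cantor_digit_def infdist_nonneg)

lemma cantor_digit_cantor: "cantor_digit i (cantor A) = of_bool (i \<in> A)"
proof (cases "i \<in> A")
  case True
  then have "infdist (cantor A) (cantor ` {A. i \<in> A}) = 0" by (intro infdist_zero) auto
  then show ?thesis using True by (simp add: cantor_digit_def)
next
  case False
  have "1 / 3 ^ Suc i \<le> infdist (cantor A) (cantor ` {A. i \<in> A})"
  proof -
    have ne: "cantor ` {A. i \<in> A} \<noteq> {}" by auto
    show ?thesis unfolding infdist_notempty[OF ne]
      using cantor_separates[of i _ A] False
      by (intro cINF_greatest ne) (auto simp: dist_real_def abs_minus_commute)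
  qed
  then have "1 \<le> 3 ^ Suc i * infdist (cantor A) (cantor ` {A. i \<in> A})"
    by (simp add: field_simps)
  then show ?thesis using False by (simp add: cantor_digit_def)
qed

text \<open>The Cantor coding turns random subgroups into random reals; the limit produced by Helly's
  selection theorem is decoded by the digit functions, which are continuous on all of \<open>\<real>\<close>.\<close>

theorem (in group) IRS_sequentially_compact:
  fixes \<mu>s :: "nat \<Rightarrow> 'a set measure"
  assumes count: "countable (carrier G)" and \<mu>s: "\<And>n. \<mu>s n \<in> IRS G"
  shows "\<exists>r \<mu>. strict_mono r \<and> \<mu> \<in> IRS G \<and>
    (\<forall>Q. finite Q \<and> Q \<subseteq> carrier G \<longrightarrow>
       (\<lambda>n. measure (\<mu>s (r n)) (above G Q)) \<longlonglongrightarrow> measure \<mu> (above G Q))"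
proof -
  define idx where "idx = to_nat_on (carrier G)"
  define c where "c H = cantor (idx ` H)" for H
  define D where "D g = cantor_digit (idx g)" for g
  have sets: "sets (\<mu>s n) = sets (borel_of (Sub G))" for n using \<mu>s by (simp add: IRS_def)
  have sp: "space (\<mu>s n) = {H. subgroup H G}" for n by (rule space_eq_subgroups[OF sets])
  interpret \<mu>s: prob_space "\<mu>s n" for n using \<mu>s by (simp add: IRS_def)
  have inj: "inj_on idx (carrier G)" unfolding idx_def by (rule inj_on_to_nat_on[OF count])
  have D: "D g (c H) = of_bool (g \<in> H)" if "subgroup H G" "g \<in> carrier G" for g H
    unfolding D_def c_def cantor_digit_cantor
    using inj_on_image_mem_iff[OF inj that(2) subgroup.subset[OF that(1)]] by simp
  have Dc: "continuous_on UNIV (D g)" for g unfolding D_def by (rule continuous_on_cantor_digit)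
  have Db: "0 \<le> D g x" "D g x \<le> 1" for g x unfolding D_def by (rule cantor_digit_bounds)+
  have c: "c \<in> borel_measurable (\<mu>s n)" for n
    unfolding c_def[abs_def] cantor_def
  proof (intro borel_measurable_suminf borel_measurable_divide borel_measurable_const measurable_If)
    fix i
    show "{H \<in> space (\<mu>s n). i \<in> idx ` H} \<in> sets (\<mu>s n)"
    proof (cases "i \<in> idx ` carrier G")
      case True
      then obtain g where g: "g \<in> carrier G" "i = idx g" by blast
      have "{H \<in> space (\<mu>s n). i \<in> idx ` H} = above G {g}"
        using inj_on_image_mem_iff[OF inj g(1) subgroup.subset] g(2) by (auto simp: sp above_def)
      then show ?thesis using g by (simp add: sets)
    next
      case False
      then have "{H \<in> space (\<mu>s n). i \<in> idx ` H} = {}"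
        using subgroup.subset by (fastforce simp: sp)
      then show ?thesis by (metis sets.empty_sets)
    qed
  qed
  define P where "P n = distr (\<mu>s n) borel c" for n
  have "real_distribution (P n)" for n
    unfolding P_def by (intro real_distribution.intro real_distribution_axioms.intro \<mu>s.prob_space_distr c) auto
  then interpret P: real_distribution "P n" for n .
  \<comment> \<open>All codes lie in [0, 1], so a single interval carries every
    distribution.\<close>
  have "tight P" unfolding tight_def
  proof (intro conjI allI impI)
    fix \<epsilon> :: real assume "\<epsilon> > 0"
    have "measure (P n) {-1<..1} = 1" for n
    proof -
      have "c -` {-1<..1} \<inter> space (\<mu>s n) = space (\<mu>s n)"
        using cantor_le_1 less_le_trans[OF _ cantor_nonneg, of "-1"] by (auto simp: c_def)
      then show ?thesis using c by (simp add: P_def measure_distr \<mu>s.prob_space)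
    qed
    then show "\<exists>a b::real. a < b \<and> (\<forall>n. measure (P n) {a<..b} > 1 - \<epsilon>)"
      using \<open>\<epsilon> > 0\<close> by (intro exI[of _ "-1"] exI[of _ 1]) auto
  qed (rule P.real_distribution_axioms)
  then obtain r M where r: "strict_mono (r :: nat \<Rightarrow> nat)" and M: "real_distribution M"
    and wc: "weak_conv_m (\<lambda>n. P (r n)) M"
    using tight_imp_convergent_subsubsequence[of P id] by (auto simp: strict_mono_id comp_def)
  interpret M: real_distribution M by fact
  have lim: "(\<lambda>n. \<integral>H. h (c H) \<partial>\<mu>s (r n)) \<longlonglongrightarrow> integral\<^sup>L M h"
    if h: "continuous_on UNIV h" "\<And>x. \<bar>h x\<bar> \<le> 1" for h :: "real \<Rightarrow> real"
  proof -
    have "(\<lambda>n. integral\<^sup>L (P (r n)) h) \<longlonglongrightarrow> integral\<^sup>L M h"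
      using h by (intro weak_conv_imp_integral_bdd_continuous_conv[OF _ M wc, of _ 1])
        (auto simp: continuous_on_eq_continuous_at P.real_distribution_axioms)
    then show ?thesis
      using h c by (simp add: P_def integral_distr borel_measurable_continuous_onI)
  qed
  have hM: "integrable M h" if h: "continuous_on UNIV h" "\<And>x. \<bar>h x\<bar> \<le> 1" for h :: "real \<Rightarrow> real"
    using h by (intro M.integrable_const_bound[of _ 1]) (auto simp: borel_measurable_continuous_onI)
  \<comment> \<open>A nonnegative continuous function vanishing at all codes of subgroups has
    integral 0 along the sequence, hence also against \<open>M\<close>. The facts \<open>ae1\<close>
    to \<open>ae3\<close> apply this to polynomial identities in the digits: each digit is 0 or 1,
    and the set they describe passes the one-step subgroup test.\<close>
  have zero: "AE x in M. h x = 0"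
    if h: "continuous_on UNIV h" "\<And>x. 0 \<le> h x" "\<And>x. h x \<le> 1" "\<And>H. subgroup H G \<Longrightarrow> h (c H) = 0"
    for h :: "real \<Rightarrow> real"
  proof -
    have "(\<integral>H. h (c H) \<partial>\<mu>s (r n)) = (\<integral>H. 0 \<partial>\<mu>s (r n))" for n
      using h(4) by (intro Bochner_Integration.integral_cong) (auto simp: sp)
    then have "integral\<^sup>L M h = 0"
      using lim[of h] h(1-3) LIMSEQ_unique[OF _ tendsto_const[of 0]] by auto
    then show ?thesis
      using integral_nonneg_eq_0_iff_AE[OF hM[of h]] h by auto
  qed
  have ae1: "AE x in M. \<forall>g\<in>carrier G. D g x * (1 - D g x) = 0"
  proof (subst AE_ball_countable[OF count], intro ballI zero)
    fix g x show "D g x * (1 - D g x) \<le> 1"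
      using mult_le_one[of "D g x" "1 - D g x"] Db[of g x] by simp
  qed (use Db Dc D in \<open>auto intro!: continuous_intros\<close>)
  have ae2: "AE x in M. 1 - D \<one> x = 0"
    by (rule zero) (use Db Dc D in \<open>auto intro!: continuous_intros simp: subgroup.one_closed\<close>)
  have "AE x in M. \<forall>p\<in>carrier G \<times> carrier G. D (fst p) x * D (snd p) x * (1 - D (fst p \<otimes> inv (snd p)) x) = 0"
  proof (subst AE_ball_countable, goal_cases)
    case 1 then show ?case using count by simp
  next
    case 2 show ?case
    proof (intro ballI zero)
      fix p :: "'a \<times> 'a" and x show "D (fst p) x * D (snd p) x * (1 - D (fst p \<otimes> inv (snd p)) x) \<le> 1"
        using Db by (intro mult_le_one) (auto intro!: mult_le_one mult_nonneg_nonneg)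
    next
      fix p and H assume "p \<in> carrier G \<times> carrier G" "subgroup H G"
      then show "D (fst p) (c H) * D (snd p) (c H) * (1 - D (fst p \<otimes> inv (snd p)) (c H)) = 0"
        by (auto simp: D subgroup.m_closed subgroup.m_inv_closed)
    qed (use Db Dc in \<open>auto intro!: continuous_intros mult_nonneg_nonneg\<close>)
  qed
  then have ae3: "AE x in M. \<forall>g\<in>carrier G. \<forall>h\<in>carrier G. D g x * D h x * (1 - D (g \<otimes> inv h) x) = 0"
    by (rule AE_mp) (auto intro!: AE_I2)
  define S where "S x = {g \<in> carrier G. D g x = 1}" for x
  have "AE x in M. subgroup (S x) G \<and> (\<forall>g\<in>carrier G. D g x = of_bool (g \<in> S x))"
    using ae1 ae2 ae3
  proof eventually_elim
    case (elim x)
    have one: "\<one> \<in> S x" using elim(2) by (simp add: S_def)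
    have div: "g \<otimes> inv h \<in> S x" if "g \<in> S x" "h \<in> S x" for g h
    proof -
      have "g \<in> carrier G" "h \<in> carrier G" "D g x = 1" "D h x = 1" using that by (auto simp: S_def)
      moreover from this have "D g x * D h x * (1 - D (g \<otimes> inv h) x) = 0" using elim(3) by blast
      ultimately show ?thesis by (simp add: S_def)
    qed
    have "subgroup (S x) G"
    proof (rule subgroupI)
      show sub: "S x \<subseteq> carrier G" by (auto simp: S_def)
      show "S x \<noteq> {}" using one by blast
      show inv: "inv g \<in> S x" if "g \<in> S x" for g
        using div[OF one that] sub that by (simp add: subset_iff)
      show "g \<otimes> h \<in> S x" if "g \<in> S x" "h \<in> S x" for g h
        using div[OF that(1) inv[OF that(2)]] sub that by (simp add: subset_iff)
    qed
    moreover have "\<forall>g\<in>carrier G. D g x = of_bool (g \<in> S x)"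
      using elim(1) by (auto simp: S_def)
    ultimately show ?case ..
  qed
  then obtain N where N: "{x \<in> space M. \<not> (subgroup (S x) G \<and> (\<forall>g\<in>carrier G. D g x = of_bool (g \<in> S x)))} \<subseteq> N"
    "emeasure M N = 0" "N \<in> sets M" by (rule AE_E)
  then have S: "subgroup (S x) G" "\<And>g. g \<in> carrier G \<Longrightarrow> D g x = of_bool (g \<in> S x)" if "x \<notin> N" for x
  proof -
    have "x \<in> space M" by simp
    then have "subgroup (S x) G \<and> (\<forall>g\<in>carrier G. D g x = of_bool (g \<in> S x))"
      using N(1) that by blast
    then show "subgroup (S x) G" "\<And>g. g \<in> carrier G \<Longrightarrow> D g x = of_bool (g \<in> S x)" by simp_all
  qed
  \<comment> \<open>The trivial subgroup is the default on the null set where decoding fails; it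
    makes \<open>T\<close> subgroup-valued everywhere, as measurability into \<open>Sub G\<close>
    requires.\<close>
  define T where "T x = (if x \<in> N then {\<one>} else S x)" for x
  have T: "T \<in> measurable M (borel_of (Sub G))"
  proof (rule measurable_borel_of_Sub[OF count])
    fix x show "subgroup (T x) G" by (simp add: T_def triv_subgroup S)
  next
    fix g assume g: "g \<in> carrier G"
    have "{x \<in> space M. D g x = 1} \<in> sets M"
      using borel_measurable_continuous_onI[OF Dc[of g]] by measurable
    moreover have "{x \<in> space M. g \<in> T x} = (if g = \<one> then N else {}) \<union> ({x \<in> space M. D g x = 1} - N)"
      using g N(3) by (auto simp: T_def S_def)
    ultimately show "{x \<in> space M. g \<in> T x} \<in> sets M" using N(3) by auto
  qed
  define \<mu> where "\<mu> = distr M (borel_of (Sub G)) T"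
  have conv: "(\<lambda>n. measure (\<mu>s (r n)) (above G Q)) \<longlonglongrightarrow> measure \<mu> (above G Q)"
    if Q: "finite Q" "Q \<subseteq> carrier G" for Q
  proof -
    \<comment> \<open>A product of digits is bounded and continuous on the line and equals the
      indicator of \<open>above G Q\<close> on codes, so the weak limit can be applied to
      it.\<close>
    let ?h = "\<lambda>x. \<Prod>g\<in>Q. D g x"
    have prod: "(\<Prod>g\<in>Q. of_bool (P g)) = (of_bool (\<forall>g\<in>Q. P g) :: real)" for P
      using Q(1) by (induction Q) auto
    have hc: "continuous_on UNIV ?h" by (intro continuous_intros Dc)
    have hb: "\<bar>?h x\<bar> \<le> 1" for x
      using Db by (simp add: prod_nonneg prod_le_1)
    have "(\<integral>H. ?h (c H) \<partial>\<mu>s (r n)) = (\<integral>H. indicator (above G Q) H \<partial>\<mu>s (r n))" for n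
    proof (rule Bochner_Integration.integral_cong[OF refl])
      fix H assume "H \<in> space (\<mu>s (r n))"
      then have H: "subgroup H G" by (simp add: sp)
      have "?h (c H) = (\<Prod>g\<in>Q. of_bool (g \<in> H))"
        using Q by (intro prod.cong) (auto simp: D[OF H])
      then show "?h (c H) = indicator (above G Q) H" using H by (auto simp: prod above_def indicator_def)
    qed
    also have "(\<integral>H. indicator (above G Q) H \<partial>\<mu>s (r n)) = measure (\<mu>s (r n)) (above G Q)" for n
      by (simp add: sp above_def Int_absorb2 subset_iff)
    finally have "(\<lambda>n. measure (\<mu>s (r n)) (above G Q)) \<longlonglongrightarrow> integral\<^sup>L M ?h"
      using lim[OF hc hb] by simp
    moreover have "integral\<^sup>L M ?h = (\<integral>x. indicator (T -` above G Q \<inter> space M) x \<partial>M)"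
    proof (rule integral_cong_AE)
      have "AE x in M. x \<notin> N" using N by (intro AE_not_in) (auto simp: null_sets_def)
      then show "AE x in M. ?h x = indicator (T -` above G Q \<inter> space M) x"
      proof eventually_elim
        case (elim x)
        have "?h x = (\<Prod>g\<in>Q. of_bool (g \<in> S x))"
          using Q by (intro prod.cong) (auto simp: S(2)[OF elim])
        then show ?case using elim S(1)[OF elim] by (auto simp: prod above_def indicator_def T_def subset_iff)
      qed
    qed (use hc T Q in \<open>auto simp: borel_measurable_continuous_onI intro!: borel_measurable_indicator\<close>)
    moreover have "(\<integral>x. indicator (T -` above G Q \<inter> space M) x \<partial>M) = measure \<mu> (above G Q)"
      using T Q by (simp add: \<mu>_def measure_distr)
    ultimately show ?thesis by simp
  qed
  have "\<mu> \<in> IRS G"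
    unfolding IRS_iff[OF count]
  proof (intro conjI ballI allI impI)
    show "prob_space \<mu>" unfolding \<mu>_def by (rule M.prob_space_distr[OF T])
    show "sets \<mu> = sets (borel_of (Sub G))" by (simp add: \<mu>_def)
    fix g Q assume g: "g \<in> carrier G" and Q: "finite Q \<and> Q \<subseteq> carrier G"
    let ?Q = "(\<lambda>q. inv g \<otimes> q \<otimes> g) ` Q"
    have "measure (\<mu>s n) (above G ?Q) = measure (\<mu>s n) (above G Q)" for n
      using \<mu>s[of n] g Q unfolding IRS_iff[OF count] by blast
    then have "(\<lambda>n. measure (\<mu>s (r n)) (above G Q)) \<longlonglongrightarrow> measure \<mu> (above G ?Q)"
      using conv[of ?Q] g Q by (auto simp: image_subset_iff)
    then show "measure \<mu> (above G ?Q) = measure \<mu> (above G Q)"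
      using conv[of Q] Q LIMSEQ_unique by blast
  qed
  then show ?thesis using r conv by blast
qed

section \<open>Free groups and stabilizer laws\<close>

lemma group_hom_free_group:
  "group H \<Longrightarrow> h \<in> hom (free_group S) H \<Longrightarrow> group_hom (free_group S) H h"
  by (simp add: group_hom_def group_hom_axioms_def group_free_group)

lemma one_free_group: "\<one>\<^bsub>free_group S\<^esub> = []"
  by (simp add: free_group_def)

lemma countable_free_group: "countable S \<Longrightarrow> countable (carrier (free_group S))"
  by (rule countable_subset[of _ "lists (S \<times> UNIV)"]) (auto simp: free_group_def in_lists_conv_set image_subset_iff)

lemma inv_gen_eq:
  assumes "s \<in> S"
  shows "inv\<^bsub>free_group S\<^esub> (gen s) = [(s, False)]" "[(s, False)] \<in> carrier (free_group S)"
proof -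
  interpret group "free_group S" by (rule group_free_group)
  show c: "[(s, False)] \<in> carrier (free_group S)"
    using assms by (simp add: free_group_def reduced_def)
  have "[(s, False)] \<otimes>\<^bsub>free_group S\<^esub> gen s = \<one>\<^bsub>free_group S\<^esub>"
    by (simp add: free_group_def gen_def)
  then show "inv\<^bsub>free_group S\<^esub> (gen s) = [(s, False)]"
    using gen_in_carrier[OF assms] c by (rule inv_equality)
qed

lemma free_group_induct [consumes 1, case_names one gen inv_gen]:
  assumes w: "w \<in> carrier (free_group S)"
    and one: "P \<one>\<^bsub>free_group S\<^esub>"
    and gen: "\<And>s w. s \<in> S \<Longrightarrow> w \<in> carrier (free_group S) \<Longrightarrow> P w \<Longrightarrow> P (gen s \<otimes>\<^bsub>free_group S\<^esub> w)"
    and inv_gen: "\<And>s w. s \<in> S \<Longrightarrow> w \<in> carrier (free_group S) \<Longrightarrow> P w \<Longrightarrow>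
      P (inv\<^bsub>free_group S\<^esub> (gen s) \<otimes>\<^bsub>free_group S\<^esub> w)"
  shows "P w"
  using w
proof (induction w)
  case Nil
  then show ?case using one by (simp add: one_free_group)
next
  case (Cons x w)
  obtain s b where x: "x = (s, b)" by (cases x)
  from Cons.prems have s: "s \<in> S" and w: "w \<in> carrier (free_group S)"
    by (auto simp: free_group_def reduced_def successively_Cons x)
  \<comment> \<open>Nothing cancels at the front of a reduced word, so prepending a letter is
    multiplication by it.\<close>
  have "x # w = red_cons x w"
    using Cons.prems by (cases w) (auto simp: free_group_def reduced_def)
  then have "x # w = [x] \<otimes>\<^bsub>free_group S\<^esub> w" by (simp add: free_group_def)
  then show ?case
    using gen[OF s w Cons.IH[OF w]] inv_gen[OF s w Cons.IH[OF w], unfolded inv_gen_eq(1)[OF s]] x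
    by (cases b) (simp_all add: gen_def)
qed

lemma free_group_hom_eqI:
  assumes "group H" "h \<in> hom (free_group S) H" "h' \<in> hom (free_group S) H"
    and "\<And>s. s \<in> S \<Longrightarrow> h (gen s) = h' (gen s)"
    and "w \<in> carrier (free_group S)"
  shows "h w = h' w"
proof -
  interpret h: group_hom "free_group S" H h using assms(1,2) by (rule group_hom_free_group)
  interpret h': group_hom "free_group S" H h' using assms(1,3) by (rule group_hom_free_group)
  show ?thesis using assms(5)
    by (induction rule: free_group_induct) (simp_all add: assms(4) gen_in_carrier)
qed

text \<open>The existence half of the universal property. Evaluating letters is multiplicative once
  it is known to survive one cancellation, which is the content of \<open>red\<close>.\<close>

lemma free_group_hom_exists:
  fixes a :: "'s \<Rightarrow> 'h"
  assumes "group H" "a \<in> S \<rightarrow> carrier H"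
  shows "\<exists>h\<in>hom (free_group S) H. \<forall>s\<in>S. h (gen s) = a s"
proof -
  interpret group H by fact
  define l where "l x = (if snd x then a (fst x) else inv\<^bsub>H\<^esub> (a (fst x)))" for x :: "'s \<times> bool"
  define h where "h w = foldr (\<lambda>x p. l x \<otimes>\<^bsub>H\<^esub> p) w \<one>\<^bsub>H\<^esub>" for w
  have l: "l x \<in> carrier H" if "fst x \<in> S" for x using that assms(2) by (auto simp: l_def)
  have h: "h w \<in> carrier H" if "fst ` set w \<subseteq> S" for w
    using that by (induction w) (auto simp: h_def l)
  have red: "h (red_cons x w) = l x \<otimes>\<^bsub>H\<^esub> h w" if "fst x \<in> S" "fst ` set w \<subseteq> S" for x w
  proof (cases w)
    case (Cons y v)
    show ?thesis
    proof (cases "fst x = fst y \<and> snd x \<noteq> snd y")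
      case True
      have "l x \<otimes>\<^bsub>H\<^esub> (l y \<otimes>\<^bsub>H\<^esub> h v) = h v"
        using True that Cons assms(2) h[of v]
        by (cases "snd x") (auto simp: l_def inv_mult_cancel_left image_subset_iff Pi_iff)
      then show ?thesis using True Cons by (simp add: h_def)
    qed (use Cons in \<open>auto simp: h_def\<close>)
  qed (simp add: h_def)
  have mult: "h (foldr red_cons u w) = h u \<otimes>\<^bsub>H\<^esub> h w" if "fst ` set u \<subseteq> S" "fst ` set w \<subseteq> S" for u w
    using that(1)
  proof (induction u)
    case Nil
    then show ?case using h[OF that(2)] by (simp add: h_def)
  next
    case (Cons x u)
    have sub: "fst ` set (foldr red_cons u w) \<subseteq> S"
    proof
      fix s assume "s \<in> fst ` set (foldr red_cons u w)"
      then have "s \<in> fst ` (set u \<union> set w)" using set_foldr_red_cons[of u w] by blast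
      then show "s \<in> S" using Cons.prems that(2) by auto
    qed
    have "h (foldr red_cons (x # u) w) = l x \<otimes>\<^bsub>H\<^esub> (h u \<otimes>\<^bsub>H\<^esub> h w)"
      using red[of x] sub Cons by simp
    also have "\<dots> = h (x # u) \<otimes>\<^bsub>H\<^esub> h w"
      using Cons.prems that h[of u] h[of w] l[of x] by (simp add: h_def m_assoc)
    finally show ?case .
  qed
  have "h \<in> hom (free_group S) H"
    by (rule homI) (auto simp: free_group_def mult intro!: h)
  moreover have "\<forall>s\<in>S. h (gen s) = a s" using assms(2) by (simp add: h_def gen_def l_def Pi_iff)
  ultimately show ?thesis by blast
qed

text \<open>Relabels an action on \<open>n\<close> points as permutations of \<open>{1..n}\<close>,
  extended by the identity. The action laws are asked for pointwise, so that coset spaces, the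
  triples used for prescribed stabilizers and abstract sets with an action can all be fed
  in.\<close>

lemma (in group) sym_hom_of_action:
  assumes b: "bij_betw b {1..n} X"
    and closed: "\<And>g x. g \<in> carrier G \<Longrightarrow> x \<in> X \<Longrightarrow> a g x \<in> X"
    and one: "\<And>x. x \<in> X \<Longrightarrow> a \<one> x = x"
    and mult: "\<And>g h x. g \<in> carrier G \<Longrightarrow> h \<in> carrier G \<Longrightarrow> x \<in> X \<Longrightarrow> a (g \<otimes> h) x = a g (a h x)"
  shows "\<exists>h\<in>hom G (sym_group n). \<forall>g\<in>carrier G. \<forall>i\<in>{1..n}. b (h g i) = a g (b i)"
proof -
  define h where "h g i = (if i \<in> {1..n} then inv_into {1..n} b (a g (b i)) else i)" for g i
  have bX: "b i \<in> X" if "i \<in> {1..n}" for i by (rule bij_betwE[OF b, rule_format, OF that])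
  have h: "b (h g i) = a g (b i)" "h g i \<in> {1..n}" if "g \<in> carrier G" "i \<in> {1..n}" for g i
  proof -
    have im: "a g (b i) \<in> b ` {1..n}" using b closed[OF that(1) bX[OF that(2)]] by (simp only: bij_betw_def)
    have "h g i = inv_into {1..n} b (a g (b i))" using that(2) by (simp only: h_def if_True)
    then show "b (h g i) = a g (b i)" "h g i \<in> {1..n}"
      using f_inv_into_f[OF im] inv_into_into[OF im] by (simp_all only:)
  qed
  have inj: "i = j" if "b i = b j" "i \<in> {1..n}" "j \<in> {1..n}" for i j
    by (rule inj_onD[OF bij_betw_imp_inj_on[OF b] that])
  have hm: "h (g \<otimes> g') i = h g (h g' i)" if "g \<in> carrier G" "g' \<in> carrier G" for g g' i
  proof (cases "i \<in> {1..n}")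
    case True
    then show ?thesis using that by (intro inj) (simp_all add: h mult bX del: atLeastAtMost_iff One_nat_def)
  qed (auto simp: h_def)
  have h1: "h \<one> i = i" for i
  proof (cases "i \<in> {1..n}")
    case True
    then show ?thesis by (intro inj) (simp_all add: h one bX del: atLeastAtMost_iff One_nat_def)
  qed (auto simp: h_def)
  have "h g permutes {1..n}" if g: "g \<in> carrier G" for g
  proof (rule bij_imp_permutes)
    show "bij_betw (h g) {1..n} {1..n}"
      using g hm[of "inv g" g] hm[of g "inv g"] h1 h(2)
      by (intro bij_betw_byWitness[where f' = "h (inv g)"]) (simp_all add: image_subset_iff del: atLeastAtMost_iff One_nat_def)
  qed (auto simp: h_def)
  then have "h \<in> hom G (sym_group n)"
    by (intro homI) (auto simp: sym_group_carrier sym_group_mult hm)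
  then show ?thesis using h by blast
qed

section \<open>Finite actions and the laws of their stabilizers\<close>

text \<open>For an action this is the probability that the stabilizer of a uniform point contains
  \<open>Q\<close>. It also makes sense for maps \<open>f\<close> that are only approximately
  multiplicative, which allows comparing them with actions.\<close>

definition fix_frac :: "nat \<Rightarrow> ('g \<Rightarrow> nat \<Rightarrow> nat) \<Rightarrow> 'g set \<Rightarrow> real" where
  "fix_frac n f Q = real (card {x \<in> {1..n}. \<forall>q\<in>Q. f q x = x}) / real n"

lemma finite_gsetD:
  assumes "finite_gset G X \<alpha>"
  shows "finite X" "X \<noteq> {}" "group_action G X \<alpha>" "group G"
  using assms group_hom.axioms(1)[OF group_action.group_hom] by (auto simp: finite_gset_def)

text \<open>Elements of \<open>Bij\<close> are extensional functions, whereas permutations are the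
  identity outside \<open>{1..n}\<close>; hence the restriction.\<close>

lemma group_action_of_sym_hom:
  assumes "group G" "h \<in> hom G (sym_group n)"
  shows "group_action G {1..n} (\<lambda>g. restrict (h g) {1..n})"
proof -
  have p: "h g permutes {1..n}" if "g \<in> carrier G" for g
    using assms that by (auto simp: hom_def sym_group_carrier)
  have B: "restrict (h g) {1..n} \<in> Bij {1..n}" if "g \<in> carrier G" for g
    using permutes_imp_bij[OF p[OF that]] by (simp add: Bij_def bij_betw_restrict_eq)
  have "(\<lambda>g. restrict (h g) {1..n}) \<in> hom G (BijGroup {1..n})"
  proof (rule homI)
    fix x y assume xy: "x \<in> carrier G" "y \<in> carrier G"
    have "h (x \<otimes>\<^bsub>G\<^esub> y) = h x \<circ> h y" using assms xy by (simp add: hom_mult sym_group_mult)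
    then have "restrict (h (x \<otimes>\<^bsub>G\<^esub> y)) {1..n} = compose {1..n} (restrict (h x) {1..n}) (restrict (h y) {1..n})"
      using permutes_in_image[OF p[OF xy(2)]] by (auto simp: compose_def fun_eq_iff)
    then show "restrict (h (x \<otimes>\<^bsub>G\<^esub> y)) {1..n} =
        restrict (h x) {1..n} \<otimes>\<^bsub>BijGroup {1..n}\<^esub> restrict (h y) {1..n}"
      using B xy by (simp add: BijGroup_def)
  qed (use B in \<open>simp add: BijGroup_def del: One_nat_def\<close>)
  then show ?thesis
    using assms(1) by (simp add: group_action_def group_hom_def group_hom_axioms_def group_BijGroup)
qed

lemma finite_gset_of_sym_hom:
  assumes "group G" "h \<in> hom G (sym_group n)" "1 \<le> n"
  shows "finite_gset G {1..n} (\<lambda>g. restrict (h g) {1..n})"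
  using group_action_of_sym_hom[OF assms(1,2)] assms(3) by (simp add: finite_gset_def)

lemma measurable_stabilizer:
  assumes "finite_gset G X \<alpha>"
  shows "stabilizer G \<alpha> \<in> measurable (uniform_count_measure X) (borel_of (Sub G))"
proof -
  interpret group_action G X \<alpha> using assms by (rule finite_gsetD)
  show ?thesis
    unfolding measurable_def using stabilizer_subgroup
    by (auto simp: space_uniform_count_measure sets_uniform_count_measure space_borel_of topspace_Sub)
qed

lemma prob_space_stab_law: "finite_gset G X \<alpha> \<Longrightarrow> prob_space (stab_law G X \<alpha>)"
  unfolding stab_law_def
  by (intro prob_space.prob_space_distr prob_space_uniform_count_measure measurable_stabilizer)
    (auto dest: finite_gsetD)

lemma sets_stab_law: "sets (stab_law G X \<alpha>) = sets (borel_of (Sub G))"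
  by (simp add: stab_law_def)

lemma measure_stab_law_above:
  assumes X: "finite_gset G X \<alpha>" and Q: "finite Q" "Q \<subseteq> carrier G"
  shows "measure (stab_law G X \<alpha>) (above G Q) = real (card {x \<in> X. \<forall>q\<in>Q. \<alpha> q x = x}) / real (card X)"
proof -
  interpret group_action G X \<alpha> using X by (rule finite_gsetD)
  have "stabilizer G \<alpha> -` above G Q \<inter> X = {x \<in> X. \<forall>q\<in>Q. \<alpha> q x = x}"
    using Q stabilizer_subgroup by (auto simp: above_def stabilizer_def)
  then have "measure (stab_law G X \<alpha>) (above G Q) = measure (uniform_count_measure X) {x \<in> X. \<forall>q\<in>Q. \<alpha> q x = x}"
    using Q by (simp add: stab_law_def measure_distr[OF measurable_stabilizer[OF X]] space_uniform_count_measure)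
  also have "\<dots> = real (card {x \<in> X. \<forall>q\<in>Q. \<alpha> q x = x}) / real (card X)"
    using finite_gsetD[OF X] by (intro measure_uniform_count_measure) auto
  finally show ?thesis .
qed

text \<open>The permutation by \<open>g\<close> maps the points fixed by the conjugate of
  \<open>Q\<close> bijectively onto the points fixed by \<open>Q\<close>, so inclusion probabilities
  are conjugation-invariant.\<close>

lemma stab_law_in_IRS:
  fixes G (structure)
  assumes X: "finite_gset G X \<alpha>" and count: "countable (carrier G)"
  shows "stab_law G X \<alpha> \<in> IRS G"
proof -
  interpret group G using X by (rule finite_gsetD)
  interpret A: group_action G X \<alpha> using X by (rule finite_gsetD)
  have eq: "card {x \<in> X. \<forall>q\<in>(\<lambda>q. inv g \<otimes> q \<otimes> g) ` Q. \<alpha> q x = x} = card {x \<in> X. \<forall>q\<in>Q. \<alpha> q x = x}"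
    if g: "g \<in> carrier G" and Q: "Q \<subseteq> carrier G" for g Q
  proof (rule bij_betw_same_card)
    have \<alpha>: "\<alpha> g x \<in> X" if "g \<in> carrier G" "x \<in> X" for g x using A.element_image[OF that refl] .
    have fixed: "\<alpha> (inv g \<otimes> q \<otimes> g) x = x \<longleftrightarrow> \<alpha> q (\<alpha> g x) = \<alpha> g x" if "q \<in> Q" "x \<in> X" for q x
    proof -
      have q: "q \<in> carrier G" using that Q by blast
      have "\<alpha> (inv g \<otimes> q \<otimes> g) x = \<alpha> (inv g) (\<alpha> q (\<alpha> g x))"
        using g q that by (simp add: A.composition_rule m_assoc \<alpha>)
      moreover have "\<alpha> (inv g) y = x \<longleftrightarrow> y = \<alpha> g x" if "y \<in> X" for y
        using A.orbit_sym_aux[OF g \<open>x \<in> X\<close>] A.orbit_sym_aux[OF inv_closed[OF g] that, of x] g by auto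
      ultimately show ?thesis using g q that \<alpha> by simp
    qed
    show "bij_betw (\<alpha> g) {x \<in> X. \<forall>q\<in>(\<lambda>q. inv g \<otimes> q \<otimes> g) ` Q. \<alpha> q x = x} {x \<in> X. \<forall>q\<in>Q. \<alpha> q x = x}"
    proof (rule bij_betw_byWitness[where f' = "\<alpha> (inv g)"])
      show "\<forall>x\<in>{x \<in> X. \<forall>q\<in>(\<lambda>q. inv g \<otimes> q \<otimes> g) ` Q. \<alpha> q x = x}. \<alpha> (inv g) (\<alpha> g x) = x"
        using A.orbit_sym_aux[OF g] by auto
      show inv: "\<forall>x\<in>{x \<in> X. \<forall>q\<in>Q. \<alpha> q x = x}. \<alpha> g (\<alpha> (inv g) x) = x"
        using A.orbit_sym_aux[of "inv g"] g by auto
      show "\<alpha> g ` {x \<in> X. \<forall>q\<in>(\<lambda>q. inv g \<otimes> q \<otimes> g) ` Q. \<alpha> q x = x} \<subseteq> {x \<in> X. \<forall>q\<in>Q. \<alpha> q x = x}"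
        using \<alpha> g fixed by auto
      show "\<alpha> (inv g) ` {x \<in> X. \<forall>q\<in>Q. \<alpha> q x = x} \<subseteq> {x \<in> X. \<forall>q\<in>(\<lambda>q. inv g \<otimes> q \<otimes> g) ` Q. \<alpha> q x = x}"
        using \<alpha> g fixed inv by auto
    qed
  qed
  have "measure (stab_law G X \<alpha>) (above G ((\<lambda>q. inv g \<otimes> q \<otimes> g) ` Q)) = measure (stab_law G X \<alpha>) (above G Q)"
    if "g \<in> carrier G" "finite Q" "Q \<subseteq> carrier G" for g Q
  proof -
    have "(\<lambda>q. inv g \<otimes> q \<otimes> g) ` Q \<subseteq> carrier G" using that by auto
    then show ?thesis
      using that measure_stab_law_above[OF X, of "(\<lambda>q. inv g \<otimes> q \<otimes> g) ` Q"] measure_stab_law_above[OF X, of Q] eq[of g Q]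
      by simp
  qed
  then show ?thesis
    unfolding IRS_iff[OF count] using prob_space_stab_law[OF X] sets_stab_law[of G X \<alpha>] by simp
qed

lemma (in group) singleton_sets_Sub:
  assumes "countable (carrier G)" "subgroup K G"
  shows "{K} \<in> sets (borel_of (Sub G))"
proof -
  have "(\<Inter>g\<in>carrier G. {H. subgroup H G \<and> (g \<in> H \<longleftrightarrow> g \<in> K)}) \<in> sets (borel_of (Sub G))"
    using assms one_closed
    by (intro sets.countable_INT') (auto intro: openin_sets_borel_of[OF openin_Sub_mem])
  moreover have "(\<Inter>g\<in>carrier G. {H. subgroup H G \<and> (g \<in> H \<longleftrightarrow> g \<in> K)}) = {K}"
  proof (intro equalityI subsetI)
    fix H assume "H \<in> (\<Inter>g\<in>carrier G. {H. subgroup H G \<and> (g \<in> H \<longleftrightarrow> g \<in> K)})"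
    then have "subgroup H G" "\<forall>g\<in>carrier G. g \<in> H \<longleftrightarrow> g \<in> K" using one_closed by auto
    then show "H \<in> {K}" using subgroup.subset[of H G] subgroup.subset[OF assms(2)] by auto
  qed (use assms(2) in auto)
  ultimately show ?thesis by simp
qed

text \<open>Stabilizers have finite index by the orbit-stabilizer bijection. The almost-sure
  statement is derived through the finite set of stabilizers that occur, a measurable event because
  singletons are measurable.\<close>

lemma AE_stab_law_finite_index:
  assumes "finite_gset G X \<alpha>" "countable (carrier G)"
  shows "AE H in stab_law G X \<alpha>. finite (rcosets\<^bsub>G\<^esub> H)"
proof -
  interpret A: group_action G X \<alpha> using assms(1) by (rule finite_gsetD)
  have fin: "finite (rcosets\<^bsub>G\<^esub> (stabilizer G \<alpha> x))" if "x \<in> X" for x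
  proof -
    have "orbit G \<alpha> x \<subseteq> X" using A.element_image that by (auto simp: orbit_def)
    then have "finite (orbit G \<alpha> x)" using finite_gsetD[OF assms(1)] finite_subset by blast
    then show ?thesis using A.orbit_stab_fun_is_bij[OF that] bij_betw_finite by blast
  qed
  let ?F = "stabilizer G \<alpha> ` X"
  have sub: "subgroup K G" if "K \<in> ?F" for K using that A.stabilizer_subgroup by auto
  have "(\<Union>K\<in>?F. {K}) \<in> sets (borel_of (Sub G))"
    using finite_gsetD[OF assms(1)] sub
    by (intro sets.finite_UN group.singleton_sets_Sub assms(2)) auto
  moreover have "(\<Union>K\<in>?F. {K}) = {H \<in> space (borel_of (Sub G)). H \<in> ?F}"
    using sub by (auto simp: space_borel_of topspace_Sub)
  ultimately have "AE H in stab_law G X \<alpha>. H \<in> ?F"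
    unfolding stab_law_def
    by (subst AE_distr_iff[OF measurable_stabilizer[OF assms(1)]])
      (auto simp: space_uniform_count_measure)
  then show ?thesis by (rule AE_mp) (auto intro!: AE_I2 fin)
qed

section \<open>Finite-index subgroups and co-soficity\<close>

text \<open>\<open>N k\<close> is the threshold after which \<open>P k\<close> holds; \<kappa> moves
  on to \<open>k\<close> only once that threshold has been passed.\<close>

lemma slow_diagonal:
  assumes "\<And>k. eventually (P k) sequentially"
  shows "\<exists>\<kappa> :: nat \<Rightarrow> nat. filterlim \<kappa> at_top sequentially \<and> eventually (\<lambda>n. P (\<kappa> n) n) sequentially"
proof -
  have "\<forall>k. \<exists>N. \<forall>n\<ge>N. P k n" using assms by (simp add: eventually_sequentially)
  then obtain N where N: "\<And>k n. n \<ge> N k \<Longrightarrow> P k n" by metis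
  \<comment> \<open>The bound \<open>k \<le> n\<close> keeps the set finite, and the inserted 0
    keeps it nonempty; 0 is a valid choice as soon as \<open>n \<ge> N 0\<close>.\<close>
  define \<kappa> where "\<kappa> n = Max (insert 0 {k. k \<le> n \<and> N k \<le> n})" for n
  have fin: "finite (insert 0 {k. k \<le> n \<and> N k \<le> n})" for n :: nat by simp
  have "filterlim \<kappa> at_top sequentially"
    unfolding filterlim_at_top
  proof
    fix k
    have "k \<le> \<kappa> n" if "n \<ge> max k (N k)" for n
      unfolding \<kappa>_def using that by (intro Max_ge fin) auto
    then show "eventually (\<lambda>n. k \<le> \<kappa> n) sequentially"
      unfolding eventually_sequentially by blast
  qed
  moreover have "P (\<kappa> n) n" if "n \<ge> N 0" for n
  proof -
    have "\<kappa> n \<in> insert 0 {k. k \<le> n \<and> N k \<le> n}" unfolding \<kappa>_def by (rule Max_in) auto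
    then have "N (\<kappa> n) \<le> n" using that by auto
    then show ?thesis by (rule N)
  qed
  ultimately show ?thesis unfolding eventually_sequentially by blast
qed

lemma finite_sym_hom_gens:
  assumes "finite S"
  shows "finite (S \<rightarrow>\<^sub>E {p. p permutes {1..k :: nat}})"
  using assms by (intro finite_PiE finite_permutations) auto

text \<open>Right multiplication by inverses is a left action on right cosets in which
  \<open>H\<close> is the stabilizer of the point \<open>H\<close>. Every subgroup of finite index
  is thereby a point stabilizer of a finite action.\<close>

lemma (in group) rcosets_action:
  assumes H: "subgroup H G"
  shows "\<And>g C. g \<in> carrier G \<Longrightarrow> C \<in> rcosets H \<Longrightarrow> C #> inv g \<in> rcosets H"
    and "\<And>C. C \<in> rcosets H \<Longrightarrow> C #> inv \<one> = C"
    and "\<And>g h C. g \<in> carrier G \<Longrightarrow> h \<in> carrier G \<Longrightarrow> C \<in> rcosets H \<Longrightarrow>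
      C #> inv (g \<otimes> h) = (C #> inv h) #> inv g"
    and "\<And>g. g \<in> carrier G \<Longrightarrow> H #> inv g = H \<longleftrightarrow> g \<in> H"
proof -
  have HG: "H \<subseteq> carrier G" using H by (rule subgroup.subset)
  have CG: "C \<subseteq> carrier G" if "C \<in> rcosets H" for C using rcosets_part_G[OF H] that by blast
  show "H #> inv g = H \<longleftrightarrow> g \<in> H" if g: "g \<in> carrier G" for g
  proof
    assume "H #> inv g = H"
    then have "inv g \<in> H" using coset_join1 g H by blast
    then show "g \<in> H" using subgroup.m_inv_closed[OF H] g by fastforce
  next
    assume "g \<in> H"
    then show "H #> inv g = H" using coset_join2[OF _ H] g subgroup.m_inv_closed[OF H] by simp
  qed
  show "C #> inv \<one> = C" if "C \<in> rcosets H" for C using CG[OF that] by simp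
  show "C #> inv g \<in> rcosets H" if g: "g \<in> carrier G" and C: "C \<in> rcosets H" for g C
  proof -
    from C obtain x where x: "x \<in> carrier G" "C = H #> x" by (auto simp: RCOSETS_def)
    then show ?thesis using g HG by (auto simp: coset_mult_assoc intro!: rcosetsI)
  qed
  show "C #> inv (g \<otimes> h) = (C #> inv h) #> inv g"
    if "g \<in> carrier G" "h \<in> carrier G" "C \<in> rcosets H" for g h C
    using that CG[of C] by (simp add: coset_mult_assoc inv_mult_group)
qed

text \<open>A subgroup of index \<open>k\<close> is a point stabilizer of an action on
  \<open>k\<close> points, and such an action is determined by the images of the finitely many
  generators. Each size therefore admits only finitely many generator images.\<close>

lemma countable_finite_index_subgroups:
  fixes G (structure)
  assumes "group G" "finite S" "\<pi> \<in> epi (free_group S) G"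
  shows "countable {H. subgroup H G \<and> finite (rcosets\<^bsub>G\<^esub> H)}"
proof -
  interpret group G by fact
  have \<pi>: "\<pi> \<in> hom (free_group S) G" "\<pi> ` carrier (free_group S) = carrier G"
    using assms(3) by (auto simp: epi_def)
  \<comment> \<open>The stabilizer of \<open>i\<close> in the action with generator images
    \<open>u\<close>. The existential quantifier hides a definite action: by \<open>uniq\<close>,
    homomorphisms with the same generator images agree on the carrier.\<close>
  define \<Phi> where "\<Phi> k i u = {g \<in> carrier G. \<exists>h\<in>hom G (sym_group k). (\<forall>s\<in>S. h (\<pi> (gen s)) = u s) \<and> h g i = i}"
    for k and i :: nat and u
  have sub: "{H. subgroup H G \<and> finite (rcosets H)} \<subseteq>
    (\<Union>k. \<Union>i. (\<Union>u\<in>S \<rightarrow>\<^sub>E {p. p permutes {1..k}}. {\<Phi> k i u}))"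
  proof
    fix H assume "H \<in> {H. subgroup H G \<and> finite (rcosets H)}"
    then have H: "subgroup H G" "finite (rcosets H)" by auto
    define k where "k = card (rcosets H)"
    obtain b where b: "bij_betw b {1..k} (rcosets H)"
      using ex_bij_betw_nat_finite_1[OF H(2)] unfolding k_def by blast
    have "\<exists>h\<in>hom G (sym_group k). \<forall>g\<in>carrier G. \<forall>i\<in>{1..k}. b (h g i) = b i #> inv g"
      by (rule sym_hom_of_action[OF b, where a = "\<lambda>g C. C #> inv g",
        OF rcosets_action(1)[OF H(1)] rcosets_action(2)[OF H(1)] rcosets_action(3)[OF H(1)]])
    then obtain h where h: "h \<in> hom G (sym_group k)" "\<forall>g\<in>carrier G. \<forall>i\<in>{1..k}. b (h g i) = b i #> inv g" by (rule bexE)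
    have perm: "h g permutes {1..k}" if "g \<in> carrier G" for g
      using h(1) that by (auto simp: hom_def sym_group_carrier)
    have "H \<in> rcosets H" using subgroup.subgroup_in_rcosets[OF H(1) is_group] .
    then have "H \<in> b ` {1..k}" by (simp only: bij_betw_imp_surj_on[OF b])
    then obtain i where i: "i \<in> {1..k}" "b i = H" by (elim imageE) simp
    have fixi: "h g i = i \<longleftrightarrow> g \<in> H" if g: "g \<in> carrier G" for g
    proof -
      have "h g i = i \<longleftrightarrow> b (h g i) = b i"
        using inj_on_eq_iff[OF bij_betw_imp_inj_on[OF b], of "h g i" i] i(1) permutes_in_image[OF perm[OF g], of i] by simp
      also have "\<dots> \<longleftrightarrow> H #> inv g = H" using h(2) g i by auto
      finally show ?thesis using rcosets_action(4)[OF H(1) g] by simp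
    qed
    define u where "u = (\<lambda>s\<in>S. h (\<pi> (gen s)))"
    have uniq: "h' g = h g" if h': "h' \<in> hom G (sym_group k)" "\<forall>s\<in>S. h' (\<pi> (gen s)) = u s"
      and g: "g \<in> carrier G" for h' g
    proof -
      have "g \<in> \<pi> ` carrier (free_group S)" using \<pi>(2) g by simp
      then obtain w where w: "w \<in> carrier (free_group S)" "g = \<pi> w" by (elim imageE) simp
      have "(h' \<circ> \<pi>) (gen s) = (h \<circ> \<pi>) (gen s)" if "s \<in> S" for s
        using h'(2) that by (simp add: u_def)
      then have "(h' \<circ> \<pi>) w = (h \<circ> \<pi>) w"
        by (rule free_group_hom_eqI[OF sym_group_is_group Group.hom_compose[OF \<pi>(1) h'(1)]
          Group.hom_compose[OF \<pi>(1) h(1)] _ w(1)])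
      then show ?thesis using w by simp
    qed
    have "\<Phi> k i u = {g \<in> carrier G. h g i = i}"
    proof (intro equalityI subsetI)
      fix g assume "g \<in> \<Phi> k i u"
      then obtain h' where "g \<in> carrier G" "h' \<in> hom G (sym_group k)" "\<forall>s\<in>S. h' (\<pi> (gen s)) = u s" "h' g i = i"
        unfolding \<Phi>_def mem_Collect_eq by (elim conjE bexE)
      then show "g \<in> {g \<in> carrier G. h g i = i}" using uniq[of h' g] by simp
    next
      fix g assume "g \<in> {g \<in> carrier G. h g i = i}"
      then show "g \<in> \<Phi> k i u" unfolding \<Phi>_def using h(1) by (auto simp: u_def)
    qed
    also have "\<dots> = H" using fixi subgroup.subset[OF H(1)] by auto
    finally have "H = \<Phi> k i u" ..
    moreover have "u \<in> S \<rightarrow>\<^sub>E {p. p permutes {1..k}}"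
      unfolding u_def using perm hom_in_carrier[OF \<pi>(1) gen_in_carrier] by auto
    ultimately show "H \<in> (\<Union>k. \<Union>i. (\<Union>u\<in>S \<rightarrow>\<^sub>E {p. p permutes {1..k}}. {\<Phi> k i u}))" by blast
  qed
  have c: "countable (\<Union>u\<in>S \<rightarrow>\<^sub>E {p. p permutes {1..k}}. {\<Phi> k i u})" for k i
    by (intro countable_finite finite_UN_I finite_sym_hom_gens[OF assms(2)]) simp
  have "countable (\<Union>k. \<Union>i. (\<Union>u\<in>S \<rightarrow>\<^sub>E {p. p permutes {1..k}}. {\<Phi> k i u}))"
    by (rule countable_UN[OF countableI_type], rule countable_UN[OF countableI_type], rule c)
  then show ?thesis by (rule countable_subset[OF sub])
qed

lemma fix_frac_eq:
  assumes "h \<in> hom G (sym_group n)" and b: "bij_betw b {1..n} X"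
    and h: "\<forall>g\<in>carrier G. \<forall>i\<in>{1..n}. b (h g i) = a g (b i)" and Q: "Q \<subseteq> carrier G"
  shows "fix_frac n h Q = real (card {x \<in> X. \<forall>q\<in>Q. a q x = x}) / real n"
proof -
  have perm: "h g permutes {1..n}" if "g \<in> carrier G" for g
    using assms(1) that by (auto simp: hom_def sym_group_carrier)
  have fixed: "h q i = i \<longleftrightarrow> a q (b i) = b i" if "q \<in> Q" "i \<in> {1..n}" for q i
  proof -
    have q: "q \<in> carrier G" using that Q by blast
    then have "h q i \<in> {1..n}" using permutes_in_image[OF perm] that by simp
    then have "h q i = i \<longleftrightarrow> b (h q i) = b i"
      using inj_on_eq_iff[OF bij_betw_imp_inj_on[OF b]] that by simp
    then show ?thesis using h q that by simp
  qed
  have "bij_betw b {i \<in> {1..n}. \<forall>q\<in>Q. h q i = i} {x \<in> X. \<forall>q\<in>Q. a q x = x}"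
  proof (rule bij_betw_imageI)
    show "inj_on b {i \<in> {1..n}. \<forall>q\<in>Q. h q i = i}"
      using bij_betw_imp_inj_on[OF b] by (rule inj_on_subset) auto
    have "X = b ` {1..n}" using bij_betw_imp_surj_on[OF b] ..
    then show "b ` {i \<in> {1..n}. \<forall>q\<in>Q. h q i = i} = {x \<in> X. \<forall>q\<in>Q. a q x = x}"
      using fixed by (auto simp del: One_nat_def)
  qed
  then show ?thesis unfolding fix_frac_def by (simp add: bij_betw_same_card)
qed

section \<open>Left translation of right cosets\<close>

lemma (in group) inv_conjugate:
  assumes "H \<subseteq> carrier G" "g \<in> carrier G"
  shows "inv g <# (g <# H #> inv g) #> g = H"
proof -
  have "x \<in> inv g <# (g <# H #> inv g) #> g \<longleftrightarrow> x \<in> H" if "x \<in> carrier G" for x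
    using mem_conjugate_iff[OF conjugate_subset[OF assms], of "inv g" x]
      mem_conjugate_iff[OF assms, of "g \<otimes> x \<otimes> inv g"] assms that
    by (simp add: m_assoc inv_mult_cancel_left)
  moreover have "inv g <# (g <# H #> inv g) #> g \<subseteq> carrier G"
    using conjugate_subset[OF conjugate_subset[OF assms], of "inv g"] assms by simp
  ultimately show ?thesis using assms(1) by blast
qed

lemma (in group) lcos_rcos_conjugate:
  assumes "H \<subseteq> carrier G" "g \<in> carrier G" "x \<in> carrier G"
  shows "g <# (H #> x) = (g <# H #> inv g) #> (g \<otimes> x)"
proof -
  have gH: "g <# H \<subseteq> carrier G" using assms by (intro l_coset_subset_G)
  have "(g <# H #> inv g) #> (g \<otimes> x) = g <# H #> (inv g \<otimes> (g \<otimes> x))"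
    using assms gH by (subst coset_mult_assoc) auto
  also have "\<dots> = g <# H #> x" using assms by (simp add: inv_mult_cancel_left)
  also have "\<dots> = g <# (H #> x)" using assms by (simp add: coset_assoc)
  finally show ?thesis ..
qed

lemma (in group) lcos_rcosets_conjugate:
  assumes H: "subgroup H G" and g: "g \<in> carrier G" and C: "C \<in> rcosets H"
  shows "g <# C \<in> rcosets (g <# H #> inv g)"
proof -
  have HG: "H \<subseteq> carrier G" using H by (rule subgroup.subset)
  obtain x where x: "x \<in> carrier G" "C = H #> x" using C by (auto simp: RCOSETS_def)
  then show ?thesis
    using lcos_rcos_conjugate[OF HG g x(1)] rcosetsI[OF conjugate_subset[OF HG g], of "g \<otimes> x"] g by simp
qed

lemma (in group) bij_betw_rcosets_conjugate:
  assumes H: "subgroup H G" and g: "g \<in> carrier G"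
  shows "bij_betw (\<lambda>C. g <# C) (rcosets H) (rcosets (g <# H #> inv g))"
proof (rule bij_betw_byWitness[where f' = "\<lambda>C. inv g <# C"])
  have HG: "H \<subseteq> carrier G" using H by (rule subgroup.subset)
  have K: "subgroup (g <# H #> inv g) G" using subgroup_conjugate[OF H g] .
  have lg: "C \<subseteq> carrier G" if "C \<in> rcosets K" "subgroup K G" for C K
    using rcosets_part_G[OF that(2)] that(1) by blast
  show "\<forall>C\<in>rcosets H. inv g <# (g <# C) = C"
    using lg[OF _ H] g by (auto simp: lcos_m_assoc lcos_mult_one)
  show "\<forall>C\<in>rcosets (g <# H #> inv g). g <# (inv g <# C) = C"
    using lg[OF _ K] g by (auto simp: lcos_m_assoc lcos_mult_one)
  show "(\<lambda>C. g <# C) ` (rcosets H) \<subseteq> rcosets (g <# H #> inv g)"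
    using lcos_rcosets_conjugate[OF H g] by blast
  have "inv g <# C \<in> rcosets H" if "C \<in> rcosets (g <# H #> inv g)" for C
    using lcos_rcosets_conjugate[OF K inv_closed[OF g] that] inv_conjugate[OF HG g] g by simp
  then show "(\<lambda>C. inv g <# C) ` (rcosets (g <# H #> inv g)) \<subseteq> rcosets H" by blast
qed

lemma (in group) conjugate_mult:
  assumes "H \<subseteq> carrier G" "g \<in> carrier G" "h \<in> carrier G"
  shows "(g \<otimes> h) <# H #> inv (g \<otimes> h) = g <# (h <# H #> inv h) #> inv g"
proof -
  have gh: "g \<otimes> h \<in> carrier G" using assms by simp
  have "x \<in> (g \<otimes> h) <# H #> inv (g \<otimes> h) \<longleftrightarrow> x \<in> g <# (h <# H #> inv h) #> inv g" if "x \<in> carrier G" for x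
    using mem_conjugate_iff[OF assms(1) gh that] mem_conjugate_iff[OF conjugate_subset[OF assms(1,3)] assms(2) that]
      mem_conjugate_iff[OF assms(1,3), of "inv g \<otimes> x \<otimes> g"] assms that
    by (simp add: inv_mult_group m_assoc)
  then show ?thesis
    using conjugate_subset[OF assms(1) gh] conjugate_subset[OF conjugate_subset[OF assms(1,3)] assms(2)]
    by blast
qed

text \<open>Left multiplication is what makes the stabilizer of \<open>H #> x\<close> equal to
  \<open>H\<close> for every representative \<open>x\<close>. In the usual action on left cosets it
  would be a conjugate of \<open>H\<close> depending on the coset.\<close>

lemma (in group) lcos_rcoset_eq_iff:
  assumes H: "subgroup H G" and g: "g \<in> carrier G" and C: "C \<in> rcosets H"
  shows "g <# C = C \<longleftrightarrow> g \<in> H"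
proof -
  have HG: "H \<subseteq> carrier G" using H by (rule subgroup.subset)
  obtain x where x: "x \<in> carrier G" "C = H #> x" using C by (auto simp: RCOSETS_def)
  have mem: "y \<in> H #> x \<longleftrightarrow> y \<otimes> inv x \<in> H" if "y \<in> carrier G" for y
  proof
    assume "y \<in> H #> x"
    then obtain k where "k \<in> H" "y = k \<otimes> x" by (auto simp: r_coset_def)
    then show "y \<otimes> inv x \<in> H" using x HG by (simp add: m_assoc subset_iff)
  next
    assume "y \<otimes> inv x \<in> H"
    moreover have "y = y \<otimes> inv x \<otimes> x" using that x by (simp add: m_assoc)
    ultimately show "y \<in> H #> x" by (auto simp: r_coset_def)
  qed
  show ?thesis
  proof
    assume "g <# C = C"
    moreover have "x \<in> C" using x rcos_self[OF _ H] by simp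
    ultimately have "g \<otimes> x \<in> C" by (auto simp: l_coset_def)
    then show "g \<in> H" using mem[of "g \<otimes> x"] x g by (simp add: m_assoc)
  next
    assume "g \<in> H"
    then have "g <# H = H" using H HG
      using coset_join3[OF g H] by simp
    then show "g <# C = C" using x coset_assoc[OF g x(1) HG] by simp
  qed
qed

text \<open>Conjugation is injective on subgroups, so the preimage of the conjugate atom is the atom
  itself. This makes the multiplicities obtained by rounding atom weights
  conjugation-invariant.\<close>

lemma (in group) IRS_measure_conjugate_singleton:
  assumes count: "countable (carrier G)" and \<rho>: "\<rho> \<in> IRS G"
    and K: "subgroup K G" and g: "g \<in> carrier G"
  shows "measure \<rho> {g <# K #> inv g} = measure \<rho> {K}"
proof -
  have sets: "sets \<rho> = sets (borel_of (Sub G))" using \<rho> by (simp add: IRS_def)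
  have KG: "K \<subseteq> carrier G" using K by (rule subgroup.subset)
  have m: "(\<lambda>H. g <# H #> inv g) \<in> measurable \<rho> (borel_of (Sub G))"
    using measurable_conjugate[OF count g] sets by (simp cong: measurable_cong_sets)
  have d: "distr \<rho> (borel_of (Sub G)) (\<lambda>H. g <# H #> inv g) = \<rho>"
    using \<rho> g by (simp add: IRS_def)
  have "(\<lambda>H. g <# H #> inv g) -` {g <# K #> inv g} \<inter> space \<rho> = {K}"
  proof (intro equalityI subsetI)
    fix H assume H: "H \<in> (\<lambda>H. g <# H #> inv g) -` {g <# K #> inv g} \<inter> space \<rho>"
    then have "subgroup H G" and e: "g <# H #> inv g = g <# K #> inv g"
      by (simp_all add: space_eq_subgroups[OF sets])
    have "H = inv g <# (g <# H #> inv g) #> g"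
      using inv_conjugate[OF subgroup.subset[OF \<open>subgroup H G\<close>] g] ..
    also have "\<dots> = K" unfolding e by (rule inv_conjugate[OF KG g])
    finally show "H \<in> {K}" by simp
  qed (use K in \<open>auto simp: space_eq_subgroups[OF sets]\<close>)
  then have "measure (distr \<rho> (borel_of (Sub G)) (\<lambda>H. g <# H #> inv g)) {g <# K #> inv g} = measure \<rho> {K}"
    using singleton_sets_Sub[OF count subgroup_conjugate[OF K g]] by (simp add: measure_distr[OF m])
  then show ?thesis unfolding d .
qed

text \<open>For \<open>m\<close> conjugation-invariant, \<open>G\<close> acts on the triples \<open>(K, C, j)\<close> with \<open>C\<close> a right coset of
  \<open>K\<close> and \<open>j < m K\<close> by left multiplication, since \<open>g K x = (g K g\<^sup>-\<^sup>1) g x\<close>; the stabilizer of such a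
  point is exactly \<open>K\<close>, so that \<open>K\<close> is attained \<open>m K \<cdot> [G : K]\<close> times.\<close>

lemma (in group) sym_hom_prescribed_stabilizers:
  assumes fin: "finite {K. 0 < m K}" and sub: "\<And>K. 0 < m K \<Longrightarrow> subgroup K G \<and> finite (rcosets K)"
    and inv: "\<And>K g. subgroup K G \<Longrightarrow> g \<in> carrier G \<Longrightarrow> m (g <# K #> inv g) = m K"
    and n: "(\<Sum>K | 0 < m K. m K * card (rcosets K)) \<le> n"
  shows "\<exists>h\<in>hom G (sym_group n). \<forall>Q. Q \<subseteq> carrier G \<longrightarrow>
    fix_frac n h Q = (real (n - (\<Sum>K | 0 < m K. m K * card (rcosets K))) +
      (\<Sum>K | 0 < m K \<and> Q \<subseteq> K. real (m K * card (rcosets K)))) / real n"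
proof -
  define M where "M = {K. 0 < m K}"
  define \<Omega> where "\<Omega> = (SIGMA K:M. (rcosets K) \<times> {..<m K})"
  define N where "N = (\<Sum>K | 0 < m K. m K * card (rcosets K))"
  have M: "finite M" "subgroup K G" "finite (rcosets K)" if "K \<in> M" for K
    using fin sub that by (auto simp: M_def)
  have finM: "finite M" using fin by (simp add: M_def)
  have card: "card (SIGMA K:M'. (rcosets K) \<times> {..<m K}) = (\<Sum>K\<in>M'. m K * card (rcosets K))" if "M' \<subseteq> M" for M'
    using that M by (subst card_SigmaI) (auto simp: card_cartesian_product mult.commute intro: finite_subset[OF _ finM])
  have fin\<Omega>: "finite \<Omega>" unfolding \<Omega>_def using M finM by (intro finite_SigmaI) auto
  have card\<Omega>: "card \<Omega> = N" unfolding \<Omega>_def N_def using card[of M] by (simp add: M_def)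
  \<comment> \<open>The \<open>Inr\<close> points are fixed by the whole group and bring the degree
    to exactly \<open>n\<close>.\<close>
  define X where "X = Inl ` \<Omega> \<union> Inr ` {..<n - N}"
  define a where "a g x = (case x of Inl (K, C, j) \<Rightarrow> Inl (g <# K #> inv g, g <# C, j) | Inr i \<Rightarrow> Inr i)"
    for g :: 'a and x :: "('a set \<times> 'a set \<times> nat) + nat"
  have finX: "finite X" by (simp add: X_def fin\<Omega>)
  have "card X = card \<Omega> + (n - N)"
    unfolding X_def using fin\<Omega> by (subst card_Un_disjoint) (auto simp: card_image)
  then have cardX: "card X = n" using n by (simp add: card\<Omega> N_def)
  obtain b where b: "bij_betw b {1..n} X"
    using ex_bij_betw_nat_finite_1[OF finX] unfolding cardX by (elim exE)
  have cG: "C \<subseteq> carrier G" if "C \<in> rcosets K" "subgroup K G" for C K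
    using rcosets_part_G[OF that(2)] that(1) by blast
  have closed: "a g x \<in> X" if g: "g \<in> carrier G" and x: "x \<in> X" for g x
  proof (cases x)
    case (Inl t)
    obtain K C j where t: "t = (K, C, j)" by (cases t)
    then have *: "K \<in> M" "C \<in> rcosets K" "j < m K" using x Inl by (auto simp: X_def \<Omega>_def)
    then have "m (g <# K #> inv g) = m K" using inv[OF M(2) g] by simp
    then have "(g <# K #> inv g, g <# C, j) \<in> \<Omega>"
      using * lcos_rcosets_conjugate[OF M(2)[OF *(1)] g] by (simp add: \<Omega>_def M_def)
    then show ?thesis using Inl t by (auto simp: a_def X_def)
  next
    case (Inr i)
    then show ?thesis using x by (simp add: a_def)
  qed
  have one: "a \<one> x = x" if "x \<in> X" for x
  proof (cases x)
    case (Inl t)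
    obtain K C j where t: "t = (K, C, j)" by (cases t)
    then have *: "K \<in> M" "C \<in> rcosets K" using that Inl by (auto simp: X_def \<Omega>_def)
    have K: "subgroup K G" using M(2)[OF *(1)] .
    have "\<one> <# K #> inv \<one> = K" using subgroup.subset[OF K] by (simp add: lcos_mult_one)
    then show ?thesis using Inl t lcos_mult_one[OF cG[OF *(2) K]] by (simp add: a_def)
  qed (simp add: a_def)
  have mult: "a (g \<otimes> h) x = a g (a h x)" if g: "g \<in> carrier G" and h: "h \<in> carrier G" and x: "x \<in> X" for g h x
  proof (cases x)
    case (Inl t)
    obtain K C j where t: "t = (K, C, j)" by (cases t)
    then have *: "K \<in> M" "C \<in> rcosets K" using x Inl by (auto simp: X_def \<Omega>_def)
    have K: "subgroup K G" using M(2)[OF *(1)] .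
    show ?thesis
      using Inl t conjugate_mult[OF subgroup.subset[OF K] g h] lcos_m_assoc[OF cG[OF *(2) K] g h]
      by (simp add: a_def)
  qed (simp add: a_def)
  have "\<exists>h\<in>hom G (sym_group n). \<forall>g\<in>carrier G. \<forall>i\<in>{1..n}. b (h g i) = a g (b i)"
    by (rule sym_hom_of_action[where a = a, OF b closed one mult])
  then obtain h where h: "h \<in> hom G (sym_group n)" "\<forall>g\<in>carrier G. \<forall>i\<in>{1..n}. b (h g i) = a g (b i)"
    by (rule bexE)
  have "fix_frac n h Q = (real (n - N) + (\<Sum>K | 0 < m K \<and> Q \<subseteq> K. real (m K * card (rcosets K)))) / real n"
    if Q: "Q \<subseteq> carrier G" for Q
  proof -
    have stab: "a g (Inl (K, C, j)) = Inl (K, C, j) \<longleftrightarrow> g \<in> K"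
      if "(K, C, j) \<in> \<Omega>" "g \<in> carrier G" for g K C j
    proof -
      have *: "subgroup K G" "C \<in> rcosets K" using that M by (auto simp: \<Omega>_def)
      have "g <# K #> inv g = K" if "g \<in> K"
        using coset_join3[OF \<open>g \<in> carrier G\<close> *(1) that] coset_join2[OF _ *(1), of "inv g"]
          subgroup.m_inv_closed[OF *(1) that] \<open>g \<in> carrier G\<close> by simp
      then show ?thesis
        using lcos_rcoset_eq_iff[OF *(1) that(2) *(2)] by (auto simp: a_def)
    qed
    have "{x \<in> X. \<forall>q\<in>Q. a q x = x} =
        Inl ` (SIGMA K:{K \<in> M. Q \<subseteq> K}. (rcosets K) \<times> {..<m K}) \<union> Inr ` {..<n - N}"
    proof (intro equalityI subsetI)
      fix x assume "x \<in> {x \<in> X. \<forall>q\<in>Q. a q x = x}"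
      then have x: "x \<in> X" "\<forall>q\<in>Q. a q x = x" by auto
      show "x \<in> Inl ` (SIGMA K:{K \<in> M. Q \<subseteq> K}. (rcosets K) \<times> {..<m K}) \<union> Inr ` {..<n - N}"
      proof (cases x)
        case (Inl t)
        obtain K C j where t: "t = (K, C, j)" by (cases t)
        then have \<Omega>: "(K, C, j) \<in> \<Omega>" using x(1) Inl by (auto simp: X_def)
        have "Q \<subseteq> K"
        proof
          fix q assume "q \<in> Q"
          then show "q \<in> K" using stab[OF \<Omega>, of q] x(2) Inl t Q by auto
        qed
        then show ?thesis using \<Omega> Inl t by (auto simp: \<Omega>_def)
      next
        case (Inr i)
        then show ?thesis using x(1) by (auto simp: X_def)
      qed
    next
      fix x assume x: "x \<in> Inl ` (SIGMA K:{K \<in> M. Q \<subseteq> K}. (rcosets K) \<times> {..<m K}) \<union> Inr ` {..<n - N}"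
      show "x \<in> {x \<in> X. \<forall>q\<in>Q. a q x = x}"
      proof (cases x)
        case (Inl t)
        obtain K C j where t: "t = (K, C, j)" by (cases t)
        then have \<Omega>: "(K, C, j) \<in> \<Omega>" "Q \<subseteq> K" using x Inl by (auto simp: \<Omega>_def)
        then have "\<forall>q\<in>Q. a q x = x" using stab[OF \<Omega>(1)] Inl t Q by auto
        then show ?thesis using \<Omega> Inl t by (simp add: X_def)
      next
        case (Inr i)
        then show ?thesis using x by (auto simp: X_def a_def)
      qed
    qed
    also have "card \<dots> = card (SIGMA K:{K \<in> M. Q \<subseteq> K}. (rcosets K) \<times> {..<m K}) + (n - N)"
    proof (subst card_Un_disjoint)
      have "(SIGMA K:{K \<in> M. Q \<subseteq> K}. (rcosets K) \<times> {..<m K}) \<subseteq> \<Omega>" by (auto simp: \<Omega>_def)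
      then show "finite (Inl ` (SIGMA K:{K \<in> M. Q \<subseteq> K}. (rcosets K) \<times> {..<m K}))"
        using fin\<Omega> finite_subset by blast
    qed (auto simp: card_image)
    also have "card (SIGMA K:{K \<in> M. Q \<subseteq> K}. (rcosets K) \<times> {..<m K}) =
        (\<Sum>K\<in>{K \<in> M. Q \<subseteq> K}. m K * card (rcosets K))"
      by (rule card) auto
    finally show ?thesis
      using fix_frac_eq[OF h(1) b h(2) Q] by (simp add: M_def add.commute)
  qed
  then show ?thesis using h(1) unfolding N_def by blast
qed

text \<open>Only countably many subgroups have finite index, so \<rho> is purely atomic, and its
  atoms are realized in proportion to their weights. The error has two sources: the atoms outside a
  finite set \<open>T\<close>, of mass below \<epsilon>/2, and the rounding at the atoms in
  \<open>T\<close>, bounded by a constant and hence at most \<epsilon>/2 of the degree for large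
  \<open>n\<close>.\<close>

lemma (in group) IRS_finite_index_approx:
  assumes count: "countable (carrier G)" and countF: "countable {H. subgroup H G \<and> finite (rcosets H)}"
    and \<rho>: "\<rho> \<in> IRS G" and ae: "AE H in \<rho>. finite (rcosets H)" and "0 < \<epsilon>"
  shows "eventually (\<lambda>n. \<exists>h\<in>hom G (sym_group n). \<forall>Q. finite Q \<longrightarrow> Q \<subseteq> carrier G \<longrightarrow>
    \<bar>fix_frac n h Q - measure \<rho> (above G Q)\<bar> \<le> \<epsilon>) sequentially"
proof -
  interpret \<rho>: prob_space \<rho> using \<rho> by (simp add: IRS_def)
  have sets: "sets \<rho> = sets (borel_of (Sub G))" using \<rho> by (simp add: IRS_def)
  have sp: "space \<rho> = {H. subgroup H G}" by (rule space_eq_subgroups[OF sets])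
  define F where "F = {H. subgroup H G \<and> finite (rcosets H)}"
  have single: "{K} \<in> sets \<rho>" if "subgroup K G" for K
    using singleton_sets_Sub[OF count that] sets by simp
  have sub_sets: "A \<in> sets \<rho>" if "A \<subseteq> F" for A
  proof -
    have "countable A" using that countF countable_subset unfolding F_def by blast
    moreover have "{K} \<in> sets \<rho>" if "K \<in> A" for K
      using that \<open>A \<subseteq> F\<close> by (intro single) (auto simp: F_def)
    ultimately have "(\<Union>K\<in>A. {K}) \<in> sets \<rho>" by (intro sets.countable_UN') auto
    then show ?thesis by simp
  qed
  have probF: "measure \<rho> F = 1"
    using ae by (subst \<rho>.prob_eq_1[OF sub_sets]) (auto simp: F_def sp elim: AE_mp intro!: AE_I2)
  have Fne: "F \<noteq> {}" using probF by auto
  define w where "w K = measure \<rho> {K}" for K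
  have wsum: "measure \<rho> A = (\<Sum>K\<in>A. w K)" if "A \<subseteq> F" "finite A" for A
    unfolding w_def using that single by (intro \<rho>.finite_measure_eq_sum_singleton) (auto simp: F_def)
  define ix where "ix K = card (rcosets K)" for K
  have ix: "1 \<le> ix K" if "K \<in> F" for K
  proof -
    have "K \<in> rcosets K" "finite (rcosets K)"
      using that subgroup.subgroup_in_rcosets[OF _ is_group] by (auto simp: F_def)
    then have "rcosets K \<noteq> {}" "finite (rcosets K)" by auto
    then show ?thesis unfolding ix_def by (simp add: Suc_le_eq card_gt_0_iff)
  qed
  obtain T where T: "finite T" "T \<subseteq> F" "measure \<rho> T > 1 - \<epsilon> / 2"
  proof -
    define e where "e = from_nat_into F"
    have e: "range e = F" unfolding e_def using range_from_nat_into[OF Fne] countF by (simp add: F_def)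
    define A where "A n = e ` {..n}" for n :: nat
    have "A n \<subseteq> F" for n using e by (auto simp: A_def)
    moreover have "incseq A" by (auto simp: incseq_def A_def)
    moreover have "(\<Union>n. A n) = F" using e by (auto simp: A_def)
    ultimately have "(\<lambda>n. measure \<rho> (A n)) \<longlonglongrightarrow> 1"
      using \<rho>.finite_Lim_measure_incseq[of A] sub_sets probF by (auto simp: image_subset_iff)
    then have "eventually (\<lambda>n. measure \<rho> (A n) > 1 - \<epsilon> / 2) sequentially"
      using \<open>0 < \<epsilon>\<close> by (intro order_tendstoD(1)) auto
    then obtain n where "measure \<rho> (A n) > 1 - \<epsilon> / 2" by (auto simp: eventually_sequentially)
    then show thesis using \<open>\<And>n. A n \<subseteq> F\<close> that[of "A n"] by (simp add: A_def)
  qed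
  \<comment> \<open>A bound for the number of points lost to rounding: at most \<open>ix K\<close>
    for each \<open>K\<close> in \<open>T\<close>.\<close>
  define c where "c = (\<Sum>K\<in>T. real (ix K))"
  \<comment> \<open>The subgroup \<open>K\<close> should be the stabilizer of about
    \<open>n * w K\<close> points, and one copy of its coset space provides \<open>ix K\<close> of
    them. Rounding down keeps the total within \<open>n\<close>.\<close>
  define m where "m n K = (if K \<in> F then nat \<lfloor>real n * w K / real (ix K)\<rfloor> else 0)" for n K
  have mle: "real (m n K * ix K) \<le> real n * w K" if "K \<in> F" for n K
  proof -
    have "real (m n K) \<le> real n * w K / real (ix K)"
      using that by (simp add: m_def w_def)
    then show ?thesis using ix[OF that] by (simp add: field_simps)
  qed
  have mge: "real n * w K - real (ix K) \<le> real (m n K * ix K)" if "K \<in> F" for n K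
  proof -
    have "real n * w K / real (ix K) - 1 \<le> real (m n K)"
      using that by (simp add: m_def w_def)
    then show ?thesis using ix[OF that] by (simp add: field_simps)
  qed
  have sum_le: "(\<Sum>K\<in>A. m n K * ix K) \<le> n" if A: "finite A" "A \<subseteq> F" for n A
  proof -
    have "real (\<Sum>K\<in>A. m n K * ix K) \<le> (\<Sum>K\<in>A. real n * w K)"
      unfolding of_nat_sum using A mle by (intro sum_mono) auto
    also have "\<dots> = real n * measure \<rho> A" using wsum[OF A(2,1)] by (simp add: sum_distrib_left)
    also have "\<dots> \<le> real n" by (simp add: mult_left_le)
    finally show ?thesis by (simp only: of_nat_le_iff)
  qed
  \<comment> \<open>A subgroup of positive multiplicity takes up at least one of the
    \<open>n\<close> points.\<close>
  have finm: "finite {K. 0 < m n K}" for n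
  proof (rule ccontr)
    assume "infinite {K. 0 < m n K}"
    then obtain A where A: "finite A" "card A = Suc n" "A \<subseteq> {K. 0 < m n K}"
      using infinite_arbitrarily_large by blast
    then have AF: "A \<subseteq> F" by (auto simp: m_def split: if_splits)
    have "1 \<le> m n K * ix K" if "K \<in> A" for K
    proof -
      have "0 < m n K" "1 \<le> ix K" using A(3) AF ix that by auto
      then show ?thesis by simp
    qed
    then have "(\<Sum>K\<in>A. 1) \<le> (\<Sum>K\<in>A. m n K * ix K)" by (intro sum_mono) auto
    then show False using sum_le[OF A(1) AF, of n] A(2) by simp
  qed
  have mF: "{K. 0 < m n K} \<subseteq> F" for n by (auto simp: m_def)
  have lower: "real n * (measure \<rho> A - \<epsilon> / 2) - c \<le> (\<Sum>K | 0 < m n K \<and> K \<in> A. real (m n K * ix K))"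
    if A: "A \<in> sets \<rho>" for n A
  proof -
    have "measure \<rho> A \<le> measure \<rho> (A \<inter> T) + measure \<rho> (space \<rho> - T)"
    proof -
      have "measure \<rho> A \<le> measure \<rho> ((A \<inter> T) \<union> (space \<rho> - T))"
        using A sub_sets[OF T(2)] sets.sets_into_space[OF A] by (intro \<rho>.finite_measure_mono) auto
      also have "\<dots> \<le> measure \<rho> (A \<inter> T) + measure \<rho> (space \<rho> - T)"
        using A sub_sets[OF T(2)] by (intro measure_Un_le) auto
      finally show ?thesis .
    qed
    also have "measure \<rho> (space \<rho> - T) < \<epsilon> / 2" using T(3) \<rho>.prob_compl[OF sub_sets[OF T(2)]] by simp
    also have "measure \<rho> (A \<inter> T) = (\<Sum>K\<in>A \<inter> T. w K)" using T by (intro wsum) auto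
    finally have "real n * (measure \<rho> A - \<epsilon> / 2) \<le> real n * (\<Sum>K\<in>A \<inter> T. w K)"
      by (intro mult_left_mono) auto
    moreover have "(\<Sum>K\<in>A \<inter> T. real (ix K)) \<le> c"
      unfolding c_def using T(1) by (intro sum_mono2) auto
    ultimately have "real n * (measure \<rho> A - \<epsilon> / 2) - c \<le> (\<Sum>K\<in>A \<inter> T. real n * w K - real (ix K))"
      by (simp add: sum_subtractf sum_distrib_left)
    also have "\<dots> \<le> (\<Sum>K\<in>A \<inter> T. real (m n K * ix K))"
      using T mge by (intro sum_mono) auto
    also have "\<dots> = (\<Sum>K\<in>{K \<in> A \<inter> T. 0 < m n K}. real (m n K * ix K))"
      using T(1) by (intro sum.mono_neutral_right) auto
    also have "\<dots> \<le> (\<Sum>K | 0 < m n K \<and> K \<in> A. real (m n K * ix K))"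
      using finite_subset[OF _ finm[of n]] by (intro sum_mono2) auto
    finally show ?thesis .
  qed
  have w_conj: "w (g <# K #> inv g) = w K" if "subgroup K G" "g \<in> carrier G" for K g
    unfolding w_def by (rule IRS_measure_conjugate_singleton[OF count \<rho> that])
  have m_conj: "m n (g <# K #> inv g) = m n K" if "subgroup K G" "g \<in> carrier G" for n K g
  proof -
    note bij = bij_betw_rcosets_conjugate[OF that]
    show ?thesis
      using bij_betw_finite[OF bij] bij_betw_same_card[OF bij] w_conj[OF that] subgroup_conjugate[OF that] that(1)
      by (simp add: m_def ix_def F_def)
  qed
  have ev: "eventually (\<lambda>n. c \<le> real n * (\<epsilon> / 2) \<and> 1 \<le> n) sequentially"
  proof -
    obtain n0 where "2 * c / \<epsilon> \<le> real n0" using real_arch_simple by blast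
    then have "c \<le> real n * (\<epsilon> / 2) \<and> 1 \<le> n" if "n \<ge> max 1 n0" for n
    proof -
      have "2 * c / \<epsilon> \<le> real n" using that \<open>2 * c / \<epsilon> \<le> real n0\<close> by linarith
      then show ?thesis using \<open>0 < \<epsilon>\<close> that by (simp add: field_simps)
    qed
    then show ?thesis unfolding eventually_sequentially by blast
  qed
  show ?thesis using ev
  proof eventually_elim
    case (elim n)
    have N: "(\<Sum>K | 0 < m n K. m n K * card (rcosets K)) \<le> n"
      using sum_le[OF finm mF] by (simp add: ix_def)
    have subm: "subgroup K G \<and> finite (rcosets K)" if "0 < m n K" for K
      using that mF[of n] by (auto simp: F_def)
    have "\<exists>h\<in>hom G (sym_group n). \<forall>Q. Q \<subseteq> carrier G \<longrightarrow>
      fix_frac n h Q = (real (n - (\<Sum>K | 0 < m n K. m n K * card (rcosets K))) +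
        (\<Sum>K | 0 < m n K \<and> Q \<subseteq> K. real (m n K * card (rcosets K)))) / real n"
      by (rule sym_hom_prescribed_stabilizers[OF finm subm m_conj N])
    then obtain h where h: "h \<in> hom G (sym_group n)" "\<forall>Q. Q \<subseteq> carrier G \<longrightarrow>
      fix_frac n h Q = (real (n - (\<Sum>K | 0 < m n K. m n K * card (rcosets K))) +
        (\<Sum>K | 0 < m n K \<and> Q \<subseteq> K. real (m n K * card (rcosets K)))) / real n" by (rule bexE)
    have "\<bar>fix_frac n h Q - measure \<rho> (above G Q)\<bar> \<le> \<epsilon>" if Q: "finite Q" "Q \<subseteq> carrier G" for Q
    proof -
      let ?p = "measure \<rho> (above G Q)"
      let ?s = "\<lambda>P. \<Sum>K | 0 < m n K \<and> P K. real (m n K * ix K)"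
      have aQ: "above G Q \<in> sets \<rho>" using Q sets by simp
      have s1: "?s (\<lambda>K. K \<in> above G Q) = ?s (\<lambda>K. Q \<subseteq> K)"
        using subm by (intro sum.cong) (auto simp: above_def)
      have s2: "?s (\<lambda>K. K \<in> space \<rho> - above G Q) = ?s (\<lambda>K. \<not> Q \<subseteq> K)"
        using subm by (intro sum.cong) (auto simp: above_def sp)
      have low: "real n * (?p - \<epsilon> / 2) - c \<le> ?s (\<lambda>K. Q \<subseteq> K)" using lower[OF aQ, of n] unfolding s1 .
      \<comment> \<open>Applied to the complementary event, the lower bound counts points that do
        not fix \<open>Q\<close>. This yields the upper bound on \<open>fix_frac\<close> and also
        absorbs the filler points, which fix everything.\<close>
      have high: "real n * (1 - ?p - \<epsilon> / 2) - c \<le> ?s (\<lambda>K. \<not> Q \<subseteq> K)"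
        using lower[of "space \<rho> - above G Q" n] aQ unfolding s2 by (simp add: \<rho>.prob_compl)
      define N where "N = (\<Sum>K | 0 < m n K. m n K * card (rcosets K))"
      have Nsum: "real N = ?s (\<lambda>K. Q \<subseteq> K) + ?s (\<lambda>K. \<not> Q \<subseteq> K)"
        unfolding of_nat_sum ix_def[symmetric] N_def
        by (subst sum.union_disjoint[symmetric]) (auto intro!: sum.cong finite_subset[OF _ finm[of n]])
      have "N \<le> n" using N by (simp only: N_def)
      then have Nn: "real N \<le> real n" by simp
      have "fix_frac n h Q = (real (n - N) + ?s (\<lambda>K. Q \<subseteq> K)) / real n"
        using h(2) Q(2) by (simp only: N_def ix_def)
      then have fr: "fix_frac n h Q * real n = real n - real N + ?s (\<lambda>K. Q \<subseteq> K)"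
        using elim by (simp add: of_nat_diff[OF \<open>N \<le> n\<close>])
      have "fix_frac n h Q * real n \<le> real n * (?p + \<epsilon> / 2) + c"
          "real n * (?p - \<epsilon> / 2) - c \<le> fix_frac n h Q * real n"
        using low high Nsum Nn fr by (simp_all add: algebra_simps)
      then have "fix_frac n h Q * real n \<le> (?p + \<epsilon>) * real n" "(?p - \<epsilon>) * real n \<le> fix_frac n h Q * real n"
        using elim by (simp_all add: algebra_simps)
      then have "fix_frac n h Q \<le> ?p + \<epsilon>" "?p - \<epsilon> \<le> fix_frac n h Q"
        using elim by simp_all
      then show ?thesis by (simp add: abs_le_iff)
    qed
    then show ?case using h(1) by blast
  qed
qed

lemma trivial_sym_hom: "(\<lambda>_. id) \<in> hom G (sym_group n)"
  by (intro homI) (auto simp: sym_group_carrier sym_group_mult permutes_id)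

text \<open>Each approximant \<open>\<mu>s k\<close> is realized within
  \<open>1 / real (Suc k)\<close> on all sufficiently large sets; letting \<open>k\<close> grow
  slowly with \<open>l\<close> realizes the limit on the prescribed degrees.\<close>

theorem (in group) co_sofic_imp_finite_actions:
  assumes count: "countable (carrier G)" and countF: "countable {H. subgroup H G \<and> finite (rcosets H)}"
    and \<mu>: "co_sofic G \<mu>" and n: "filterlim n at_top sequentially"
  shows "\<exists>g. (\<forall>l. g l \<in> hom G (sym_group (n l))) \<and>
    (\<forall>Q. finite Q \<longrightarrow> Q \<subseteq> carrier G \<longrightarrow>
      (\<lambda>l. fix_frac (n l) (g l) Q) \<longlonglongrightarrow> measure \<mu> (above G Q))"
proof -
  obtain \<mu>s where \<mu>s: "\<forall>k. \<mu>s k \<in> IRS G \<and> (AE H in \<mu>s k. finite (rcosets H))"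
    "limitin (IRS_topology G) \<mu>s \<mu> sequentially"
    using \<mu> unfolding co_sofic_def by (elim exE conjE)
  have lim: "(\<lambda>k. measure (\<mu>s k) (above G Q)) \<longlonglongrightarrow> measure \<mu> (above G Q)"
    if "finite Q" "Q \<subseteq> carrier G" for Q
    using \<mu>s(2)[unfolded limitin_IRS_iff[OF count]] that by (elim conjE) simp
  \<comment> \<open>The bound is uniform in \<open>Q\<close>, so one slowly growing \<kappa> serves
    all finite sets simultaneously.\<close>
  define P where "P k N h \<longleftrightarrow> h \<in> hom G (sym_group N) \<and> (\<forall>Q. finite Q \<longrightarrow> Q \<subseteq> carrier G \<longrightarrow>
    \<bar>fix_frac N h Q - measure (\<mu>s k) (above G Q)\<bar> \<le> 1 / real (Suc k))" for k N h
  have "eventually (\<lambda>N. \<exists>h. P k N h) sequentially" for k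
    using IRS_finite_index_approx[OF count countF, of "\<mu>s k" "1 / real (Suc k)"] \<mu>s(1)
    unfolding P_def by (simp add: Bex_def)
  then have "eventually (\<lambda>l. \<exists>h. P k (n l) h) sequentially" for k
    using n by (rule eventually_compose_filterlim)
  from slow_diagonal[of "\<lambda>k l. \<exists>h. P k (n l) h", OF this] obtain \<kappa> where \<kappa>: "filterlim \<kappa> at_top sequentially" "eventually (\<lambda>l. \<exists>h. P (\<kappa> l) (n l) h) sequentially"
    by (elim exE conjE)
  \<comment> \<open>The trivial action stands in at the finitely many indices where no approximating
    action is known.\<close>
  define g where "g l = (if \<exists>h. P (\<kappa> l) (n l) h then SOME h. P (\<kappa> l) (n l) h else (\<lambda>_. id))" for l
  have gP: "P (\<kappa> l) (n l) (g l)" if "\<exists>h. P (\<kappa> l) (n l) h" for l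
    using someI_ex[OF that] that by (simp add: g_def)
  have "g l \<in> hom G (sym_group (n l))" for l
  proof (cases "\<exists>h. P (\<kappa> l) (n l) h")
    case True
    then show ?thesis using gP by (simp add: P_def)
  next
    case False
    then have "g l = (\<lambda>_. id)" unfolding g_def by (simp only: if_False)
    then show ?thesis using trivial_sym_hom by simp
  qed
  moreover have "(\<lambda>l. fix_frac (n l) (g l) Q) \<longlonglongrightarrow> measure \<mu> (above G Q)"
    if Q: "finite Q" "Q \<subseteq> carrier G" for Q
  proof -
    have "(\<lambda>l. fix_frac (n l) (g l) Q - measure (\<mu>s (\<kappa> l)) (above G Q)) \<longlonglongrightarrow> 0"
    proof (rule Lim_null_comparison)
      show "eventually (\<lambda>l. norm (fix_frac (n l) (g l) Q - measure (\<mu>s (\<kappa> l)) (above G Q)) \<le> 1 / real (Suc (\<kappa> l))) sequentially"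
        using \<kappa>(2)
      proof eventually_elim
        case (elim l)
        then show ?case using gP[OF elim] Q unfolding P_def by simp
      qed
      show "(\<lambda>l. 1 / real (Suc (\<kappa> l))) \<longlonglongrightarrow> 0"
        using filterlim_compose[OF LIMSEQ_inverse_real_of_nat \<kappa>(1)] by (simp add: inverse_eq_divide)
    qed
    moreover have "(\<lambda>l. measure (\<mu>s (\<kappa> l)) (above G Q)) \<longlonglongrightarrow> measure \<mu> (above G Q)"
      by (rule filterlim_compose[OF lim[OF Q] \<kappa>(1)])
    ultimately show ?thesis using tendsto_add by fastforce
  qed
  ultimately show ?thesis by (intro exI[of _ g] conjI allI impI)
qed

section \<open>Permutation distance and correction of asymptotic homomorphisms\<close>

lemma perm_dist_eq:
  "n \<le> M \<Longrightarrow> perm_dist n M \<sigma> \<tau> = real (card {x \<in> {1..n}. \<sigma> x \<noteq> \<tau> x}) / real n"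
  by (simp add: perm_dist_def min_absorb1)

lemma perm_dist_nonneg: "0 \<le> perm_dist n M \<sigma> \<tau>"
  by (simp add: perm_dist_def)

lemma perm_dist_refl: "perm_dist n M \<sigma> \<sigma> = 0"
  by (simp add: perm_dist_def)

lemma perm_dist_commute: "perm_dist n n \<sigma> \<tau> = perm_dist n n \<tau> \<sigma>"
proof -
  have "{x \<in> {1..min n n}. \<sigma> x \<noteq> \<tau> x} = {x \<in> {1..min n n}. \<tau> x \<noteq> \<sigma> x}" by auto
  then show ?thesis by (simp only: perm_dist_def)
qed

lemma perm_dist_le_card:
  assumes "n \<le> M" "card {x \<in> {1..n}. \<sigma> x \<noteq> \<tau> x} \<le> k"
  shows "perm_dist n M \<sigma> \<tau> \<le> real k / real n"
  using assms by (simp add: perm_dist_eq divide_right_mono del: One_nat_def)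

lemma perm_dist_triangle:
  assumes "n \<le> M"
  shows "perm_dist n M \<sigma> \<tau> \<le> perm_dist n n \<sigma> \<rho> + perm_dist n M \<rho> \<tau>"
proof -
  have "card {x \<in> {1..n}. \<sigma> x \<noteq> \<tau> x} \<le> card ({x \<in> {1..n}. \<sigma> x \<noteq> \<rho> x} \<union> {x \<in> {1..n}. \<rho> x \<noteq> \<tau> x})"
    by (intro card_mono) auto
  also have "\<dots> \<le> card {x \<in> {1..n}. \<sigma> x \<noteq> \<rho> x} + card {x \<in> {1..n}. \<rho> x \<noteq> \<tau> x}"
    by (rule card_Un_le)
  finally show ?thesis
    by (rule perm_dist_le_card[OF assms, THEN order_trans])
      (simp only: perm_dist_eq[OF assms] perm_dist_eq[OF order_refl] of_nat_add add_divide_distrib order_refl)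
qed

lemma card_permuted:
  assumes "p permutes A"
  shows "card {x \<in> A. P (p x)} = card {x \<in> A. P x}"
proof -
  have "bij_betw p {x \<in> A. P (p x)} {x \<in> A. P x}"
  proof (rule bij_betw_imageI)
    show "inj_on p {x \<in> A. P (p x)}" using permutes_inj_on[OF assms] by (rule inj_on_subset) auto
    show "p ` {x \<in> A. P (p x)} = {x \<in> A. P x}"
    proof (intro equalityI subsetI)
      fix y assume y: "y \<in> {x \<in> A. P x}"
      then have "inv' p y \<in> A" "p (inv' p y) = y"
        using assms permutes_in_image[OF permutes_inv[OF assms]] by (simp_all add: permutes_inverses)
      then show "y \<in> p ` {x \<in> A. P (p x)}" using y by (intro image_eqI[of _ _ "inv' p y"]) auto
    qed (use permutes_in_image[OF assms] in auto)
  qed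
  then show ?thesis by (rule bij_betw_same_card)
qed

text \<open>Disagreements of \<sigma> and \<tau> after \<open>\<sigma>'\<close> are counted by
  moving them along \<open>\<sigma>'\<close>, which permutes \<open>{1..n}\<close>. The second pair
  acts on a possibly larger set, and \<tau> or \<open>\<tau>'\<close> may lead out of
  \<open>{1..n}\<close>.\<close>

lemma perm_dist_comp:
  assumes "n \<le> M" "\<sigma>' permutes {1..n}"
  shows "perm_dist n M (\<sigma> \<circ> \<sigma>') (\<tau> \<circ> \<tau>') \<le> perm_dist n M \<sigma> \<tau> + perm_dist n M \<sigma>' \<tau>'"
proof -
  have "card {x \<in> {1..n}. (\<sigma> \<circ> \<sigma>') x \<noteq> (\<tau> \<circ> \<tau>') x} \<le>
      card ({x \<in> {1..n}. \<sigma> (\<sigma>' x) \<noteq> \<tau> (\<sigma>' x)} \<union> {x \<in> {1..n}. \<sigma>' x \<noteq> \<tau>' x})"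
    by (intro card_mono) auto
  also have "\<dots> \<le> card {x \<in> {1..n}. \<sigma> (\<sigma>' x) \<noteq> \<tau> (\<sigma>' x)} + card {x \<in> {1..n}. \<sigma>' x \<noteq> \<tau>' x}"
    by (rule card_Un_le)
  also have "card {x \<in> {1..n}. \<sigma> (\<sigma>' x) \<noteq> \<tau> (\<sigma>' x)} = card {x \<in> {1..n}. \<sigma> x \<noteq> \<tau> x}"
    by (rule card_permuted[OF assms(2)])
  finally show ?thesis
    by (rule perm_dist_le_card[OF assms(1), THEN order_trans])
      (simp only: perm_dist_eq[OF assms(1)] of_nat_add add_divide_distrib order_refl)
qed

text \<open>Substitute \<open>y = \<sigma> z\<close>: where \<sigma> and \<tau> agree at
  \<open>z\<close>, both inverses send the common value back to \<open>z\<close>.\<close>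

lemma perm_dist_inv:
  assumes "n \<le> M" "\<sigma> permutes {1..n}" "\<tau> permutes {1..M}"
  shows "perm_dist n M (inv' \<sigma>) (inv' \<tau>) \<le> perm_dist n M \<sigma> \<tau>"
proof -
  have "card {y \<in> {1..n}. inv' \<sigma> y \<noteq> inv' \<tau> y} = card {z \<in> {1..n}. inv' \<sigma> (\<sigma> z) \<noteq> inv' \<tau> (\<sigma> z)}"
    by (rule card_permuted[OF assms(2), symmetric])
  also have "\<dots> \<le> card {z \<in> {1..n}. \<sigma> z \<noteq> \<tau> z}"
  proof (rule card_mono)
    show "{z \<in> {1..n}. inv' \<sigma> (\<sigma> z) \<noteq> inv' \<tau> (\<sigma> z)} \<subseteq> {z \<in> {1..n}. \<sigma> z \<noteq> \<tau> z}"
      using permutes_inverses(2)[OF assms(2)] permutes_inverses(2)[OF assms(3)] by auto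
  qed simp
  finally show ?thesis
    using perm_dist_le_card[OF assms(1)] assms(1) by (simp add: perm_dist_eq del: One_nat_def)
qed

lemma perm_dist_comp_id:
  assumes "\<tau> permutes {1..n}"
  shows "perm_dist n n \<sigma> (inv' \<tau>) = perm_dist n n (\<sigma> \<circ> \<tau>) id"
proof -
  have "card {y \<in> {1..n}. \<sigma> y \<noteq> inv' \<tau> y} = card {z \<in> {1..n}. \<sigma> (\<tau> z) \<noteq> inv' \<tau> (\<tau> z)}"
    by (rule card_permuted[OF assms, symmetric])
  then show ?thesis by (simp add: perm_dist_def permutes_inverses[OF assms] del: One_nat_def)
qed

lemma sym_hom_permutes:
  "h \<in> hom G (sym_group n) \<Longrightarrow> g \<in> carrier G \<Longrightarrow> h g permutes {1..n}"
  by (auto simp: hom_def sym_group_carrier)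

lemma sym_hom_mult:
  "h \<in> hom G (sym_group n) \<Longrightarrow> g \<in> carrier G \<Longrightarrow> g' \<in> carrier G \<Longrightarrow> h (g \<otimes>\<^bsub>G\<^esub> g') = h g \<circ> h g'"
  by (simp add: hom_mult sym_group_mult)

lemma sym_hom_one:
  assumes "group G" "h \<in> hom G (sym_group n)"
  shows "h \<one>\<^bsub>G\<^esub> = id"
  using group_hom.hom_one[of G "sym_group n" h] assms
  by (simp add: group_hom_def group_hom_axioms_def sym_group_is_group sym_group_one)

lemma sym_hom_inv:
  assumes "group G" and h: "h \<in> hom G (sym_group n)" and g: "g \<in> carrier G"
  shows "h (inv\<^bsub>G\<^esub> g) = inv' (h g)"
proof -
  interpret group G by fact
  have "h (inv\<^bsub>G\<^esub> g) \<circ> h g = id"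
    using sym_hom_mult[OF h, of "inv\<^bsub>G\<^esub> g" g] sym_hom_one[OF assms(1,2)] g by simp
  then have "h (inv\<^bsub>G\<^esub> g) \<circ> (h g \<circ> inv' (h g)) = inv' (h g)" by (simp add: o_assoc)
  then show ?thesis using permutes_inv_o(1)[OF sym_hom_permutes[OF h g]] by simp
qed

text \<open>The constant can be taken as the length of the word, each letter costing at most one
  generator defect. It is chosen before the degrees and the actions, so the bound is uniform along a
  sequence.\<close>

lemma perm_dist_word_bound:
  assumes "group G" and \<pi>: "\<pi> \<in> hom (free_group S) G" and "finite S" and w: "w \<in> carrier (free_group S)"
  shows "\<exists>C::nat. \<forall>n N \<alpha> h. \<alpha> \<in> hom (free_group S) (sym_group n) \<longrightarrow> h \<in> hom G (sym_group N) \<longrightarrow> n \<le> N \<longrightarrow>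
    perm_dist n N (\<alpha> w) (h (\<pi> w)) \<le> real C * (\<Sum>s\<in>S. perm_dist n N (\<alpha> (gen s)) (h (\<pi> (gen s))))"
  using w
proof (induction rule: free_group_induct)
  case one
  have "\<pi> \<one>\<^bsub>free_group S\<^esub> = \<one>\<^bsub>G\<^esub>"
    using group_hom.hom_one[OF group_hom_free_group[OF assms(1) \<pi>]] .
  then show ?case
    by (intro exI[of _ 0])
      (simp add: sym_hom_one[OF assms(1)] sym_hom_one[OF group_free_group] perm_dist_refl)
next
  case (gen s w)
  then obtain C where C: "\<And>n N \<alpha> h. \<alpha> \<in> hom (free_group S) (sym_group n) \<Longrightarrow> h \<in> hom G (sym_group N) \<Longrightarrow> n \<le> N \<Longrightarrow>
    perm_dist n N (\<alpha> w) (h (\<pi> w)) \<le> real C * (\<Sum>s\<in>S. perm_dist n N (\<alpha> (gen s)) (h (\<pi> (gen s))))" by blast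
  note gs = gen_in_carrier[OF gen(1)]
  show ?case
  proof (intro exI[of _ "Suc C"] allI impI)
    fix n N \<alpha> h assume \<alpha>: "\<alpha> \<in> hom (free_group S) (sym_group n)" and h: "h \<in> hom G (sym_group N)" and nN: "n \<le> N"
    have "perm_dist n N (\<alpha> (gen s)) (h (\<pi> (gen s))) \<le> (\<Sum>s\<in>S. perm_dist n N (\<alpha> (gen s)) (h (\<pi> (gen s))))"
      using gen(1) \<open>finite S\<close> by (intro member_le_sum) (auto simp: perm_dist_nonneg)
    then show "perm_dist n N (\<alpha> (gen s \<otimes>\<^bsub>free_group S\<^esub> w)) (h (\<pi> (gen s \<otimes>\<^bsub>free_group S\<^esub> w))) \<le>
        real (Suc C) * (\<Sum>s\<in>S. perm_dist n N (\<alpha> (gen s)) (h (\<pi> (gen s))))"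
      using perm_dist_comp[OF nN sym_hom_permutes[OF \<alpha> gen(2)], of "\<alpha> (gen s)" "h (\<pi> (gen s))" "h (\<pi> w)"]
        C[OF \<alpha> h nN] sym_hom_mult[OF \<alpha> gs gen(2)]
        sym_hom_mult[OF h hom_in_carrier[OF \<pi> gs] hom_in_carrier[OF \<pi> gen(2)]] hom_mult[OF \<pi> gs gen(2)]
      by (simp add: algebra_simps)
  qed
next
  case (inv_gen s w)
  then obtain C where C: "\<And>n N \<alpha> h. \<alpha> \<in> hom (free_group S) (sym_group n) \<Longrightarrow> h \<in> hom G (sym_group N) \<Longrightarrow> n \<le> N \<Longrightarrow>
    perm_dist n N (\<alpha> w) (h (\<pi> w)) \<le> real C * (\<Sum>s\<in>S. perm_dist n N (\<alpha> (gen s)) (h (\<pi> (gen s))))" by blast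
  note gs = gen_in_carrier[OF inv_gen(1)]
  interpret F: group "free_group S" by (rule group_free_group)
  note ig = F.inv_closed[OF gs]
  have \<pi>i: "\<pi> (inv\<^bsub>free_group S\<^esub> (gen s)) = inv\<^bsub>G\<^esub> (\<pi> (gen s))"
    using group_hom.hom_inv[OF group_hom_free_group[OF assms(1) \<pi>] gs] .
  show ?case
  proof (intro exI[of _ "Suc C"] allI impI)
    fix n N \<alpha> h assume \<alpha>: "\<alpha> \<in> hom (free_group S) (sym_group n)" and h: "h \<in> hom G (sym_group N)" and nN: "n \<le> N"
    have "perm_dist n N (\<alpha> (inv\<^bsub>free_group S\<^esub> (gen s))) (h (\<pi> (inv\<^bsub>free_group S\<^esub> (gen s)))) \<le>
        perm_dist n N (\<alpha> (gen s)) (h (\<pi> (gen s)))"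
      using perm_dist_inv[OF nN sym_hom_permutes[OF \<alpha> gs] sym_hom_permutes[OF h hom_in_carrier[OF \<pi> gs]]]
        sym_hom_inv[OF group_free_group \<alpha> gs] sym_hom_inv[OF assms(1) h hom_in_carrier[OF \<pi> gs]] \<pi>i
      by simp
    also have "\<dots> \<le> (\<Sum>s\<in>S. perm_dist n N (\<alpha> (gen s)) (h (\<pi> (gen s))))"
      using inv_gen(1) \<open>finite S\<close> by (intro member_le_sum) (auto simp: perm_dist_nonneg)
    finally show "perm_dist n N (\<alpha> (inv\<^bsub>free_group S\<^esub> (gen s) \<otimes>\<^bsub>free_group S\<^esub> w))
          (h (\<pi> (inv\<^bsub>free_group S\<^esub> (gen s) \<otimes>\<^bsub>free_group S\<^esub> w))) \<le>
        real (Suc C) * (\<Sum>s\<in>S. perm_dist n N (\<alpha> (gen s)) (h (\<pi> (gen s))))"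
      using perm_dist_comp[OF nN sym_hom_permutes[OF \<alpha> inv_gen(2)], of "\<alpha> (inv\<^bsub>free_group S\<^esub> (gen s))"
          "h (\<pi> (inv\<^bsub>free_group S\<^esub> (gen s)))" "h (\<pi> w)"]
        C[OF \<alpha> h nN] sym_hom_mult[OF \<alpha> ig inv_gen(2)]
        sym_hom_mult[OF h hom_in_carrier[OF \<pi> ig] hom_in_carrier[OF \<pi> inv_gen(2)]] hom_mult[OF \<pi> ig inv_gen(2)]
      by (simp add: algebra_simps)
  qed
qed

lemma tendsto_0_le:
  fixes f g :: "nat \<Rightarrow> real"
  assumes "g \<longlonglongrightarrow> 0" "\<And>n. 0 \<le> f n" "\<And>n. f n \<le> g n"
  shows "f \<longlonglongrightarrow> 0"
  by (rule tendsto_sandwich[OF _ _ tendsto_const assms(1)]) (use assms in auto)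

text \<open>Exact actions of the free group are given by the values of \<open>f\<close> on
  generators. A fixed word uses multiplicativity of \<open>f\<close> finitely often, so the
  accumulated error still tends to 0.\<close>

lemma asymptotic_hom_shadow:
  assumes "group G" and \<pi>: "\<pi> \<in> hom (free_group S) G" and f: "asymptotic_hom G n f"
    and \<alpha>: "\<And>l. \<alpha> l \<in> hom (free_group S) (sym_group (n l))"
    and eq: "\<And>l s. s \<in> S \<Longrightarrow> \<alpha> l (gen s) = f l (\<pi> (gen s))"
    and w: "w \<in> carrier (free_group S)"
  shows "(\<lambda>l. perm_dist (n l) (n l) (f l (\<pi> w)) (\<alpha> l w)) \<longlonglongrightarrow> 0"
proof -
  interpret G: group G by fact
  interpret F: group "free_group S" by (rule group_free_group)
  interpret \<pi>: group_hom "free_group S" G \<pi> by (rule group_hom_free_group[OF assms(1) \<pi>])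
  have perm: "f l g permutes {1..n l}" if "g \<in> carrier G" for l g
    using f that by (auto simp: asymptotic_hom_def sym_group_carrier Pi_iff)
  have f_mult: "(\<lambda>l. perm_dist (n l) (n l) (f l (g \<otimes>\<^bsub>G\<^esub> h)) (f l g \<circ> f l h)) \<longlonglongrightarrow> 0"
    if "g \<in> carrier G" "h \<in> carrier G" for g h
    using f that by (simp add: asymptotic_hom_def sym_group_mult)
  \<comment> \<open>The image of the identity is close to its own square, and a permutation agrees
    with its square exactly at its fixed points.\<close>
  have f_one: "(\<lambda>l. perm_dist (n l) (n l) (f l \<one>\<^bsub>G\<^esub>) id) \<longlonglongrightarrow> 0"
  proof -
    have iff: "f l \<one>\<^bsub>G\<^esub> x = f l \<one>\<^bsub>G\<^esub> (f l \<one>\<^bsub>G\<^esub> x) \<longleftrightarrow> f l \<one>\<^bsub>G\<^esub> x = x" for l x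
      using inj_eq[OF permutes_inj[OF perm[OF G.one_closed, of l]], of x "f l \<one>\<^bsub>G\<^esub> x"] by metis
    have "perm_dist (n l) (n l) (f l \<one>\<^bsub>G\<^esub>) (f l \<one>\<^bsub>G\<^esub> \<circ> f l \<one>\<^bsub>G\<^esub>) = perm_dist (n l) (n l) (f l \<one>\<^bsub>G\<^esub>) id" for l
      unfolding perm_dist_def comp_apply id_apply iff ..
    then show ?thesis using f_mult[OF G.one_closed G.one_closed] by simp
  qed
  \<comment> \<open>The product of the images of \<open>inv g\<close> and \<open>g\<close> is close
    to the image of the identity, hence to \<open>id\<close>; cancelling the permutation
    \<open>f l g\<close> on the right preserves distances.\<close>
  have f_inv: "(\<lambda>l. perm_dist (n l) (n l) (f l (inv\<^bsub>G\<^esub> g)) (inv' (f l g))) \<longlonglongrightarrow> 0"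
    if g: "g \<in> carrier G" for g
  proof (rule tendsto_0_le)
    show "(\<lambda>l. perm_dist (n l) (n l) (f l (inv\<^bsub>G\<^esub> g \<otimes>\<^bsub>G\<^esub> g)) (f l (inv\<^bsub>G\<^esub> g) \<circ> f l g) +
        perm_dist (n l) (n l) (f l \<one>\<^bsub>G\<^esub>) id) \<longlonglongrightarrow> 0"
      using tendsto_add[OF f_mult[OF G.inv_closed[OF g] g] f_one] by simp
    fix l
    show "perm_dist (n l) (n l) (f l (inv\<^bsub>G\<^esub> g)) (inv' (f l g)) \<le>
        perm_dist (n l) (n l) (f l (inv\<^bsub>G\<^esub> g \<otimes>\<^bsub>G\<^esub> g)) (f l (inv\<^bsub>G\<^esub> g) \<circ> f l g) +
        perm_dist (n l) (n l) (f l \<one>\<^bsub>G\<^esub>) id"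
      using perm_dist_triangle[of "n l" "n l" "f l (inv\<^bsub>G\<^esub> g) \<circ> f l g" id "f l \<one>\<^bsub>G\<^esub>"] g
      by (simp add: perm_dist_comp_id[OF perm[OF g]] perm_dist_commute[of "n l" "f l \<one>\<^bsub>G\<^esub>" "f l (inv\<^bsub>G\<^esub> g) \<circ> f l g"])
  qed (rule perm_dist_nonneg)
  have step: "(\<lambda>l. perm_dist (n l) (n l) (f l (\<pi> (u \<otimes>\<^bsub>free_group S\<^esub> v))) (\<alpha> l (u \<otimes>\<^bsub>free_group S\<^esub> v))) \<longlonglongrightarrow> 0"
    if u: "u \<in> carrier (free_group S)" and v: "v \<in> carrier (free_group S)"
      and limu: "(\<lambda>l. perm_dist (n l) (n l) (f l (\<pi> u)) (\<alpha> l u)) \<longlonglongrightarrow> 0"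
      and limv: "(\<lambda>l. perm_dist (n l) (n l) (f l (\<pi> v)) (\<alpha> l v)) \<longlonglongrightarrow> 0" for u v
  proof (rule tendsto_0_le)
    show "(\<lambda>l. perm_dist (n l) (n l) (f l (\<pi> u \<otimes>\<^bsub>G\<^esub> \<pi> v)) (f l (\<pi> u) \<circ> f l (\<pi> v)) +
        (perm_dist (n l) (n l) (f l (\<pi> u)) (\<alpha> l u) + perm_dist (n l) (n l) (f l (\<pi> v)) (\<alpha> l v))) \<longlonglongrightarrow> 0"
      using tendsto_add[OF f_mult[OF \<pi>.hom_closed[OF u] \<pi>.hom_closed[OF v]] tendsto_add[OF limu limv]] by simp
    fix l
    show "perm_dist (n l) (n l) (f l (\<pi> (u \<otimes>\<^bsub>free_group S\<^esub> v))) (\<alpha> l (u \<otimes>\<^bsub>free_group S\<^esub> v)) \<le>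
      perm_dist (n l) (n l) (f l (\<pi> u \<otimes>\<^bsub>G\<^esub> \<pi> v)) (f l (\<pi> u) \<circ> f l (\<pi> v)) +
        (perm_dist (n l) (n l) (f l (\<pi> u)) (\<alpha> l u) + perm_dist (n l) (n l) (f l (\<pi> v)) (\<alpha> l v))"
      using perm_dist_triangle[of "n l" "n l" "f l (\<pi> u \<otimes>\<^bsub>G\<^esub> \<pi> v)" "\<alpha> l u \<circ> \<alpha> l v" "f l (\<pi> u) \<circ> f l (\<pi> v)"]
        perm_dist_comp[OF order_refl perm[OF \<pi>.hom_closed[OF v]], of l "f l (\<pi> u)" "\<alpha> l u" "\<alpha> l v"]
        sym_hom_mult[OF \<alpha> u v] \<pi>.hom_mult[OF u v] by simp
  qed (rule perm_dist_nonneg)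
  show ?thesis using w
  proof (induction rule: free_group_induct)
    case one
    then show ?case using f_one by (simp only: \<pi>.hom_one sym_hom_one[OF group_free_group \<alpha>])
  next
    case (gen s w)
    show ?case
      using gen by (intro step gen_in_carrier) (simp_all add: eq perm_dist_refl)
  next
    case (inv_gen s w)
    have gs: "gen s \<in> carrier (free_group S)" by (rule gen_in_carrier[OF inv_gen(1)])
    show ?case
      using inv_gen gs f_inv[OF \<pi>.hom_closed[OF gs]]
      by (intro step F.inv_closed) (simp_all add: eq sym_hom_inv[OF group_free_group \<alpha> gs])
  qed
qed

section \<open>Correctability without rates\<close>

text \<open>A condition on a single action, in which \<delta> is both the admissible defect and the
  argument of \<nu>. Requiring it eventually for every \<delta> replaces the choice of a rate, and
  its failure can be examined along subsequences.\<close>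

definition nearly_action ::
  "(real \<Rightarrow> nat \<Rightarrow> enat) \<Rightarrow> 's set \<Rightarrow> ('g, 'b) monoid_scheme \<Rightarrow> ('s word \<Rightarrow> 'g) \<Rightarrow>
    real \<Rightarrow> nat \<Rightarrow> ('s word \<Rightarrow> nat \<Rightarrow> nat) \<Rightarrow> bool" where
  "nearly_action \<nu> S G \<pi> \<delta> n \<alpha> \<longleftrightarrow>
     (\<exists>N h. h \<in> hom G (sym_group N) \<and> n \<le> N \<and> enat N \<le> enat n + \<nu> \<delta> n \<and>
        (\<Sum>s\<in>S. perm_dist n N (\<alpha> (gen s)) (h (\<pi> (gen s)))) < \<delta>)"

text \<open>The rate takes only the values \<open>1 / real (Suc k)\<close>, so the diagonal choice
  over natural numbers applies.\<close>

lemma slow_rate: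
  assumes "\<And>\<delta>::real. 0 < \<delta> \<Longrightarrow> eventually (P \<delta>) sequentially"
  shows "\<exists>\<epsilon>. (\<forall>n. 0 < \<epsilon> n) \<and> \<epsilon> \<longlonglongrightarrow> 0 \<and> eventually (\<lambda>n. P (\<epsilon> n) n) sequentially"
proof -
  have "eventually (P (1 / real (Suc k))) sequentially" for k by (rule assms) simp
  from slow_diagonal[of "\<lambda>k. P (1 / real (Suc k))", OF this] obtain \<kappa> where
    \<kappa>: "filterlim \<kappa> at_top sequentially" "eventually (\<lambda>n. P (1 / real (Suc (\<kappa> n))) n) sequentially"
    by (elim exE conjE)
  have "(\<lambda>n. 1 / real (Suc (\<kappa> n))) \<longlonglongrightarrow> 0"
    using filterlim_compose[OF LIMSEQ_inverse_real_of_nat \<kappa>(1)] by (simp add: inverse_eq_divide)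
  then show ?thesis using \<kappa>(2) by (intro exI[of _ "\<lambda>n. 1 / real (Suc (\<kappa> n))"]) auto
qed

text \<open>Given a correction, \<epsilon> drops below \<delta> and monotonicity of \<nu> enlarges
  the admissible size accordingly. Conversely \<open>slow_rate\<close> supplies the rate, and
  closeness on generators spreads to every group element through
  \<open>perm_dist_word_bound\<close>.\<close>

lemma correctable_iff:
  fixes \<nu> :: "real \<Rightarrow> nat \<Rightarrow> enat"
  assumes "group G" and "finite S" and \<pi>: "\<pi> \<in> epi (free_group S) G"
    and mono: "\<And>\<epsilon> \<epsilon>' n. 0 < \<epsilon> \<Longrightarrow> \<epsilon> \<le> \<epsilon>' \<Longrightarrow> 1 \<le> n \<Longrightarrow> \<nu> \<epsilon> n \<le> \<nu> \<epsilon>' n"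
    and n: "\<And>l. 1 \<le> n l"
    and \<alpha>: "\<And>l. \<alpha> l \<in> hom (free_group S) (sym_group (n l))"
    and shadow: "\<And>w. w \<in> carrier (free_group S) \<Longrightarrow>
      (\<lambda>l. perm_dist (n l) (n l) (f l (\<pi> w)) (\<alpha> l w)) \<longlonglongrightarrow> 0"
  shows "correctable \<nu> G n f \<longleftrightarrow> (\<forall>\<delta>>0. eventually (\<lambda>l. nearly_action \<nu> S G \<pi> \<delta> (n l) (\<alpha> l)) sequentially)"
proof
  have hom\<pi>: "\<pi> \<in> hom (free_group S) G" and surj: "\<pi> ` carrier (free_group S) = carrier G"
    using \<pi> by (auto simp: epi_def)
  assume "correctable \<nu> G n f"
  from this[unfolded correctable_def] obtain \<epsilon> N h where c: "(\<forall>l. 0 < \<epsilon> l) \<and> \<epsilon> \<longlonglongrightarrow> 0 \<and>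
      (\<forall>l. h l \<in> hom G (sym_group (N l)) \<and> n l \<le> N l \<and> enat (N l) \<le> enat (n l) + \<nu> (\<epsilon> l) (n l)) \<and>
      (\<forall>g\<in>carrier G. (\<lambda>l. perm_dist (n l) (N l) (f l g) (h l g)) \<longlonglongrightarrow> 0)"
    by (elim exE) (rule that)
  note \<epsilon> = c[THEN conjunct1] c[THEN conjunct2, THEN conjunct1]
    and h = c[THEN conjunct2, THEN conjunct2, THEN conjunct1]
    and lim = c[THEN conjunct2, THEN conjunct2, THEN conjunct2]
  have "(\<lambda>l. \<Sum>s\<in>S. perm_dist (n l) (N l) (\<alpha> l (gen s)) (h l (\<pi> (gen s)))) \<longlonglongrightarrow> (\<Sum>s\<in>S. 0)"
  proof (rule tendsto_sum)
    fix s assume s: "s \<in> S"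
    note gs = gen_in_carrier[OF s]
    show "(\<lambda>l. perm_dist (n l) (N l) (\<alpha> l (gen s)) (h l (\<pi> (gen s)))) \<longlonglongrightarrow> 0"
    proof (rule tendsto_0_le)
    show "(\<lambda>l. perm_dist (n l) (n l) (f l (\<pi> (gen s))) (\<alpha> l (gen s)) +
        perm_dist (n l) (N l) (f l (\<pi> (gen s))) (h l (\<pi> (gen s)))) \<longlonglongrightarrow> 0"
      using tendsto_add[OF shadow[OF gs] lim[rule_format, OF hom_in_carrier[OF hom\<pi> gs]]] by simp
    fix l
    show "perm_dist (n l) (N l) (\<alpha> l (gen s)) (h l (\<pi> (gen s))) \<le>
        perm_dist (n l) (n l) (f l (\<pi> (gen s))) (\<alpha> l (gen s)) +
        perm_dist (n l) (N l) (f l (\<pi> (gen s))) (h l (\<pi> (gen s)))"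
      using perm_dist_triangle[of "n l" "N l" "\<alpha> l (gen s)" "h l (\<pi> (gen s))" "f l (\<pi> (gen s))"] h
      by (simp add: perm_dist_commute[of "n l" "\<alpha> l (gen s)"])
    qed (rule perm_dist_nonneg)
  qed
  then have sum0: "(\<lambda>l. \<Sum>s\<in>S. perm_dist (n l) (N l) (\<alpha> l (gen s)) (h l (\<pi> (gen s)))) \<longlonglongrightarrow> 0" by simp
  show "\<forall>\<delta>>0. eventually (\<lambda>l. nearly_action \<nu> S G \<pi> \<delta> (n l) (\<alpha> l)) sequentially"
  proof (intro allI impI)
    fix \<delta> :: real assume "0 < \<delta>"
    from order_tendstoD(2)[OF \<epsilon>(2) this] order_tendstoD(2)[OF sum0 this]
    show "eventually (\<lambda>l. nearly_action \<nu> S G \<pi> \<delta> (n l) (\<alpha> l)) sequentially"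
    proof eventually_elim
      case (elim l)
      have "\<nu> (\<epsilon> l) (n l) \<le> \<nu> \<delta> (n l)" using \<epsilon>(1) elim(1) n by (intro mono) auto
      then have "enat (N l) \<le> enat (n l) + \<nu> \<delta> (n l)" using h by (meson add_left_mono order_trans)
      then show ?case unfolding nearly_action_def using h elim(2) by (intro exI[of _ "N l"] exI[of _ "h l"]) simp
    qed
  qed
next
  have hom\<pi>: "\<pi> \<in> hom (free_group S) G" and surj: "\<pi> ` carrier (free_group S) = carrier G"
    using \<pi> by (auto simp: epi_def)
  assume R: "\<forall>\<delta>>0. eventually (\<lambda>l. nearly_action \<nu> S G \<pi> \<delta> (n l) (\<alpha> l)) sequentially"
  from slow_rate[of "\<lambda>\<delta> l. nearly_action \<nu> S G \<pi> \<delta> (n l) (\<alpha> l)"] R obtain \<epsilon> where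
    \<epsilon>: "\<forall>l. 0 < \<epsilon> l" "\<epsilon> \<longlonglongrightarrow> 0" and ev: "eventually (\<lambda>l. nearly_action \<nu> S G \<pi> (\<epsilon> l) (n l) (\<alpha> l)) sequentially"
    by auto
  define W where "W l p \<longleftrightarrow> snd p \<in> hom G (sym_group (fst p)) \<and> n l \<le> fst p \<and>
    enat (fst p) \<le> enat (n l) + \<nu> (\<epsilon> l) (n l)" for l and p :: "nat \<times> _"
  define D where "D l p = (\<Sum>s\<in>S. perm_dist (n l) (fst p) (\<alpha> l (gen s)) (snd p (\<pi> (gen s))))" for l p
  have "\<exists>p. W l p \<and> (nearly_action \<nu> S G \<pi> (\<epsilon> l) (n l) (\<alpha> l) \<longrightarrow> D l p < \<epsilon> l)" for l
  proof (cases "nearly_action \<nu> S G \<pi> (\<epsilon> l) (n l) (\<alpha> l)")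
    case True
    then obtain N h where "h \<in> hom G (sym_group N) \<and> n l \<le> N \<and> enat N \<le> enat (n l) + \<nu> (\<epsilon> l) (n l) \<and>
        (\<Sum>s\<in>S. perm_dist (n l) N (\<alpha> l (gen s)) (h (\<pi> (gen s)))) < \<epsilon> l"
      unfolding nearly_action_def by (elim exE)
    then show ?thesis by (intro exI[of _ "(N, h)"]) (simp add: W_def D_def)
  next
    case False
    \<comment> \<open>At exceptional indices the trivial action of the same degree meets the size
      constraint; no closeness is claimed there.\<close>
    then show ?thesis by (intro exI[of _ "(n l, \<lambda>_. id)"]) (simp add: W_def trivial_sym_hom)
  qed
  then obtain p where p: "\<And>l. W l (p l)" "\<And>l. nearly_action \<nu> S G \<pi> (\<epsilon> l) (n l) (\<alpha> l) \<Longrightarrow> D l (p l) < \<epsilon> l"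
    by metis
  define N where "N l = fst (p l)" for l
  define h where "h l = snd (p l)" for l
  have h: "h l \<in> hom G (sym_group (N l))" "n l \<le> N l" "enat (N l) \<le> enat (n l) + \<nu> (\<epsilon> l) (n l)" for l
    using p(1)[of l] by (auto simp: W_def N_def h_def)
  have D0: "(\<lambda>l. D l (p l)) \<longlonglongrightarrow> 0"
  proof (rule tendsto_sandwich[OF _ _ tendsto_const \<epsilon>(2)])
    show "eventually (\<lambda>l. 0 \<le> D l (p l)) sequentially"
      by (intro always_eventually allI) (simp add: D_def sum_nonneg perm_dist_nonneg)
    show "eventually (\<lambda>l. D l (p l) \<le> \<epsilon> l) sequentially"
      using ev by eventually_elim (simp add: p(2) less_imp_le)
  qed
  have "(\<lambda>l. perm_dist (n l) (N l) (f l g) (h l g)) \<longlonglongrightarrow> 0" if g: "g \<in> carrier G" for g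
  proof -
    have "g \<in> \<pi> ` carrier (free_group S)" using surj g by simp
    then obtain w where w: "w \<in> carrier (free_group S)" "g = \<pi> w" by (elim imageE) simp
    from perm_dist_word_bound[OF assms(1) hom\<pi> assms(2) w(1)] obtain C where
      C: "\<forall>n N \<alpha> h. \<alpha> \<in> hom (free_group S) (sym_group n) \<longrightarrow> h \<in> hom G (sym_group N) \<longrightarrow> n \<le> N \<longrightarrow>
        perm_dist n N (\<alpha> w) (h (\<pi> w)) \<le> real C * (\<Sum>s\<in>S. perm_dist n N (\<alpha> (gen s)) (h (\<pi> (gen s))))"
      by (elim exE)
    show ?thesis unfolding w(2)
    proof (rule tendsto_0_le)
      show "(\<lambda>l. perm_dist (n l) (n l) (f l (\<pi> w)) (\<alpha> l w) + real C * D l (p l)) \<longlonglongrightarrow> 0"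
        using tendsto_add[OF shadow[OF w(1)] tendsto_mult_left[OF D0, of "real C"]] by simp
      fix l
      have "perm_dist (n l) (N l) (\<alpha> l w) (h l (\<pi> w)) \<le> real C * D l (p l)"
        using C[rule_format, OF \<alpha> h(1,2), of l] unfolding D_def by (simp add: N_def h_def)
      then show "perm_dist (n l) (N l) (f l (\<pi> w)) (h l (\<pi> w)) \<le>
          perm_dist (n l) (n l) (f l (\<pi> w)) (\<alpha> l w) + real C * D l (p l)"
        using perm_dist_triangle[OF h(2), of l "f l (\<pi> w)" "h l (\<pi> w)" "\<alpha> l w"] by simp
    qed (rule perm_dist_nonneg)
  qed
  then show "correctable \<nu> G n f"
    unfolding correctable_def using \<epsilon> h by (intro exI[of _ \<epsilon>] exI[of _ N] exI[of _ h]) auto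
qed

section \<open>Finite sets with an action in labelled form\<close>

text \<open>The labellings are chosen so that the injection \<open>f\<close> becomes the inclusion
  of \<open>{1..n}\<close> in \<open>{1..N}\<close>. The defect of an injection is then a sum of
  permutation distances.\<close>

lemma defect_transfer:
  assumes b: "bij_betw b {1..n} X" and c: "bij_betw c {1..N} Y" and nN: "n \<le> N"
    and \<alpha>: "\<And>s. s \<in> S \<Longrightarrow> \<alpha>' (gen s) permutes {1..n}" "\<And>s i. s \<in> S \<Longrightarrow> i \<in> {1..n} \<Longrightarrow> b (\<alpha>' (gen s) i) = \<alpha> (gen s) (b i)"
    and h: "\<And>s. s \<in> S \<Longrightarrow> h (\<pi> (gen s)) permutes {1..N}"
      "\<And>s i. s \<in> S \<Longrightarrow> i \<in> {1..N} \<Longrightarrow> c (h (\<pi> (gen s)) i) = \<beta> (\<pi> (gen s)) (c i)"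
    and f: "\<And>i. i \<in> {1..n} \<Longrightarrow> f (b i) = c i"
  shows "1 / real (card X) * (\<Sum>s\<in>S. \<Sum>x\<in>X. of_bool (f (\<alpha> (gen s) x) \<noteq> (\<beta> \<circ> \<pi>) (gen s) (f x))) =
    (\<Sum>s\<in>S. perm_dist n N (\<alpha>' (gen s)) (h (\<pi> (gen s))))"
proof -
  have cardX: "card X = n" using bij_betw_same_card[OF b] by simp
  have "(\<Sum>x\<in>X. of_bool (f (\<alpha> (gen s) x) \<noteq> (\<beta> \<circ> \<pi>) (gen s) (f x))) =
      real (card {i \<in> {1..n}. \<alpha>' (gen s) i \<noteq> h (\<pi> (gen s)) i})" if s: "s \<in> S" for s
  proof -
    have "(\<Sum>x\<in>X. of_bool (f (\<alpha> (gen s) x) \<noteq> (\<beta> \<circ> \<pi>) (gen s) (f x))) =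
        (\<Sum>i\<in>{1..n}. of_bool (f (\<alpha> (gen s) (b i)) \<noteq> (\<beta> \<circ> \<pi>) (gen s) (f (b i))) :: real)"
      by (rule sum.reindex_bij_betw[OF b, symmetric])
    also have "\<dots> = (\<Sum>i\<in>{1..n}. of_bool (\<alpha>' (gen s) i \<noteq> h (\<pi> (gen s)) i))"
    proof (rule sum.cong[OF refl])
      fix i assume i: "i \<in> {1..n}"
      have i': "i \<in> {1..N}" using i nN by simp
      have ai: "\<alpha>' (gen s) i \<in> {1..n}" using permutes_in_image[OF \<alpha>(1)[OF s]] i by simp
      then have ai': "\<alpha>' (gen s) i \<in> {1..N}" using nN by simp
      have hi: "h (\<pi> (gen s)) i \<in> {1..N}" using permutes_in_image[OF h(1)[OF s]] i' by simp
      have "f (\<alpha> (gen s) (b i)) = c (\<alpha>' (gen s) i)" using \<alpha>(2)[OF s i] f[OF ai] by simp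
      moreover have "(\<beta> \<circ> \<pi>) (gen s) (f (b i)) = c (h (\<pi> (gen s)) i)" using h(2)[OF s i'] f[OF i] by simp
      ultimately show "of_bool (f (\<alpha> (gen s) (b i)) \<noteq> (\<beta> \<circ> \<pi>) (gen s) (f (b i))) =
          (of_bool (\<alpha>' (gen s) i \<noteq> h (\<pi> (gen s)) i) :: real)"
        using inj_on_eq_iff[OF bij_betw_imp_inj_on[OF c] ai' hi] by simp
    qed
    also have "\<dots> = real (card {i \<in> {1..n}. \<alpha>' (gen s) i \<noteq> h (\<pi> (gen s)) i})"
      by (simp add: sum.If_cases of_bool_def Int_def)
    finally show ?thesis .
  qed
  then show ?thesis
    by (simp add: cardX perm_dist_eq[OF nN] sum_divide_distrib del: One_nat_def atLeastAtMost_iff)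
qed

lemma inj_defect_finite:
  assumes "finite X" "finite Y"
  shows "finite ((\<lambda>f. 1 / real (card X) * (\<Sum>s\<in>S. \<Sum>x\<in>X. of_bool (f (\<alpha> (gen s) x) \<noteq> \<beta> (gen s) (f x)))) `
    {f \<in> X \<rightarrow>\<^sub>E Y. inj_on f X} :: real set)"
  using assms by (intro finite_imageI finite_subset[OF _ finite_PiE[of X "\<lambda>_. Y"]]) auto

lemma sym_hom_of_gset:
  assumes X: "finite_gset G X \<alpha>" and b: "bij_betw b {1..n} X"
  shows "\<exists>h\<in>hom G (sym_group n). \<forall>g\<in>carrier G. \<forall>i\<in>{1..n}. b (h g i) = \<alpha> g (b i)"
proof -
  interpret group G using X by (rule finite_gsetD)
  interpret A: group_action G X \<alpha> using X by (rule finite_gsetD)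
  show ?thesis
  proof (rule sym_hom_of_action[OF b])
    show "\<alpha> g x \<in> X" if "g \<in> carrier G" "x \<in> X" for g x using A.element_image[OF that refl] .
    show "\<alpha> \<one>\<^bsub>G\<^esub> x = x" if "x \<in> X" for x using A.id_eq_one that by (metis restrict_apply')
    show "\<alpha> (g \<otimes>\<^bsub>G\<^esub> h) x = \<alpha> g (\<alpha> h x)" if "g \<in> carrier G" "h \<in> carrier G" "x \<in> X" for g h x
      using A.composition_rule that by blast
  qed
qed

text \<open>The reverse of \<open>sym_hom_of_gset\<close>: permutations are transported along a
  labelling to an action on an arbitrary finite set.\<close>

lemma gset_of_sym_hom:
  assumes "group G" and h: "h \<in> hom G (sym_group N)" and c: "bij_betw c {1..N} Y" and N: "1 \<le> N"
  shows "\<exists>\<beta>. finite_gset G Y \<beta> \<and> (\<forall>g\<in>carrier G. \<forall>i\<in>{1..N}. c (h g i) = \<beta> g (c i))"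
proof -
  define d where "d = inv_into {1..N} c"
  define \<beta> where "\<beta> g = (\<lambda>y\<in>Y. c (h g (d y)))" for g
  have Y: "Y = c ` {1..N}" using bij_betw_imp_surj_on[OF c] by simp
  have d: "d y \<in> {1..N}" "c (d y) = y" if "y \<in> Y" for y
    using that inv_into_into[of y c "{1..N}"] f_inv_into_f[of y c "{1..N}"] unfolding d_def Y by simp_all
  have dc: "d (c i) = i" "c i \<in> Y" if "i \<in> {1..N}" for i
    using inv_into_f_f[OF bij_betw_imp_inj_on[OF c] that] that unfolding d_def Y by simp_all
  have hN: "h g i \<in> {1..N}" if "g \<in> carrier G" "i \<in> {1..N}" for g i
    using permutes_in_image[OF sym_hom_permutes[OF h that(1)]] that(2) by simp
  have \<beta>c: "\<beta> g (c i) = c (h g i)" if "i \<in> {1..N}" for g i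
    using dc[OF that] by (simp add: \<beta>_def)
  have B: "\<beta> g \<in> Bij Y" if g: "g \<in> carrier G" for g
  proof -
    have "bij_betw (\<lambda>y. c (h g (d y))) Y Y"
    proof (rule bij_betw_byWitness[where f' = "\<lambda>y. c (inv' (h g) (d y))"])
      have p: "inv' (h g) i \<in> {1..N}" if "i \<in> {1..N}" for i
        using permutes_in_image[OF permutes_inv[OF sym_hom_permutes[OF h g]]] that by simp
      note pi = permutes_inverses[OF sym_hom_permutes[OF h g]]
      show "\<forall>y\<in>Y. c (inv' (h g) (d (c (h g (d y))))) = y"
        using d dc(1)[OF hN[OF g d(1)]] pi by simp
      show "\<forall>y\<in>Y. c (h g (d (c (inv' (h g) (d y))))) = y"
        using d dc(1)[OF p[OF d(1)]] pi by simp
      show "(\<lambda>y. c (h g (d y))) ` Y \<subseteq> Y" using dc(2)[OF hN[OF g d(1)]] by auto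
      show "(\<lambda>y. c (inv' (h g) (d y))) ` Y \<subseteq> Y" using dc(2)[OF p[OF d(1)]] by auto
    qed
    then show ?thesis by (simp add: Bij_def \<beta>_def bij_betw_restrict_eq)
  qed
  have "\<beta> \<in> hom G (BijGroup Y)"
  proof (rule homI)
    fix x y assume xy: "x \<in> carrier G" "y \<in> carrier G"
    have "\<beta> (x \<otimes>\<^bsub>G\<^esub> y) = compose Y (\<beta> x) (\<beta> y)"
    proof
      fix z
      show "\<beta> (x \<otimes>\<^bsub>G\<^esub> y) z = compose Y (\<beta> x) (\<beta> y) z"
      proof (cases "z \<in> Y")
        case True
        then have "\<beta> y z = c (h y (d z))" by (simp add: \<beta>_def)
        then have "\<beta> x (\<beta> y z) = c (h x (h y (d z)))"
          using \<beta>c[OF hN[OF xy(2) d(1)[OF True]], of x] by simp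
        also have "\<dots> = \<beta> (x \<otimes>\<^bsub>G\<^esub> y) z" using True sym_hom_mult[OF h xy] by (simp add: \<beta>_def)
        finally show ?thesis using True by (simp add: compose_eq)
      qed (simp add: compose_def \<beta>_def)
    qed
    then show "\<beta> (x \<otimes>\<^bsub>G\<^esub> y) = \<beta> x \<otimes>\<^bsub>BijGroup Y\<^esub> \<beta> y" using B xy by (simp add: BijGroup_def)
  qed (simp add: BijGroup_def B)
  then have "group_action G Y \<beta>"
    using assms(1) by (simp add: group_action_def group_hom_def group_hom_axioms_def group_BijGroup)
  then have "finite_gset G Y \<beta>" using N unfolding finite_gset_def Y by simp
  then show ?thesis using \<beta>c by (intro exI[of _ \<beta>]) simp
qed

section \<open>Solutions of challenges\<close>

context
  fixes G :: "('g, 'm) monoid_scheme" and S :: "'s set" and \<pi> :: "'s word \<Rightarrow> 'g"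
    and X :: "'x set" and \<alpha> :: "'s word \<Rightarrow> 'x \<Rightarrow> 'x" and b :: "nat \<Rightarrow> 'x" and n :: nat
    and \<alpha>' :: "'s word \<Rightarrow> nat \<Rightarrow> nat"
  assumes X: "finite_gset (free_group S) X \<alpha>" and b: "bij_betw b {1..n} X"
    and \<alpha>': "\<alpha>' \<in> hom (free_group S) (sym_group n)"
    and b\<alpha>: "\<forall>w\<in>carrier (free_group S). \<forall>i\<in>{1..n}. b (\<alpha>' w i) = \<alpha> w (b i)"
    and \<pi>: "\<pi> \<in> hom (free_group S) G"
begin

lemma card_eq_of_bij: "card X = n"
  using bij_betw_same_card[OF b] by simp

lemma defect_eq_perm_dist_sum:
  assumes h: "h \<in> hom G (sym_group N)" and c: "bij_betw c {1..N} Y" and "n \<le> N"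
    and hc: "\<forall>g\<in>carrier G. \<forall>i\<in>{1..N}. c (h g i) = \<beta> g (c i)"
    and f: "\<And>i. i \<in> {1..n} \<Longrightarrow> f (b i) = c i"
  shows "1 / real (card X) * (\<Sum>s\<in>S. \<Sum>x\<in>X. of_bool (f (\<alpha> (gen s) x) \<noteq> (\<beta> \<circ> \<pi>) (gen s) (f x))) =
    (\<Sum>s\<in>S. perm_dist n N (\<alpha>' (gen s)) (h (\<pi> (gen s))))"
proof (rule defect_transfer[OF b c assms(3)])
  fix s assume s: "s \<in> S"
  note gs = gen_in_carrier[OF s]
  note pgs = hom_in_carrier[OF \<pi> gs]
  show "\<alpha>' (gen s) permutes {1..n}" by (rule sym_hom_permutes[OF \<alpha>' gs])
  show "h (\<pi> (gen s)) permutes {1..N}" by (rule sym_hom_permutes[OF h pgs])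
  show "b (\<alpha>' (gen s) i) = \<alpha> (gen s) (b i)" if "i \<in> {1..n}" for i using b\<alpha> gs that by blast
  show "c (h (\<pi> (gen s)) i) = \<beta> (\<pi> (gen s)) (c i)" if "i \<in> {1..N}" for i using hc pgs that by blast
qed (rule f)

text \<open>Take an optimal injection and label its target accordingly: the first \<open>n\<close>
  labels follow the injection, the remaining ones enumerate the complement of its image.\<close>

lemma gset_dist_attained:
  assumes Y: "finite_gset G Y \<beta>" and le: "n \<le> card Y"
  shows "\<exists>h\<in>hom G (sym_group (card Y)).
    (\<Sum>s\<in>S. perm_dist n (card Y) (\<alpha>' (gen s)) (h (\<pi> (gen s)))) = gset_dist S X \<alpha> Y (\<beta> \<circ> \<pi>)"
proof -
  have fX: "finite X" and fY: "finite Y" using X Y by (auto simp: finite_gset_def)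
  let ?v = "\<lambda>f. 1 / real (card X) * (\<Sum>s\<in>S. \<Sum>x\<in>X. of_bool (f (\<alpha> (gen s) x) \<noteq> (\<beta> \<circ> \<pi>) (gen s) (f x)))"
  let ?I = "{f \<in> X \<rightarrow>\<^sub>E Y. inj_on f X}"
  have dist: "gset_dist S X \<alpha> Y (\<beta> \<circ> \<pi>) = Min (?v ` ?I)"
    using le unfolding gset_dist_def card_eq_of_bij inj_defect_def by simp
  have "?I \<noteq> {}"
  proof -
    obtain f where "f ` X \<subseteq> Y" "inj_on f X"
      using card_le_inj[OF fX fY] le by (auto simp: card_eq_of_bij)
    then have "restrict f X \<in> ?I" by (auto simp: inj_on_def)
    then show ?thesis by blast
  qed
  then have "Min (?v ` ?I) \<in> ?v ` ?I"
    using inj_defect_finite[OF fX fY] by (intro Min_in) auto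
  then obtain f where v: "Min (?v ` ?I) = ?v f" and f0: "f \<in> ?I" by (rule imageE)
  then have f: "f \<in> X \<rightarrow>\<^sub>E Y" "inj_on f X" by simp_all
  have fXY: "f ` X \<subseteq> Y" using f(1) by auto
  have cfX: "card (f ` X) = n" using card_image[OF f(2)] by (simp add: card_eq_of_bij)
  have "card (Y - f ` X) = card Y - n" using fXY fX cfX by (simp add: card_Diff_subset)
  moreover have "card {n + 1..card Y} = card Y - n" by simp
  ultimately obtain e where e: "bij_betw e {n + 1..card Y} (Y - f ` X)"
    using finite_same_card_bij[of "{n + 1..card Y}" "Y - f ` X"] fY by auto
  define c where "c i = (if i \<le> n then f (b i) else e i)" for i
  have "bij_betw c ({1..n} \<union> {n + 1..card Y}) (f ` X \<union> (Y - f ` X))"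
  proof (rule bij_betw_combine)
    have "bij_betw (f \<circ> b) {1..n} (f ` X)"
      using b inj_on_imp_bij_betw[OF f(2)] by (rule bij_betw_trans)
    then show "bij_betw c {1..n} (f ` X)"
      by (rule bij_betw_cong[THEN iffD1, rotated]) (simp add: c_def)
    show "bij_betw c {n + 1..card Y} (Y - f ` X)"
      using e by (rule bij_betw_cong[THEN iffD1, rotated]) (simp add: c_def)
  qed auto
  moreover have "{1..n} \<union> {n + 1..card Y} = {1..card Y}" using le by auto
  moreover have "f ` X \<union> (Y - f ` X) = Y" using fXY by auto
  ultimately have c: "bij_betw c {1..card Y} Y" by simp
  obtain h where h: "h \<in> hom G (sym_group (card Y))" "\<forall>g\<in>carrier G. \<forall>i\<in>{1..card Y}. c (h g i) = \<beta> g (c i)"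
    using sym_hom_of_gset[OF Y c] by (rule bexE)
  have "?v f = (\<Sum>s\<in>S. perm_dist n (card Y) (\<alpha>' (gen s)) (h (\<pi> (gen s))))"
    by (rule defect_eq_perm_dist_sum[OF h(1) c le h(2)]) (simp add: c_def)
  then show ?thesis unfolding dist v using h(1) by (intro bexI[of _ h]) simp_all
qed

text \<open>An infinite type has room for a set of \<open>N\<close> points, and the minimum over
  injections is at most the value at the label-preserving one.\<close>

lemma gset_dist_le:
  assumes "group G" and h: "h \<in> hom G (sym_group N)" and "1 \<le> n" "n \<le> N" and inf: "infinite (UNIV :: 'y set)"
  shows "\<exists>(Y :: 'y set) \<beta>. finite_gset G Y \<beta> \<and> card Y = N \<and>
    gset_dist S X \<alpha> Y (\<beta> \<circ> \<pi>) \<le> (\<Sum>s\<in>S. perm_dist n N (\<alpha>' (gen s)) (h (\<pi> (gen s))))"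
proof -
  obtain \<iota> :: "nat \<Rightarrow> 'y" where \<iota>: "inj \<iota>" using infinite_countable_subset[OF inf] by auto
  define Y where "Y = \<iota> ` {1..N}"
  have c: "bij_betw \<iota> {1..N} Y"
    unfolding Y_def using inj_on_subset[OF \<iota>, of "{1..N}"] by (intro inj_on_imp_bij_betw) simp
  have cardY: "card Y = N" using bij_betw_same_card[OF c] by simp
  have "1 \<le> N" using assms by simp
  from gset_of_sym_hom[OF assms(1) h c this] obtain \<beta> where
    \<beta>: "finite_gset G Y \<beta>" "\<forall>g\<in>carrier G. \<forall>i\<in>{1..N}. \<iota> (h g i) = \<beta> g (\<iota> i)" by (elim exE conjE)
  have fX: "finite X" and fY: "finite Y" using X \<beta>(1) by (auto simp: finite_gset_def)
  let ?v = "\<lambda>f. 1 / real (card X) * (\<Sum>s\<in>S. \<Sum>x\<in>X. of_bool (f (\<alpha> (gen s) x) \<noteq> (\<beta> \<circ> \<pi>) (gen s) (f x)))"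
  let ?I = "{f \<in> X \<rightarrow>\<^sub>E Y. inj_on f X}"
  define f where "f = (\<lambda>x\<in>X. \<iota> (inv_into {1..n} b x))"
  have Xb: "X = b ` {1..n}" using bij_betw_imp_surj_on[OF b] by simp
  have fb: "f (b i) = \<iota> i" if "i \<in> {1..n}" for i
    using that inv_into_f_f[OF bij_betw_imp_inj_on[OF b] that] unfolding f_def Xb by simp
  have "f \<in> ?I"
  proof -
    have "f x \<in> Y" if xX: "x \<in> X" for x
    proof -
      obtain i where i: "i \<in> {1..n}" "x = b i" using xX unfolding Xb by (elim imageE) simp
      then have "i \<in> {1..N}" using assms(4) by simp
      then show ?thesis using fb[OF i(1)] i(2) by (simp add: Y_def)
    qed
    moreover have "inj_on f X"
    proof (rule inj_onI)
      fix x y assume xy: "x \<in> X" "y \<in> X" "f x = f y"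
      obtain i where i: "i \<in> {1..n}" "x = b i" using xy(1) unfolding Xb by (elim imageE) simp
      obtain j where j: "j \<in> {1..n}" "y = b j" using xy(2) unfolding Xb by (elim imageE) simp
      have "\<iota> i = \<iota> j" using xy(3) fb i j by simp
      then have "i = j" by (rule injD[OF \<iota>])
      then show "x = y" using i j by simp
    qed
    ultimately show ?thesis by (auto simp: f_def)
  qed
  have "gset_dist S X \<alpha> Y (\<beta> \<circ> \<pi>) = Min (?v ` ?I)"
    using assms(4) unfolding gset_dist_def card_eq_of_bij inj_defect_def cardY by simp
  also have "\<dots> \<le> ?v f"
    using inj_defect_finite[OF fX fY] \<open>f \<in> ?I\<close> by (intro Min_le) auto
  also have "?v f = (\<Sum>s\<in>S. perm_dist n N (\<alpha>' (gen s)) (h (\<pi> (gen s))))"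
    by (rule defect_eq_perm_dist_sum[OF h c assms(4) \<beta>(2) fb])
  finally show ?thesis using \<beta>(1) cardY by (intro exI[of _ Y] exI[of _ \<beta>]) simp
qed

end

text \<open>The counterpart of \<open>correctable_iff\<close> on the side of challenges, with the
  same condition on the right, which is how the two notions meet. The distance of sets only involves
  generators, so closeness transfers directly.\<close>

lemma flexible_solution_iff:
  fixes X :: "nat \<Rightarrow> 'x::infinite set" and \<nu> :: "real \<Rightarrow> nat \<Rightarrow> enat"
  assumes "group G" and \<pi>: "\<pi> \<in> hom (free_group S) G"
    and mono: "\<And>\<epsilon> \<epsilon>' n. 0 < \<epsilon> \<Longrightarrow> \<epsilon> \<le> \<epsilon>' \<Longrightarrow> 1 \<le> n \<Longrightarrow> \<nu> \<epsilon> n \<le> \<nu> \<epsilon>' n"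
    and X: "\<And>n. finite_gset (free_group S) (X n) (\<alpha> n)"
    and b: "\<And>n. bij_betw (b n) {1..card (X n)} (X n)"
    and \<alpha>': "\<And>n. \<alpha>' n \<in> hom (free_group S) (sym_group (card (X n)))"
    and b\<alpha>: "\<And>n. \<forall>w\<in>carrier (free_group S). \<forall>i\<in>{1..card (X n)}. b n (\<alpha>' n w i) = \<alpha> n w (b n i)"
  shows "(\<exists>(Y :: nat \<Rightarrow> 'x set) \<beta>. flexible_solution \<nu> S G \<pi> X \<alpha> Y \<beta>) \<longleftrightarrow>
    (\<forall>\<delta>>0. eventually (\<lambda>n. nearly_action \<nu> S G \<pi> \<delta> (card (X n)) (\<alpha>' n)) sequentially)"
proof
  note ctx = X b \<alpha>' b\<alpha> \<pi>
  have pos: "1 \<le> card (X n)" for n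
    using X[of n] by (simp add: finite_gset_def Suc_le_eq card_gt_0_iff)
  assume "\<exists>(Y :: nat \<Rightarrow> 'x set) \<beta>. flexible_solution \<nu> S G \<pi> X \<alpha> Y \<beta>"
  then obtain Y :: "nat \<Rightarrow> 'x set" and \<beta> where sol: "flexible_solution \<nu> S G \<pi> X \<alpha> Y \<beta>" by (elim exE)
  note sol' = sol[unfolded flexible_solution_def]
  have Y: "finite_gset G (Y n) (\<beta> n)" for n using sol' by (elim conjE) simp
  have lim: "(\<lambda>n. gset_dist S (X n) (\<alpha> n) (Y n) (\<beta> n \<circ> \<pi>)) \<longlonglongrightarrow> 0" using sol' by (elim conjE)
  from sol'[THEN conjunct2, THEN conjunct2] obtain \<epsilon> where
    \<epsilon>: "\<forall>n. 0 < \<epsilon> n" "\<epsilon> \<longlonglongrightarrow> 0" and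
    card: "\<forall>n. card (X n) \<le> card (Y n) \<and> enat (card (Y n)) \<le> enat (card (X n)) + \<nu> (\<epsilon> n) (card (X n))"
    by (elim exE conjE) (rule that)
  show "\<forall>\<delta>>0. eventually (\<lambda>n. nearly_action \<nu> S G \<pi> \<delta> (card (X n)) (\<alpha>' n)) sequentially"
  proof (intro allI impI)
    fix \<delta> :: real assume "0 < \<delta>"
    from order_tendstoD(2)[OF \<epsilon>(2) this] order_tendstoD(2)[OF lim this]
    show "eventually (\<lambda>n. nearly_action \<nu> S G \<pi> \<delta> (card (X n)) (\<alpha>' n)) sequentially"
    proof eventually_elim
      case (elim n)
      have le: "card (X n) \<le> card (Y n)" using card by simp
      obtain h where h: "h \<in> hom G (sym_group (card (Y n)))"
        "(\<Sum>s\<in>S. perm_dist (card (X n)) (card (Y n)) (\<alpha>' n (gen s)) (h (\<pi> (gen s)))) =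
          gset_dist S (X n) (\<alpha> n) (Y n) (\<beta> n \<circ> \<pi>)"
        using gset_dist_attained[OF ctx Y le] by (rule bexE)
      have "\<nu> (\<epsilon> n) (card (X n)) \<le> \<nu> \<delta> (card (X n))" using \<epsilon>(1) elim(1) pos by (intro mono) auto
      then have "enat (card (Y n)) \<le> enat (card (X n)) + \<nu> \<delta> (card (X n))"
        using card by (meson add_left_mono order_trans)
      then show ?case
        unfolding nearly_action_def using h le elim(2) by (intro exI[of _ "card (Y n)"] exI[of _ h]) simp
    qed
  qed
next
  note ctx = X b \<alpha>' b\<alpha> \<pi>
  have pos: "1 \<le> card (X n)" for n
    using X[of n] by (simp add: finite_gset_def Suc_le_eq card_gt_0_iff)
  have inf: "infinite (UNIV :: 'x set)" by (rule infinite_UNIV)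
  assume R: "\<forall>\<delta>>0. eventually (\<lambda>n. nearly_action \<nu> S G \<pi> \<delta> (card (X n)) (\<alpha>' n)) sequentially"
  from slow_rate[of "\<lambda>\<delta> n. nearly_action \<nu> S G \<pi> \<delta> (card (X n)) (\<alpha>' n)"] R obtain \<epsilon> where
    \<epsilon>: "\<forall>n. 0 < \<epsilon> n" "\<epsilon> \<longlonglongrightarrow> 0"
    and ev: "eventually (\<lambda>n. nearly_action \<nu> S G \<pi> (\<epsilon> n) (card (X n)) (\<alpha>' n)) sequentially"
    by auto
  define W where "W n p \<longleftrightarrow> finite_gset G (fst p) (snd p) \<and> card (X n) \<le> card (fst p) \<and>
    enat (card (fst p)) \<le> enat (card (X n)) + \<nu> (\<epsilon> n) (card (X n))" for n and p :: "'x set \<times> _"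
  define D where "D n p = gset_dist S (X n) (\<alpha> n) (fst p) (snd p \<circ> \<pi>)" for n and p :: "'x set \<times> _"
  have "\<exists>p. W n p \<and> (nearly_action \<nu> S G \<pi> (\<epsilon> n) (card (X n)) (\<alpha>' n) \<longrightarrow> D n p < \<epsilon> n)" for n
  proof (cases "nearly_action \<nu> S G \<pi> (\<epsilon> n) (card (X n)) (\<alpha>' n)")
    case True
    then obtain N h where h: "h \<in> hom G (sym_group N) \<and> card (X n) \<le> N \<and>
        enat N \<le> enat (card (X n)) + \<nu> (\<epsilon> n) (card (X n)) \<and>
        (\<Sum>s\<in>S. perm_dist (card (X n)) N (\<alpha>' n (gen s)) (h (\<pi> (gen s)))) < \<epsilon> n"
      unfolding nearly_action_def by (elim exE)
    from gset_dist_le[OF ctx assms(1) conjunct1[OF h] pos conjunct1[OF conjunct2[OF h]] inf]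
    obtain Y :: "'x set" and \<beta> where "finite_gset G Y \<beta> \<and> card Y = N \<and>
      gset_dist S (X n) (\<alpha> n) Y (\<beta> \<circ> \<pi>) \<le> (\<Sum>s\<in>S. perm_dist (card (X n)) N (\<alpha>' n (gen s)) (h (\<pi> (gen s))))"
      by (elim exE)
    then show ?thesis using h by (intro exI[of _ "(Y, \<beta>)"]) (auto simp: W_def D_def)
  next
    case False
    \<comment> \<open>The default at exceptional indices: a set of the same size with trivial
      action.\<close>
    from gset_dist_le[OF X[of n] b[of n] \<alpha>'[of n] b\<alpha>[of n] \<pi> assms(1) trivial_sym_hom pos order_refl inf]
    obtain Y :: "'x set" and \<beta> where "finite_gset G Y \<beta> \<and> card Y = card (X n) \<and>
      gset_dist S (X n) (\<alpha> n) Y (\<beta> \<circ> \<pi>) \<le> (\<Sum>s\<in>S. perm_dist (card (X n)) (card (X n)) (\<alpha>' n (gen s)) id)"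
      by (elim exE)
    then show ?thesis using False by (intro exI[of _ "(Y, \<beta>)"]) (auto simp: W_def)
  qed
  then obtain p where p: "\<And>n. W n (p n)"
      "\<And>n. nearly_action \<nu> S G \<pi> (\<epsilon> n) (card (X n)) (\<alpha>' n) \<Longrightarrow> D n (p n) < \<epsilon> n"
    by metis
  have D0: "(\<lambda>n. D n (p n)) \<longlonglongrightarrow> 0"
  proof (rule tendsto_sandwich[OF _ _ tendsto_const \<epsilon>(2)])
    \<comment> \<open>Nonnegativity of the minimum is seen by writing it as a sum of permutation
      distances.\<close>
    have "0 \<le> D n (p n)" for n
    proof -
      have Y: "finite_gset G (fst (p n)) (snd (p n))" "card (X n) \<le> card (fst (p n))"
        using p(1)[of n] by (simp_all add: W_def)
      obtain h where "(\<Sum>s\<in>S. perm_dist (card (X n)) (card (fst (p n))) (\<alpha>' n (gen s)) (h (\<pi> (gen s)))) = D n (p n)"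
        using gset_dist_attained[OF ctx Y] unfolding D_def by (elim bexE)
      moreover have "0 \<le> (\<Sum>s\<in>S. perm_dist (card (X n)) (card (fst (p n))) (\<alpha>' n (gen s)) (h (\<pi> (gen s))))"
        by (intro sum_nonneg perm_dist_nonneg)
      ultimately show ?thesis by simp
    qed
    then show "eventually (\<lambda>n. 0 \<le> D n (p n)) sequentially" by (intro always_eventually allI)
    show "eventually (\<lambda>n. D n (p n) \<le> \<epsilon> n) sequentially"
      using ev by eventually_elim (simp add: p(2) less_imp_le)
  qed
  have "flexible_solution \<nu> S G \<pi> X \<alpha> (\<lambda>n. fst (p n)) (\<lambda>n. snd (p n))"
    unfolding flexible_solution_def
  proof (intro conjI exI[of _ \<epsilon>] allI)
    show "(\<lambda>n. gset_dist S (X n) (\<alpha> n) (fst (p n)) (snd (p n) \<circ> \<pi>)) \<longlonglongrightarrow> 0"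
      using D0 by (simp only: D_def)
    fix n
    show "finite_gset G (fst (p n)) (snd (p n))" "card (X n) \<le> card (fst (p n))"
      "enat (card (fst (p n))) \<le> enat (card (X n)) + \<nu> (\<epsilon> n) (card (X n))"
      using p(1)[of n] by (simp_all add: W_def)
  qed (use \<epsilon> in auto)
  then show "\<exists>(Y :: nat \<Rightarrow> 'x set) \<beta>. flexible_solution \<nu> S G \<pi> X \<alpha> Y \<beta>" by (intro exI)
qed

section \<open>Invariant random subgroups of a quotient\<close>

lemma epi_countable_carrier:
  assumes "finite S" "\<pi> \<in> epi (free_group S) G"
  shows "countable (carrier G)"
proof -
  have "carrier G = \<pi> ` carrier (free_group S)" using assms(2) by (simp add: epi_def)
  then show ?thesis using countable_free_group[of S] assms(1) by (simp add: countable_finite)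
qed

lemma subgroup_vimage_hom:
  assumes "group F" "group G" "\<pi> \<in> hom F G" "subgroup K G"
  shows "subgroup (\<pi> -` K \<inter> carrier F) F"
proof -
  interpret group_hom F G \<pi> using assms by (simp add: group_hom_def group_hom_axioms_def)
  show ?thesis
    using assms(4) by unfold_locales
      (auto simp: subgroup.one_closed subgroup.m_closed subgroup.m_inv_closed)
qed

lemma measurable_IRS_embed:
  assumes "group F" "group G" "\<pi> \<in> hom F G" "countable (carrier F)"
  shows "(\<lambda>K. \<pi> -` K \<inter> carrier F) \<in> measurable (borel_of (Sub G)) (borel_of (Sub F))"
proof (rule measurable_borel_of_Sub[OF assms(4)])
  fix K assume "K \<in> space (borel_of (Sub G))"
  then show "subgroup (\<pi> -` K \<inter> carrier F) F"
    using assms by (intro subgroup_vimage_hom) (auto simp: space_borel_of topspace_Sub)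
next
  fix w assume w: "w \<in> carrier F"
  have "{K \<in> space (borel_of (Sub G)). w \<in> \<pi> -` K \<inter> carrier F} = above G {\<pi> w}"
    using w by (auto simp: space_borel_of topspace_Sub above_def)
  then show "{K \<in> space (borel_of (Sub G)). w \<in> \<pi> -` K \<inter> carrier F} \<in> sets (borel_of (Sub G))"
    using hom_in_carrier[OF assms(3) w] by simp
qed

text \<open>The preimage of \<open>K\<close> contains \<open>Q\<close> exactly when \<open>K\<close>
  contains the image of \<open>Q\<close>. Embedded laws are therefore handled through images,
  without computing in the space of subgroups of the free group.\<close>

lemma measure_IRS_embed_above:
  assumes "group F" "group G" "\<pi> \<in> hom F G" "countable (carrier F)"
    and \<mu>: "sets \<mu> = sets (borel_of (Sub G))" and Q: "finite Q" "Q \<subseteq> carrier F"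
  shows "measure (IRS_embed F \<pi> \<mu>) (above F Q) = measure \<mu> (above G (\<pi> ` Q))"
proof -
  have m: "(\<lambda>K. \<pi> -` K \<inter> carrier F) \<in> measurable \<mu> (borel_of (Sub F))"
    using measurable_IRS_embed[OF assms(1-4)] \<mu> by (simp cong: measurable_cong_sets)
  have "(\<lambda>K. \<pi> -` K \<inter> carrier F) -` above F Q \<inter> space \<mu> = above G (\<pi> ` Q)"
    using Q subgroup_vimage_hom[OF assms(1-3)] by (auto simp: space_eq_subgroups[OF \<mu>] above_def)
  then show ?thesis using Q by (simp add: IRS_embed_def measure_distr[OF m])
qed

lemma IRS_embed_in_IRS:
  assumes "group F" "group G" and \<pi>: "\<pi> \<in> hom F G" and count: "countable (carrier F)" "countable (carrier G)"
    and \<mu>: "\<mu> \<in> IRS G"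
  shows "IRS_embed F \<pi> \<mu> \<in> IRS F"
proof -
  interpret F: group F by fact
  interpret G: group G by fact
  interpret \<pi>: group_hom F G \<pi> using assms by (simp add: group_hom_def group_hom_axioms_def)
  interpret prob_space \<mu> using \<mu> by (simp add: IRS_def)
  have sets: "sets \<mu> = sets (borel_of (Sub G))" using \<mu> by (simp add: IRS_def)
  have m: "(\<lambda>K. \<pi> -` K \<inter> carrier F) \<in> measurable \<mu> (borel_of (Sub F))"
    using measurable_IRS_embed[OF assms(1-4)] sets by (simp cong: measurable_cong_sets)
  show ?thesis unfolding F.IRS_iff[OF count(1)]
  proof (intro conjI ballI allI impI)
    show "prob_space (IRS_embed F \<pi> \<mu>)" unfolding IRS_embed_def by (rule prob_space_distr[OF m])
    show "sets (IRS_embed F \<pi> \<mu>) = sets (borel_of (Sub F))" by (simp add: IRS_embed_def)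
    fix g Q assume g: "g \<in> carrier F" and Q: "finite Q \<and> Q \<subseteq> carrier F"
    have im: "\<pi> ` (\<lambda>q. inv\<^bsub>F\<^esub> g \<otimes>\<^bsub>F\<^esub> q \<otimes>\<^bsub>F\<^esub> g) ` Q = (\<lambda>q. inv\<^bsub>G\<^esub> (\<pi> g) \<otimes>\<^bsub>G\<^esub> q \<otimes>\<^bsub>G\<^esub> \<pi> g) ` \<pi> ` Q"
      unfolding image_image using g Q by (intro image_cong) auto
    have Q': "(\<lambda>q. inv\<^bsub>F\<^esub> g \<otimes>\<^bsub>F\<^esub> q \<otimes>\<^bsub>F\<^esub> g) ` Q \<subseteq> carrier F" using g Q by auto
    have "\<pi> ` Q \<subseteq> carrier G" using Q by auto
    then have "measure \<mu> (above G ((\<lambda>q. inv\<^bsub>G\<^esub> (\<pi> g) \<otimes>\<^bsub>G\<^esub> q \<otimes>\<^bsub>G\<^esub> \<pi> g) ` \<pi> ` Q)) = measure \<mu> (above G (\<pi> ` Q))"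
      using \<mu>[unfolded G.IRS_iff[OF count(2)]] g Q by simp
    then show "measure (IRS_embed F \<pi> \<mu>) (above F ((\<lambda>q. inv\<^bsub>F\<^esub> g \<otimes>\<^bsub>F\<^esub> q \<otimes>\<^bsub>F\<^esub> g) ` Q)) =
        measure (IRS_embed F \<pi> \<mu>) (above F Q)"
      using measure_IRS_embed_above[OF assms(1-4) sets] Q Q' by (simp add: im)
  qed
qed

lemma (in group) measure_dirac_trivial_above:
  assumes "finite Q" "Q \<subseteq> carrier G"
  shows "measure (dirac_trivial G) (above G Q) = of_bool (Q \<subseteq> {\<one>})"
proof -
  have "measure (dirac_trivial G) (above G Q) = indicator (above G Q) {\<one>}"
    unfolding dirac_trivial_def by (rule measure_return[OF above_sets[OF assms]])
  then show ?thesis using triv_subgroup by (simp add: indicator_def above_def)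
qed

lemma (in group) dirac_trivial_in_IRS:
  assumes "countable (carrier G)"
  shows "dirac_trivial G \<in> IRS G"
  unfolding IRS_iff[OF assms]
proof (intro conjI ballI allI impI)
  show "prob_space (dirac_trivial G)"
    unfolding dirac_trivial_def
    by (intro prob_space_return) (simp add: space_borel_of topspace_Sub triv_subgroup)
  show "sets (dirac_trivial G) = sets (borel_of (Sub G))" by (simp add: dirac_trivial_def)
  fix g Q assume g: "g \<in> carrier G" and Q: "finite Q \<and> Q \<subseteq> carrier G"
  have "inv g \<otimes> q \<otimes> g = \<one> \<longleftrightarrow> q = \<one>" if "q \<in> carrier G" for q
  proof
    assume "inv g \<otimes> q \<otimes> g = \<one>"
    then have "g \<otimes> (inv g \<otimes> q \<otimes> g) \<otimes> inv g = \<one>" using g by simp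
    then show "q = \<one>" using g that by (simp add: m_assoc inv_mult_cancel_left)
  qed (use g in simp)
  then have "(\<lambda>q. inv g \<otimes> q \<otimes> g) ` Q \<subseteq> {\<one>} \<longleftrightarrow> Q \<subseteq> {\<one>}" using Q by auto
  moreover have "(\<lambda>q. inv g \<otimes> q \<otimes> g) ` Q \<subseteq> carrier G" using g Q by auto
  ultimately show "measure (dirac_trivial G) (above G ((\<lambda>q. inv g \<otimes> q \<otimes> g) ` Q)) =
      measure (dirac_trivial G) (above G Q)"
    using Q by (simp only: measure_dirac_trivial_above finite_imageI)
qed

text \<open>Each kernel element lies in almost every subgroup. The kernel is countable, so almost
  every \<open>H\<close> contains all of it and is then the full preimage of its image; pushing
  \<mu> forward under taking images loses nothing.\<close>

lemma IRS_descend: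
  assumes "group F" "group G" and \<pi>: "\<pi> \<in> epi F G" and count: "countable (carrier F)" "countable (carrier G)"
    and \<mu>: "\<mu> \<in> IRS F"
    and ker: "\<And>w. w \<in> carrier F \<Longrightarrow> \<pi> w = \<one>\<^bsub>G\<^esub> \<Longrightarrow> measure \<mu> (above F {w}) = 1"
  shows "\<exists>\<mu>'\<in>IRS G. \<forall>Q. finite Q \<longrightarrow> Q \<subseteq> carrier F \<longrightarrow> measure \<mu>' (above G (\<pi> ` Q)) = measure \<mu> (above F Q)"
proof -
  have hom: "\<pi> \<in> hom F G" and surj: "\<pi> ` carrier F = carrier G" using \<pi> by (simp_all add: epi_def)
  interpret F: group F by fact
  interpret G: group G by fact
  interpret \<pi>: group_hom F G \<pi> using assms(1,2) hom by (simp add: group_hom_def group_hom_axioms_def)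
  interpret prob_space \<mu> using \<mu> by (simp add: IRS_def)
  have sets: "sets \<mu> = sets (borel_of (Sub F))" using \<mu> by (simp add: IRS_def)
  have sp: "space \<mu> = {H. subgroup H F}" by (rule space_eq_subgroups[OF sets])
  have m: "(\<lambda>H. \<pi> ` H) \<in> measurable \<mu> (borel_of (Sub G))"
  proof (rule measurable_borel_of_Sub[OF count(2)])
    fix H assume "H \<in> space \<mu>"
    then show "subgroup (\<pi> ` H) G" by (simp add: sp \<pi>.subgroup_img_is_subgroup)
  next
    fix g
    \<comment> \<open>The image of \<open>H\<close> contains \<open>g\<close> exactly when
      \<open>H\<close> contains one of the countably many preimages of \<open>g\<close>.\<close>
    have "{H \<in> space \<mu>. g \<in> \<pi> ` H} = (\<Union>w\<in>{w \<in> carrier F. \<pi> w = g}. above F {w})"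
    proof (intro equalityI subsetI)
      fix H assume H: "H \<in> {H \<in> space \<mu>. g \<in> \<pi> ` H}"
      then obtain w where "w \<in> H" "g = \<pi> w" by auto
      then show "H \<in> (\<Union>w\<in>{w \<in> carrier F. \<pi> w = g}. above F {w})"
        using H subgroup.subset[of H F] by (auto simp: sp above_def)
    qed (auto simp: sp above_def)
    also have "\<dots> \<in> sets \<mu>"
    proof (rule sets.countable_UN')
      show "countable {w \<in> carrier F. \<pi> w = g}" using count(1) by (rule countable_subset[rotated]) auto
      have "above F {w} \<in> sets \<mu>" if "w \<in> {w \<in> carrier F. \<pi> w = g}" for w
        unfolding sets using that by (intro above_sets) simp_all
      then show "(\<lambda>w. above F {w}) ` {w \<in> carrier F. \<pi> w = g} \<subseteq> sets \<mu>" by blast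
    qed
    finally show "{H \<in> space \<mu>. g \<in> \<pi> ` H} \<in> sets \<mu>" .
  qed
  have "AE H in \<mu>. \<forall>w\<in>{w \<in> carrier F. \<pi> w = \<one>\<^bsub>G\<^esub>}. w \<in> H"
  proof (subst AE_ball_countable)
    show "countable {w \<in> carrier F. \<pi> w = \<one>\<^bsub>G\<^esub>}" using count(1) by (rule countable_subset[rotated]) auto
    show "\<forall>w\<in>{w \<in> carrier F. \<pi> w = \<one>\<^bsub>G\<^esub>}. AE H in \<mu>. w \<in> H"
    proof
      fix w assume w: "w \<in> {w \<in> carrier F. \<pi> w = \<one>\<^bsub>G\<^esub>}"
      have ev: "above F {w} \<in> events" unfolding sets using w by (intro above_sets) simp_all
      have "AE H in \<mu>. H \<in> above F {w}"
        using ker[of w] w prob_eq_1[OF ev] by simp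
      then show "AE H in \<mu>. w \<in> H" by (rule AE_mp) (auto simp: above_def intro!: AE_I2)
    qed
  qed
  then have ae: "AE H in \<mu>. \<forall>w\<in>carrier F. \<pi> w \<in> \<pi> ` H \<longrightarrow> w \<in> H"
  proof (rule AE_mp, intro AE_I2 impI ballI)
    fix H w assume H: "H \<in> space \<mu>" and k: "\<forall>w\<in>{w \<in> carrier F. \<pi> w = \<one>\<^bsub>G\<^esub>}. w \<in> H"
      and w: "w \<in> carrier F" "\<pi> w \<in> \<pi> ` H"
    have HF: "subgroup H F" using H by (simp add: sp)
    obtain v where v: "v \<in> H" "\<pi> w = \<pi> v" using w(2) by (elim imageE)
    have vF: "v \<in> carrier F" using v(1) HF subgroup.subset by blast
    have "w \<otimes>\<^bsub>F\<^esub> inv\<^bsub>F\<^esub> v \<in> H" using k w(1) vF v(2) by simp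
    then have "w \<otimes>\<^bsub>F\<^esub> inv\<^bsub>F\<^esub> v \<otimes>\<^bsub>F\<^esub> v \<in> H" using v(1) by (rule subgroup.m_closed[OF HF])
    then show "w \<in> H" using w(1) vF by (simp add: F.m_assoc)
  qed
  define \<mu>' where "\<mu>' = distr \<mu> (borel_of (Sub G)) (\<lambda>H. \<pi> ` H)"
  have eq: "measure \<mu>' (above G (\<pi> ` Q)) = measure \<mu> (above F Q)" if Q: "finite Q" "Q \<subseteq> carrier F" for Q
  proof -
    have Q': "finite (\<pi> ` Q)" "\<pi> ` Q \<subseteq> carrier G" using Q by auto
    have "measure \<mu>' (above G (\<pi> ` Q)) = measure \<mu> ((\<lambda>H. \<pi> ` H) -` above G (\<pi> ` Q) \<inter> space \<mu>)"
      unfolding \<mu>'_def using Q' by (intro measure_distr[OF m]) simp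
    also have "\<dots> = measure \<mu> (above F Q)"
    proof (rule finite_measure_eq_AE)
      show "AE H in \<mu>. H \<in> (\<lambda>H. \<pi> ` H) -` above G (\<pi> ` Q) \<inter> space \<mu> \<longleftrightarrow> H \<in> above F Q"
        using ae
      proof (rule AE_mp, intro AE_I2 impI)
        fix H assume H: "H \<in> space \<mu>" and *: "\<forall>w\<in>carrier F. \<pi> w \<in> \<pi> ` H \<longrightarrow> w \<in> H"
        have "subgroup (\<pi> ` H) G" using H by (simp add: sp \<pi>.subgroup_img_is_subgroup)
        moreover have "\<pi> ` Q \<subseteq> \<pi> ` H \<longleftrightarrow> Q \<subseteq> H"
        proof
          assume "\<pi> ` Q \<subseteq> \<pi> ` H"
          then show "Q \<subseteq> H" using * Q(2) by (auto simp: image_subset_iff subset_iff)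
        qed (rule image_mono)
        ultimately show "H \<in> (\<lambda>H. \<pi> ` H) -` above G (\<pi> ` Q) \<inter> space \<mu> \<longleftrightarrow> H \<in> above F Q"
          using H by (simp add: above_def sp)
      qed
      show "(\<lambda>H. \<pi> ` H) -` above G (\<pi> ` Q) \<inter> space \<mu> \<in> events"
        using Q' by (intro measurable_sets[OF m]) simp
      show "above F Q \<in> events" using Q sets by simp
    qed
    finally show ?thesis .
  qed
  have "\<mu>' \<in> IRS G" unfolding G.IRS_iff[OF count(2)]
  proof (intro conjI ballI allI impI)
    show "prob_space \<mu>'" unfolding \<mu>'_def by (rule prob_space_distr[OF m])
    show "sets \<mu>' = sets (borel_of (Sub G))" by (simp add: \<mu>'_def)
    \<comment> \<open>Invariance is checked upstairs, after lifting both the conjugator and the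
      finite set through the surjection.\<close>
    fix g Q assume g: "g \<in> carrier G" and Q: "finite Q \<and> Q \<subseteq> carrier G"
    have "g \<in> \<pi> ` carrier F" using g surj by simp
    then obtain u where u: "u \<in> carrier F" "g = \<pi> u" by (elim imageE) simp
    have "finite Q" "Q \<subseteq> \<pi> ` carrier F" using Q by (simp_all only: surj)
    from finite_subset_image[OF this] obtain P where P: "finite P" "P \<subseteq> carrier F" "Q = \<pi> ` P"
      by blast
    have im: "(\<lambda>q. inv\<^bsub>G\<^esub> g \<otimes>\<^bsub>G\<^esub> q \<otimes>\<^bsub>G\<^esub> g) ` Q = \<pi> ` (\<lambda>q. inv\<^bsub>F\<^esub> u \<otimes>\<^bsub>F\<^esub> q \<otimes>\<^bsub>F\<^esub> u) ` P"
      unfolding image_image P(3) u(2) using u(1) P(2) by (intro image_cong) auto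
    have P': "(\<lambda>q. inv\<^bsub>F\<^esub> u \<otimes>\<^bsub>F\<^esub> q \<otimes>\<^bsub>F\<^esub> u) ` P \<subseteq> carrier F" using u P(2) by auto
    have "measure \<mu> (above F ((\<lambda>q. inv\<^bsub>F\<^esub> u \<otimes>\<^bsub>F\<^esub> q \<otimes>\<^bsub>F\<^esub> u) ` P)) = measure \<mu> (above F P)"
      using \<mu>[unfolded F.IRS_iff[OF count(1)]] u P by simp
    then show "measure \<mu>' (above G ((\<lambda>q. inv\<^bsub>G\<^esub> g \<otimes>\<^bsub>G\<^esub> q \<otimes>\<^bsub>G\<^esub> g) ` Q)) = measure \<mu>' (above G Q)"
      unfolding im using P P' by (simp add: eq)
  qed
  then show ?thesis using eq by blast
qed

lemma measure_stab_law_sym_hom: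
  assumes "group G" "h \<in> hom G (sym_group n)" "1 \<le> n" "finite Q" "Q \<subseteq> carrier G"
  shows "measure (stab_law G {1..n} (\<lambda>g. restrict (h g) {1..n})) (above G Q) = fix_frac n h Q"
proof -
  have "{x \<in> {1..n}. \<forall>q\<in>Q. restrict (h q) {1..n} x = x} = {x \<in> {1..n}. \<forall>q\<in>Q. h q x = x}" by auto
  then show ?thesis
    unfolding measure_stab_law_above[OF finite_gset_of_sym_hom[OF assms(1-3)] assms(4,5)] fix_frac_def
    by (simp only: card_atLeastAtMost) simp
qed

lemma fix_frac_transport:
  assumes "finite_gset F X \<alpha>" "bij_betw b {1..card X} X" "\<alpha>' \<in> hom F (sym_group (card X))"
    and "\<forall>w\<in>carrier F. \<forall>i\<in>{1..card X}. b (\<alpha>' w i) = \<alpha> w (b i)" "finite Q" "Q \<subseteq> carrier F"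
  shows "measure (stab_law F X \<alpha>) (above F Q) = fix_frac (card X) \<alpha>' Q"
  using measure_stab_law_above[OF assms(1,5,6)] fix_frac_eq[OF assms(3,2,4,6)] by simp

section \<open>Comparison of the two formulations\<close>

lemma not_eventually_subseq:
  assumes "\<not> eventually P sequentially"
  shows "\<exists>r :: nat \<Rightarrow> nat. strict_mono r \<and> (\<forall>n. \<not> P (r n))"
proof -
  have "infinite {n. \<not> P n}"
    using assms unfolding eventually_sequentially infinite_nat_iff_unbounded_le by auto
  then show ?thesis
    using infinite_enumerate[of "{n. \<not> P n}"] by auto
qed

locale marked_group =
  fixes G :: "('g, 'm) monoid_scheme" and S :: "'s set" and \<pi> :: "'s word \<Rightarrow> 'g"
  assumes G: "group G" and S: "finite S" and epi: "\<pi> \<in> epi (free_group S) G"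
begin

abbreviation "F \<equiv> free_group S"

text \<open>A challenge reduced to permutations and numbers. The parameter \<open>M\<close>
  distinguishes the three parts: all of \<open>IRS G\<close>, its co-sofic elements, or the Dirac
  measure alone.\<close>

definition limit_law :: "'g set measure set \<Rightarrow> (nat \<Rightarrow> nat) \<Rightarrow> (nat \<Rightarrow> 's word \<Rightarrow> nat \<Rightarrow> nat) \<Rightarrow> bool" where
  "limit_law M n \<alpha> \<longleftrightarrow> (\<forall>l. 1 \<le> n l \<and> \<alpha> l \<in> hom F (sym_group (n l))) \<and>
     (\<exists>\<mu>\<in>M. \<forall>Q. finite Q \<longrightarrow> Q \<subseteq> carrier F \<longrightarrow>
        (\<lambda>l. fix_frac (n l) (\<alpha> l) Q) \<longlonglongrightarrow> measure \<mu> (above G (\<pi> ` Q)))"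

definition lift :: "'g \<Rightarrow> 's word" where
  "lift g = (SOME w. w \<in> carrier F \<and> \<pi> w = g)"

lemma hom: "\<pi> \<in> hom F G" and surj: "\<pi> ` carrier F = carrier G"
  using epi by (simp_all add: epi_def)

lemma pi_closed: "w \<in> carrier F \<Longrightarrow> \<pi> w \<in> carrier G"
  by (rule hom_in_carrier[OF hom])

lemma lift: "g \<in> carrier G \<Longrightarrow> lift g \<in> carrier F" "g \<in> carrier G \<Longrightarrow> \<pi> (lift g) = g"
proof -
  have "lift g \<in> carrier F \<and> \<pi> (lift g) = g" if g: "g \<in> carrier G"
  proof -
    have "g \<in> \<pi> ` carrier F" using g by (simp only: surj)
    then obtain w where "w \<in> carrier F \<and> \<pi> w = g" by (elim imageE) simp
    then show ?thesis unfolding lift_def by (rule someI)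
  qed
  then show "g \<in> carrier G \<Longrightarrow> lift g \<in> carrier F" "g \<in> carrier G \<Longrightarrow> \<pi> (lift g) = g" by simp_all
qed

lemma limit_law_subseq:
  assumes "limit_law M n \<alpha>" "strict_mono r"
  shows "limit_law M (n \<circ> r) (\<alpha> \<circ> r)"
proof -
  from assms(1) obtain \<mu> where \<mu>: "\<mu> \<in> M" "\<forall>Q. finite Q \<longrightarrow> Q \<subseteq> carrier F \<longrightarrow>
        (\<lambda>l. fix_frac (n l) (\<alpha> l) Q) \<longlonglongrightarrow> measure \<mu> (above G (\<pi> ` Q))"
    unfolding limit_law_def by (elim conjE bexE)
  have "(\<lambda>l. fix_frac ((n \<circ> r) l) ((\<alpha> \<circ> r) l) Q) \<longlonglongrightarrow> measure \<mu> (above G (\<pi> ` Q))"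
    if "finite Q" "Q \<subseteq> carrier F" for Q
    using LIMSEQ_subseq_LIMSEQ[OF \<mu>(2)[rule_format, OF that] assms(2)] by (simp add: comp_def)
  then show ?thesis using assms(1) \<mu>(1) unfolding limit_law_def by (intro conjI allI bexI[of _ \<mu>]) auto
qed

lemma limit_law_ker:
  assumes law: "limit_law M n \<alpha>" and M: "M \<subseteq> IRS G"
    and w: "w \<in> carrier F" "\<pi> w = \<one>\<^bsub>G\<^esub>"
  shows "(\<lambda>l. fix_frac (n l) (\<alpha> l) {w}) \<longlonglongrightarrow> 1"
proof -
  from law obtain \<mu> where \<mu>: "\<mu> \<in> M" "\<forall>Q. finite Q \<longrightarrow> Q \<subseteq> carrier F \<longrightarrow>
        (\<lambda>l. fix_frac (n l) (\<alpha> l) Q) \<longlonglongrightarrow> measure \<mu> (above G (\<pi> ` Q))"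
    unfolding limit_law_def by (elim conjE bexE)
  have IRS: "\<mu> \<in> IRS G" using \<mu>(1) M by blast
  then interpret prob_space \<mu> by (simp add: IRS_def)
  have "space \<mu> = {H. subgroup H G}" using IRS by (intro space_eq_subgroups) (simp add: IRS_def)
  then have "above G (\<pi> ` {w}) = space \<mu>" using w(2) by (auto simp: above_def subgroup.one_closed)
  then show ?thesis using \<mu>(2)[rule_format, of "{w}"] w(1) by (simp add: prob_space)
qed

text \<open>The permutations of \<open>u\<close> and \<open>v\<close> agree at a point exactly when
  the quotient word fixes it. For exact actions, distances are thus determined by fixed-point
  fractions.\<close>

lemma perm_dist_eq_fix_frac:
  assumes "1 \<le> n" and \<alpha>: "\<alpha> \<in> hom F (sym_group n)"
    and uv: "u \<in> carrier F" "v \<in> carrier F"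
  shows "perm_dist n n (\<alpha> u) (\<alpha> v) = 1 - fix_frac n \<alpha> {inv\<^bsub>F\<^esub> u \<otimes>\<^bsub>F\<^esub> v}"
proof -
  interpret F: group F by (rule group_free_group)
  have p: "\<alpha> u permutes {1..n}" by (rule sym_hom_permutes[OF \<alpha> uv(1)])
  have "\<alpha> (inv\<^bsub>F\<^esub> u \<otimes>\<^bsub>F\<^esub> v) x = x \<longleftrightarrow> \<alpha> u x = \<alpha> v x" for x
  proof -
    have "\<alpha> (inv\<^bsub>F\<^esub> u \<otimes>\<^bsub>F\<^esub> v) x = inv' (\<alpha> u) (\<alpha> v x)"
      using sym_hom_mult[OF \<alpha> F.inv_closed[OF uv(1)] uv(2)] sym_hom_inv[OF group_free_group \<alpha> uv(1)] by simp
    then show ?thesis using permutes_inv_eq[OF p, of "\<alpha> v x" x] by simp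
  qed
  then have "fix_frac n \<alpha> {inv\<^bsub>F\<^esub> u \<otimes>\<^bsub>F\<^esub> v} = real (card {x \<in> {1..n}. \<alpha> u x = \<alpha> v x}) / real n"
    by (simp add: fix_frac_def)
  moreover have "card {x \<in> {1..n}. \<alpha> u x = \<alpha> v x} + card {x \<in> {1..n}. \<alpha> u x \<noteq> \<alpha> v x} = n"
  proof -
    have "card {x \<in> {1..n}. \<alpha> u x = \<alpha> v x} + card {x \<in> {1..n}. \<alpha> u x \<noteq> \<alpha> v x} =
        card ({x \<in> {1..n}. \<alpha> u x = \<alpha> v x} \<union> {x \<in> {1..n}. \<alpha> u x \<noteq> \<alpha> v x})"
      by (rule card_Un_disjoint[symmetric]) auto
    also have "{x \<in> {1..n}. \<alpha> u x = \<alpha> v x} \<union> {x \<in> {1..n}. \<alpha> u x \<noteq> \<alpha> v x} = {1..n}" by auto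
    finally show ?thesis by simp
  qed
  then have "real (card {x \<in> {1..n}. \<alpha> u x = \<alpha> v x}) = real n - real (card {x \<in> {1..n}. \<alpha> u x \<noteq> \<alpha> v x})" by linarith
  ultimately show ?thesis
    using assms(1) by (simp only: perm_dist_eq[OF order_refl]) (simp add: diff_divide_distrib del: One_nat_def)
qed

lemma limit_law_close:
  assumes law: "limit_law M n \<alpha>" and M: "M \<subseteq> IRS G"
    and uv: "u \<in> carrier F" "v \<in> carrier F" and eq: "\<pi> u = \<pi> v"
  shows "(\<lambda>l. perm_dist (n l) (n l) (\<alpha> l u) (\<alpha> l v)) \<longlonglongrightarrow> 0"
proof -
  interpret F: group F by (rule group_free_group)
  interpret G: group G by (rule G)
  interpret \<pi>: group_hom F G \<pi> by (rule group_hom_free_group[OF G hom])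
  have "\<pi> (inv\<^bsub>F\<^esub> u \<otimes>\<^bsub>F\<^esub> v) = \<one>\<^bsub>G\<^esub>" using uv eq by (simp add: pi_closed)
  then have "(\<lambda>l. fix_frac (n l) (\<alpha> l) {inv\<^bsub>F\<^esub> u \<otimes>\<^bsub>F\<^esub> v}) \<longlonglongrightarrow> 1"
    using uv by (intro limit_law_ker[OF law M]) auto
  then have "(\<lambda>l. 1 - fix_frac (n l) (\<alpha> l) {inv\<^bsub>F\<^esub> u \<otimes>\<^bsub>F\<^esub> v}) \<longlonglongrightarrow> 1 - 1"
    by (intro tendsto_diff tendsto_const)
  moreover have "perm_dist (n l) (n l) (\<alpha> l u) (\<alpha> l v) =
      1 - fix_frac (n l) (\<alpha> l) {inv\<^bsub>F\<^esub> u \<otimes>\<^bsub>F\<^esub> v}" for l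
    using law uv by (intro perm_dist_eq_fix_frac) (simp_all add: limit_law_def)
  ultimately show ?thesis by simp
qed

text \<open>The words \<open>lift (g \<otimes> h)\<close> and \<open>lift g \<otimes> lift h\<close>
  have the same image under \<pi>, so they act asymptotically alike by
  \<open>limit_law_close\<close>. An arbitrary set-theoretic section is enough.\<close>

lemma limit_law_asymptotic_hom:
  assumes law: "limit_law M n \<alpha>" and M: "M \<subseteq> IRS G" and n: "filterlim n at_top sequentially"
  shows "asymptotic_hom G n (\<lambda>l g. \<alpha> l (lift g))"
  unfolding asymptotic_hom_def
proof (intro conjI ballI allI)
  interpret F: group F by (rule group_free_group)
  interpret G: group G by (rule G)
  have \<alpha>: "\<alpha> l \<in> hom F (sym_group (n l))" and n1: "1 \<le> n l" for l
    using law by (simp_all add: limit_law_def)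
  show "(\<lambda>g. \<alpha> l (lift g)) \<in> carrier G \<rightarrow> carrier (sym_group (n l))" for l
    using hom_in_carrier[OF \<alpha> lift(1)] by simp
  show "1 \<le> n l" for l by (rule n1)
  show "filterlim n at_top sequentially" by (rule n)
  fix g h assume g: "g \<in> carrier G" and h: "h \<in> carrier G"
  have "(\<lambda>l. perm_dist (n l) (n l) (\<alpha> l (lift (g \<otimes>\<^bsub>G\<^esub> h))) (\<alpha> l (lift g \<otimes>\<^bsub>F\<^esub> lift h))) \<longlonglongrightarrow> 0"
    using g h by (intro limit_law_close[OF law M]) (simp_all add: lift hom_mult[OF hom])
  then show "(\<lambda>l. perm_dist (n l) (n l) (\<alpha> l (lift (g \<otimes>\<^bsub>G\<^esub> h)))
      (\<alpha> l (lift g) \<otimes>\<^bsub>sym_group (n l)\<^esub> \<alpha> l (lift h))) \<longlonglongrightarrow> 0"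
    using hom_mult[OF \<alpha> lift(1)[OF g] lift(1)[OF h]] by simp
qed

text \<open>Bounded degree is no obstruction: there are only finitely many actions of the free group on
  \<open>k\<close> points, and one of them that occurs infinitely often kills the kernel of \<open>\<pi>\<close> exactly.\<close>

lemma limit_law_bounded:
  assumes law: "limit_law M n \<alpha>" and M: "M \<subseteq> IRS G" and K: "\<And>l. n l < K" and "0 < \<delta>"
  shows "\<exists>l. nearly_action \<nu> S G \<pi> \<delta> (n l) (\<alpha> l)"
proof -
  interpret F: group F by (rule group_free_group)
  interpret G: group G by (rule G)
  interpret \<pi>: group_hom F G \<pi> by (rule group_hom_free_group[OF G hom])
  have \<alpha>: "\<alpha> l \<in> hom F (sym_group (n l))" and n1: "1 \<le> n l" for l
    using law by (simp_all add: limit_law_def)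
  \<comment> \<open>Degree and generator images determine the action on the carrier and take only
    finitely many values, so one value recurs infinitely often.\<close>
  define c where "c l = (n l, \<lambda>s\<in>S. \<alpha> l (gen s))" for l
  have "range c \<subseteq> (\<Union>k\<in>{..<K}. {k} \<times> (S \<rightarrow>\<^sub>E {p. p permutes {1..k}}))"
    using K sym_hom_permutes[OF \<alpha> gen_in_carrier] by (auto simp: c_def)
  moreover have "finite (\<Union>k\<in>{..<K}. {k} \<times> (S \<rightarrow>\<^sub>E {p. p permutes {1..k}}))"
    using finite_sym_hom_gens[OF S] by (intro finite_UN_I finite_cartesian_product) auto
  ultimately have "finite (range c)" by (rule finite_subset)
  then obtain l0 where "infinite {l. c l = c l0}"
    using pigeonhole_infinite[of UNIV c] by auto
  then have inf: "infinite {l. c l = c l0}" .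
  have same: "n l = n l0 \<and> (\<forall>w\<in>carrier F. \<alpha> l w = \<alpha> l0 w)" if "c l = c l0" for l
  proof (intro conjI ballI)
    show nl: "n l = n l0" using that by (simp add: c_def)
    fix w assume w: "w \<in> carrier F"
    have gens: "\<alpha> l (gen s) = \<alpha> l0 (gen s)" if "s \<in> S" for s
    proof -
      have "snd (c l) s = snd (c l0) s" using \<open>c l = c l0\<close> by simp
      then show ?thesis using that by (simp add: c_def)
    qed
    show "\<alpha> l w = \<alpha> l0 w"
      using \<alpha>[of l] unfolding nl by (rule free_group_hom_eqI[OF sym_group_is_group _ \<alpha> gens w])
  qed
  have ker: "\<alpha> l0 w = id" if w: "w \<in> carrier F" "\<pi> w = \<one>\<^bsub>G\<^esub>" for w
  proof -
    \<comment> \<open>This number occurs infinitely often in a sequence with limit 1, so it equals 1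
      exactly.\<close>
    have "fix_frac (n l0) (\<alpha> l0) {w} = 1"
    proof (rule ccontr)
      let ?x = "fix_frac (n l0) (\<alpha> l0) {w}"
      assume "?x \<noteq> 1"
      then have "0 < dist ?x 1" by simp
      with limit_law_ker[OF law M w]
      have "\<exists>m. \<forall>l\<ge>m. dist (fix_frac (n l) (\<alpha> l) {w}) 1 < dist ?x 1"
        unfolding lim_sequentially by simp
      then obtain m where m: "\<forall>l\<ge>m. dist (fix_frac (n l) (\<alpha> l) {w}) 1 < dist ?x 1" ..
      have "\<exists>l\<ge>m. l \<in> {l. c l = c l0}"
        using inf unfolding infinite_nat_iff_unbounded_le by simp
      then obtain l where l: "l \<ge> m" "c l = c l0" by (elim exE conjE) simp
      have "fix_frac (n l) (\<alpha> l) {w} = ?x" using same[OF l(2)] w(1) by (simp add: fix_frac_def)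
      then show False using m l(1) by auto
    qed
    then have "real (card {x \<in> {1..n l0}. \<forall>q\<in>{w}. \<alpha> l0 q x = x}) = real (n l0)"
      unfolding fix_frac_def using n1[of l0] by (simp only: divide_eq_1_iff)
    then have "card {x \<in> {1..n l0}. \<forall>q\<in>{w}. \<alpha> l0 q x = x} = card {1..n l0}"
      by (simp only: of_nat_eq_iff card_atLeastAtMost diff_Suc_1 One_nat_def)
    then have all: "{x \<in> {1..n l0}. \<forall>q\<in>{w}. \<alpha> l0 q x = x} = {1..n l0}"
      by (intro card_subset_eq) auto
    have "\<alpha> l0 w x = x" for x
    proof (cases "x \<in> {1..n l0}")
      case True
      then have "x \<in> {x \<in> {1..n l0}. \<forall>q\<in>{w}. \<alpha> l0 q x = x}" unfolding all .
      then show ?thesis by simp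
    next
      case False
      then show ?thesis by (rule permutes_not_in[OF sym_hom_permutes[OF \<alpha> w(1)]])
    qed
    then show ?thesis by (simp add: fun_eq_iff)
  qed
  have fib: "\<alpha> l0 u = \<alpha> l0 v"
    if uv: "u \<in> carrier F" "v \<in> carrier F" "\<pi> u = \<pi> v" for u v
  proof -
    have "\<alpha> l0 (u \<otimes>\<^bsub>F\<^esub> inv\<^bsub>F\<^esub> v) = id"
      using uv by (intro ker) (simp_all add: pi_closed)
    then have "\<alpha> l0 u \<circ> (\<alpha> l0 (inv\<^bsub>F\<^esub> v) \<circ> \<alpha> l0 v) = \<alpha> l0 v"
      using sym_hom_mult[OF \<alpha> uv(1) F.inv_closed[OF uv(2)]] by (simp add: o_assoc)
    moreover have "\<alpha> l0 (inv\<^bsub>F\<^esub> v) \<circ> \<alpha> l0 v = id"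
      using sym_hom_mult[OF \<alpha> F.inv_closed[OF uv(2)] uv(2)] sym_hom_one[OF group_free_group \<alpha>] uv(2) by simp
    ultimately show ?thesis by simp
  qed
  \<comment> \<open>By \<open>fib\<close> the action is constant on the fibres of \<pi>, so reading
    it through the section gives a genuine homomorphism with zero defect.\<close>
  define h where "h g = \<alpha> l0 (lift g)" for g
  have "h \<in> hom G (sym_group (n l0))"
  proof (rule homI)
    show "h g \<in> carrier (sym_group (n l0))" if "g \<in> carrier G" for g
      unfolding h_def by (rule hom_in_carrier[OF \<alpha> lift(1)[OF that]])
    fix g g' assume g: "g \<in> carrier G" "g' \<in> carrier G"
    have "\<alpha> l0 (lift (g \<otimes>\<^bsub>G\<^esub> g')) = \<alpha> l0 (lift g \<otimes>\<^bsub>F\<^esub> lift g')"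
      using g by (intro fib) (simp_all add: lift)
    then show "h (g \<otimes>\<^bsub>G\<^esub> g') = h g \<otimes>\<^bsub>sym_group (n l0)\<^esub> h g'"
      using hom_mult[OF \<alpha> lift(1)[OF g(1)] lift(1)[OF g(2)]] by (simp add: h_def)
  qed
  moreover have "h (\<pi> (gen s)) = \<alpha> l0 (gen s)" if "s \<in> S" for s
    unfolding h_def using gen_in_carrier[OF that] by (intro fib) (simp_all add: lift pi_closed)
  then have "(\<Sum>s\<in>S. perm_dist (n l0) (n l0) (\<alpha> l0 (gen s)) (h (\<pi> (gen s)))) = 0"
    by (simp add: perm_dist_refl)
  ultimately have "nearly_action \<nu> S G \<pi> \<delta> (n l0) (\<alpha> l0)"
    unfolding nearly_action_def using \<open>0 < \<delta>\<close> by (intro exI[of _ "n l0"] exI[of _ h]) simp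
  then show ?thesis ..
qed

text \<open>The argument common to the three parts, for a class \<open>A\<close> of asymptotic
  homomorphisms and a set \<open>M\<close> of laws. \<open>A_lift\<close> leads from laws to the
  class, and \<open>A_law\<close> leads back after passing to a subsequence. Both directions refute
  \<open>nearly_action\<close> along a bad subsequence, so it is enough that the class and the laws
  pass to subsequences.\<close>

theorem stability_iff_challenges:
  fixes \<nu> :: "real \<Rightarrow> nat \<Rightarrow> enat"
  assumes mono: "\<And>\<epsilon> \<epsilon>' n. 0 < \<epsilon> \<Longrightarrow> \<epsilon> \<le> \<epsilon>' \<Longrightarrow> 1 \<le> n \<Longrightarrow> \<nu> \<epsilon> n \<le> \<nu> \<epsilon>' n"
    and M: "M \<subseteq> IRS G"
    and A_asymp: "\<And>n f. A n f \<Longrightarrow> asymptotic_hom G n f"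
    and A_subseq: "\<And>n f r. A n f \<Longrightarrow> strict_mono r \<Longrightarrow> A (n \<circ> r) (f \<circ> r)"
    and A_lift: "\<And>n \<alpha>. limit_law M n \<alpha> \<Longrightarrow> filterlim n at_top sequentially \<Longrightarrow> A n (\<lambda>l g. \<alpha> l (lift g))"
    and A_law: "\<And>n f \<alpha>. A n f \<Longrightarrow> (\<And>l. \<alpha> l \<in> hom F (sym_group (n l))) \<Longrightarrow>
      (\<And>w. w \<in> carrier F \<Longrightarrow>
        (\<lambda>l. perm_dist (n l) (n l) (f l (\<pi> w)) (\<alpha> l w)) \<longlonglongrightarrow> 0) \<Longrightarrow>
      \<exists>r. strict_mono r \<and> limit_law M (n \<circ> r) (\<alpha> \<circ> r)"
  shows "(\<forall>n f. A n f \<longrightarrow> correctable \<nu> G n f) \<longleftrightarrow>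
    (\<forall>n \<alpha>. limit_law M n \<alpha> \<longrightarrow> (\<forall>\<delta>>0. eventually (\<lambda>l. nearly_action \<nu> S G \<pi> \<delta> (n l) (\<alpha> l)) sequentially))"
proof (intro iffI allI impI)
  fix n :: "nat \<Rightarrow> nat" and \<alpha> :: "nat \<Rightarrow> 's word \<Rightarrow> nat \<Rightarrow> nat" and \<delta> :: real
  assume stable: "\<forall>n f. A n f \<longrightarrow> correctable \<nu> G n f" and law: "limit_law M n \<alpha>" and \<delta>: "0 < \<delta>"
  show "eventually (\<lambda>l. nearly_action \<nu> S G \<pi> \<delta> (n l) (\<alpha> l)) sequentially"
  proof (rule ccontr)
    assume "\<not> eventually (\<lambda>l. nearly_action \<nu> S G \<pi> \<delta> (n l) (\<alpha> l)) sequentially"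
    from not_eventually_subseq[OF this] obtain r :: "nat \<Rightarrow> nat" where
      r: "strict_mono r" "\<forall>l. \<not> nearly_action \<nu> S G \<pi> \<delta> (n (r l)) (\<alpha> (r l))" by (elim exE conjE)
    have law_r: "limit_law M (n \<circ> r) (\<alpha> \<circ> r)" by (rule limit_law_subseq[OF law r(1)])
    show False
    \<comment> \<open>Stability speaks only of degrees tending to infinity. Otherwise infinitely
      many degrees stay below some \<open>K\<close>, and a further subsequence falls under
      \<open>limit_law_bounded\<close>.\<close>
    proof (cases "filterlim (n \<circ> r) at_top sequentially")
      case True
      define f where "f = (\<lambda>l g. (\<alpha> \<circ> r) l (lift g))"
      have "correctable \<nu> G (n \<circ> r) f"
        unfolding f_def using stable A_lift[OF law_r True] by simp
      moreover have "(\<lambda>l. perm_dist ((n \<circ> r) l) ((n \<circ> r) l) (f l (\<pi> w)) ((\<alpha> \<circ> r) l w)) \<longlonglongrightarrow> 0"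
        if w: "w \<in> carrier F" for w
        unfolding f_def using w by (intro limit_law_close[OF law_r M]) (simp_all add: lift pi_closed)
      moreover have "(\<alpha> \<circ> r) l \<in> hom F (sym_group ((n \<circ> r) l))" "1 \<le> (n \<circ> r) l" for l
        using law_r by (simp_all add: limit_law_def)
      moreover have "\<nu> \<epsilon> k \<le> \<nu> \<epsilon>' k" if "0 < \<epsilon>" "\<epsilon> \<le> \<epsilon>'" "1 \<le> k" for \<epsilon> \<epsilon>' k using that by (rule mono)
      ultimately have "\<forall>\<delta>>0. eventually (\<lambda>l. nearly_action \<nu> S G \<pi> \<delta> ((n \<circ> r) l) ((\<alpha> \<circ> r) l)) sequentially"
        using correctable_iff[OF G S epi, of \<nu> "n \<circ> r" "\<alpha> \<circ> r" f] by simp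
      then have "eventually (\<lambda>l. nearly_action \<nu> S G \<pi> \<delta> ((n \<circ> r) l) ((\<alpha> \<circ> r) l)) sequentially" using \<delta> by blast
      then show False using r(2) by (auto simp: eventually_sequentially)
    next
      case False
      then obtain K where "\<not> eventually (\<lambda>l. K \<le> (n \<circ> r) l) sequentially"
        unfolding filterlim_at_top by blast
      from not_eventually_subseq[OF this] obtain r' :: "nat \<Rightarrow> nat" where
        r': "strict_mono r'" "\<forall>l. \<not> K \<le> (n \<circ> r) (r' l)" by (elim exE conjE)
      have "(n \<circ> r \<circ> r') l < K" for l using r'(2) by (simp add: not_le)
      from limit_law_bounded[OF limit_law_subseq[OF law_r r'(1)] M this \<delta>]
      obtain l where "nearly_action \<nu> S G \<pi> \<delta> ((n \<circ> r \<circ> r') l) ((\<alpha> \<circ> r \<circ> r') l)" ..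
      then show False using r(2) by simp
    qed
  qed
next
  fix n f
  assume R: "\<forall>n \<alpha>. limit_law M n \<alpha> \<longrightarrow> (\<forall>\<delta>>0. eventually (\<lambda>l. nearly_action \<nu> S G \<pi> \<delta> (n l) (\<alpha> l)) sequentially)"
    and A: "A n f"
  have asymp: "asymptotic_hom G n f" by (rule A_asymp[OF A])
  have "\<exists>\<alpha>\<in>hom F (sym_group (n l)). \<forall>s\<in>S. \<alpha> (gen s) = f l (\<pi> (gen s))" for l
    using asymp pi_closed[OF gen_in_carrier]
    by (intro free_group_hom_exists[OF sym_group_is_group]) (auto simp: asymptotic_hom_def Pi_iff)
  then have "\<forall>l. \<exists>\<alpha>. \<alpha> \<in> hom F (sym_group (n l)) \<and> (\<forall>s\<in>S. \<alpha> (gen s) = f l (\<pi> (gen s)))"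
    by (simp add: Bex_def)
  from choice[OF this] obtain \<alpha> where
    \<alpha>': "\<forall>l. \<alpha> l \<in> hom F (sym_group (n l)) \<and> (\<forall>s\<in>S. \<alpha> l (gen s) = f l (\<pi> (gen s)))" ..
  then have \<alpha>: "\<alpha> l \<in> hom F (sym_group (n l))" "s \<in> S \<Longrightarrow> \<alpha> l (gen s) = f l (\<pi> (gen s))" for l s
    by simp_all
  have shadow: "(\<lambda>l. perm_dist (n l) (n l) (f l (\<pi> w)) (\<alpha> l w)) \<longlonglongrightarrow> 0" if "w \<in> carrier F" for w
    by (rule asymptotic_hom_shadow[OF G hom asymp \<alpha> that])
  have n1: "1 \<le> n l" for l using asymp by (simp add: asymptotic_hom_def)
  have "eventually (\<lambda>l. nearly_action \<nu> S G \<pi> \<delta> (n l) (\<alpha> l)) sequentially" if \<delta>: "0 < \<delta>" for \<delta>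
  proof (rule ccontr)
    assume "\<not> eventually (\<lambda>l. nearly_action \<nu> S G \<pi> \<delta> (n l) (\<alpha> l)) sequentially"
    from not_eventually_subseq[OF this] obtain r :: "nat \<Rightarrow> nat" where
      r: "strict_mono r" "\<forall>l. \<not> nearly_action \<nu> S G \<pi> \<delta> (n (r l)) (\<alpha> (r l))" by (elim exE conjE)
    \<comment> \<open>The limit is extracted from the bad subsequence, not from the original
      sequence, so that its law applies to indices where \<open>nearly_action\<close> fails.\<close>
    have "\<exists>r'. strict_mono r' \<and> limit_law M (n \<circ> r \<circ> r') (\<alpha> \<circ> r \<circ> r')"
    proof (rule A_law[OF A_subseq[OF A r(1)]])
      show "(\<alpha> \<circ> r) l \<in> hom F (sym_group ((n \<circ> r) l))" for l using \<alpha>(1) by simp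
      show "(\<lambda>l. perm_dist ((n \<circ> r) l) ((n \<circ> r) l) ((f \<circ> r) l (\<pi> w)) ((\<alpha> \<circ> r) l w)) \<longlonglongrightarrow> 0"
        if "w \<in> carrier F" for w
        using LIMSEQ_subseq_LIMSEQ[OF shadow[OF that] r(1)] by (simp add: comp_def)
    qed
    then obtain r' where r': "strict_mono r'" "limit_law M (n \<circ> r \<circ> r') (\<alpha> \<circ> r \<circ> r')" by (elim exE conjE)
    have "eventually (\<lambda>l. nearly_action \<nu> S G \<pi> \<delta> ((n \<circ> r \<circ> r') l) ((\<alpha> \<circ> r \<circ> r') l)) sequentially"
      using R[rule_format, OF r'(2) \<delta>] .
    then show False using r(2) by (auto simp: eventually_sequentially)
  qed
  then have "\<forall>\<delta>>0. eventually (\<lambda>l. nearly_action \<nu> S G \<pi> \<delta> (n l) (\<alpha> l)) sequentially" by simp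
  moreover have "correctable \<nu> G n f \<longleftrightarrow>
      (\<forall>\<delta>>0. eventually (\<lambda>l. nearly_action \<nu> S G \<pi> \<delta> (n l) (\<alpha> l)) sequentially)"
  proof (rule correctable_iff[OF G S epi])
    show "\<nu> \<epsilon> k \<le> \<nu> \<epsilon>' k" if "0 < \<epsilon>" "\<epsilon> \<le> \<epsilon>'" "1 \<le> k" for \<epsilon> \<epsilon>' k using that by (rule mono)
    show "1 \<le> n l" for l by (rule n1)
    show "\<alpha> l \<in> hom F (sym_group (n l))" for l by (rule \<alpha>(1))
    show "(\<lambda>l. perm_dist (n l) (n l) (f l (\<pi> w)) (\<alpha> l w)) \<longlonglongrightarrow> 0" if "w \<in> carrier F" for w
      using that by (rule shadow)
  qed
  ultimately show "correctable \<nu> G n f" by (rule iffD2[rotated])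
qed

end

section \<open>Total variation and common fixed points\<close>

lemma prob_fix_law:
  assumes "1 \<le> n"
  shows "measure_pmf.prob (fix_law n f Q) A = real (card {x \<in> {1..n}. {\<gamma> \<in> Q. f \<gamma> x = x} \<in> A}) / real n"
proof -
  have "{1..n} \<noteq> {}" using assms by simp
  then have "measure_pmf.prob (pmf_of_set {1..n}) ((\<lambda>x. {\<gamma> \<in> Q. f \<gamma> x = x}) -` A) =
      real (card ({1..n} \<inter> (\<lambda>x. {\<gamma> \<in> Q. f \<gamma> x = x}) -` A)) / real (card {1..n})"
    by (rule measure_pmf_of_set) simp
  moreover have "{1..n} \<inter> (\<lambda>x. {\<gamma> \<in> Q. f \<gamma> x = x}) -` A = {x \<in> {1..n}. {\<gamma> \<in> Q. f \<gamma> x = x} \<in> A}"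
    by blast
  ultimately show ?thesis unfolding fix_law_def measure_map_pmf by simp
qed

text \<open>With \<open>T\<close> equal to \<open>Q - R\<close> this is the probability that the set
  of fixing elements of \<open>Q\<close> is exactly \<open>R\<close>. General \<open>T\<close> is
  allowed for the induction that reduces it to \<open>fix_frac\<close>.\<close>

definition cylinder_frac :: "nat \<Rightarrow> ('g \<Rightarrow> nat \<Rightarrow> nat) \<Rightarrow> 'g set \<Rightarrow> 'g set \<Rightarrow> real" where
  "cylinder_frac n f R T = real (card {x \<in> {1..n}. (\<forall>q\<in>R. f q x = x) \<and> (\<forall>t\<in>T. f t x \<noteq> x)}) / real n"

lemma cylinder_frac_insert:
  "cylinder_frac n f R (insert t T) = cylinder_frac n f R T - cylinder_frac n f (insert t R) T"
proof -
  define E where "E R T = {x \<in> {1..n}. (\<forall>q\<in>R. f q x = x) \<and> (\<forall>t\<in>T. f t x \<noteq> x)}" for R T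
  have "x \<in> E R T \<longleftrightarrow> x \<in> E R (insert t T) \<union> E (insert t R) T" for x
    unfolding E_def by (cases "f t x = x") simp_all
  then have "E R T = E R (insert t T) \<union> E (insert t R) T" by blast
  moreover have "E R (insert t T) \<inter> E (insert t R) T = {}" by (simp add: E_def set_eq_iff)
  then have "card (E R (insert t T) \<union> E (insert t R) T) = card (E R (insert t T)) + card (E (insert t R) T)"
    by (intro card_Un_disjoint) (simp_all add: E_def)
  ultimately have "real (card (E R T)) = real (card (E R (insert t T))) + real (card (E (insert t R) T))"
    by simp
  then show ?thesis
    unfolding cylinder_frac_def E_def[symmetric] by (simp add: add_divide_distrib)
qed

text \<open>Inclusion-exclusion by induction on the excluded set. Only differences of fractions are
  controlled, so neither sequence needs a limit of its own.\<close>

lemma cylinder_frac_diff_tendsto: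
  assumes "finite T" "finite R" "R \<subseteq> C" "T \<subseteq> C"
    and "\<And>Q. finite Q \<Longrightarrow> Q \<subseteq> C \<Longrightarrow> (\<lambda>l. fix_frac (n l) (f l) Q - fix_frac (n l) (g l) Q) \<longlonglongrightarrow> 0"
  shows "(\<lambda>l. cylinder_frac (n l) (f l) R T - cylinder_frac (n l) (g l) R T) \<longlonglongrightarrow> 0"
  using assms(1-4)
proof (induction T arbitrary: R)
  case empty
  then show ?case using assms(5)[of R] by (simp add: cylinder_frac_def fix_frac_def)
next
  case (insert t T)
  have "(\<lambda>l. (cylinder_frac (n l) (f l) R T - cylinder_frac (n l) (g l) R T) -
      (cylinder_frac (n l) (f l) (insert t R) T - cylinder_frac (n l) (g l) (insert t R) T)) \<longlonglongrightarrow> 0 - 0"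
    using insert.prems by (intro tendsto_diff insert.IH) auto
  then show ?case by (simp add: cylinder_frac_insert algebra_simps)
qed

lemma pmf_fix_law:
  assumes "1 \<le> n" "R \<subseteq> Q"
  shows "pmf (fix_law n f Q) R = cylinder_frac n f R (Q - R)"
proof -
  have "{\<gamma> \<in> Q. f \<gamma> x = x} \<in> {R} \<longleftrightarrow> (\<forall>q\<in>R. f q x = x) \<and> (\<forall>t\<in>Q - R. f t x \<noteq> x)" for x
    using assms(2) by auto
  then show ?thesis
    unfolding measure_pmf_single[symmetric] prob_fix_law[OF assms(1)] cylinder_frac_def by simp
qed

lemma abs_prob_diff_le_tv_dist:
  "\<bar>measure_pmf.prob p A - measure_pmf.prob q A\<bar> \<le> tv_dist p q"
  unfolding tv_dist_def
proof (rule cSUP_upper)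
  show "bdd_above (range (\<lambda>A. \<bar>measure_pmf.prob p A - measure_pmf.prob q A\<bar>))"
  proof (rule bdd_aboveI2)
    fix A
    have "0 \<le> measure_pmf.prob p A" "measure_pmf.prob p A \<le> 1" "0 \<le> measure_pmf.prob q A" "measure_pmf.prob q A \<le> 1"
      by simp_all
    then show "\<bar>measure_pmf.prob p A - measure_pmf.prob q A\<bar> \<le> 1" by linarith
  qed
qed simp

text \<open>Both laws live on the finite set \<open>Pow Q\<close>, so every event is a finite sum of
  atoms and the sum of all atom differences bounds the supremum.\<close>

lemma tv_dist_fix_law_le:
  assumes "1 \<le> n" "finite Q"
  shows "tv_dist (fix_law n f Q) (fix_law n g Q) \<le>
    (\<Sum>R\<in>Pow Q. \<bar>cylinder_frac n f R (Q - R) - cylinder_frac n g R (Q - R)\<bar>)"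
  unfolding tv_dist_def
proof (rule cSUP_least)
  fix A :: "'a set set"
  have prob: "measure_pmf.prob (fix_law n h Q) A = (\<Sum>R\<in>A \<inter> Pow Q. cylinder_frac n h R (Q - R))" for h :: "'a \<Rightarrow> nat \<Rightarrow> nat"
  proof -
    have "measure_pmf.prob (fix_law n h Q) A = measure_pmf.prob (fix_law n h Q) (A \<inter> Pow Q)"
      unfolding prob_fix_law[OF assms(1)] by (simp add: Int_def)
    also have "\<dots> = (\<Sum>R\<in>A \<inter> Pow Q. pmf (fix_law n h Q) R)"
      using assms(2) by (intro measure_measure_pmf_finite) simp
    also have "\<dots> = (\<Sum>R\<in>A \<inter> Pow Q. cylinder_frac n h R (Q - R))"
      by (intro sum.cong pmf_fix_law[OF assms(1)]) auto
    finally show ?thesis .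
  qed
  have "\<bar>measure_pmf.prob (fix_law n f Q) A - measure_pmf.prob (fix_law n g Q) A\<bar> \<le>
      (\<Sum>R\<in>A \<inter> Pow Q. \<bar>cylinder_frac n f R (Q - R) - cylinder_frac n g R (Q - R)\<bar>)"
    unfolding prob sum_subtractf[symmetric] by (rule sum_abs)
  also have "\<dots> \<le> (\<Sum>R\<in>Pow Q. \<bar>cylinder_frac n f R (Q - R) - cylinder_frac n g R (Q - R)\<bar>)"
    using assms(2) by (intro sum_mono2) auto
  finally show "\<bar>measure_pmf.prob (fix_law n f Q) A - measure_pmf.prob (fix_law n g Q) A\<bar> \<le>
    (\<Sum>R\<in>Pow Q. \<bar>cylinder_frac n f R (Q - R) - cylinder_frac n g R (Q - R)\<bar>)" .
qed simp

lemma tv_dist_fix_law_tendsto: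
  assumes n: "\<And>l. 1 \<le> n l" and Q: "finite Q" "Q \<subseteq> C"
    and lim: "\<And>Q. finite Q \<Longrightarrow> Q \<subseteq> C \<Longrightarrow> (\<lambda>l. fix_frac (n l) (f l) Q - fix_frac (n l) (g l) Q) \<longlonglongrightarrow> 0"
  shows "(\<lambda>l. tv_dist (fix_law (n l) (f l) Q) (fix_law (n l) (g l) Q)) \<longlonglongrightarrow> 0"
proof (rule tendsto_0_le)
  have "(\<lambda>l. \<Sum>R\<in>Pow Q. \<bar>cylinder_frac (n l) (f l) R (Q - R) - cylinder_frac (n l) (g l) R (Q - R)\<bar>) \<longlonglongrightarrow>
      (\<Sum>R\<in>Pow Q. \<bar>0\<bar>)"
  proof (rule tendsto_sum, rule tendsto_rabs)
    fix R assume "R \<in> Pow Q"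
    then show "(\<lambda>l. cylinder_frac (n l) (f l) R (Q - R) - cylinder_frac (n l) (g l) R (Q - R)) \<longlonglongrightarrow> 0"
      using Q by (intro cylinder_frac_diff_tendsto[where C = C] lim) (auto intro: finite_subset)
  qed
  then show "(\<lambda>l. \<Sum>R\<in>Pow Q. \<bar>cylinder_frac (n l) (f l) R (Q - R) - cylinder_frac (n l) (g l) R (Q - R)\<bar>) \<longlonglongrightarrow> 0"
    by simp
  show "0 \<le> tv_dist (fix_law (n l) (f l) Q) (fix_law (n l) (g l) Q)" for l
    by (rule order_trans[OF abs_ge_zero abs_prob_diff_le_tv_dist])
  show "tv_dist (fix_law (n l) (f l) Q) (fix_law (n l) (g l) Q) \<le>
      (\<Sum>R\<in>Pow Q. \<bar>cylinder_frac (n l) (f l) R (Q - R) - cylinder_frac (n l) (g l) R (Q - R)\<bar>)" for l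
    by (rule tv_dist_fix_law_le[OF n Q(1)])
qed

text \<open>The event that all of \<open>Q\<close> fixes the point is the single atom
  \<open>Q\<close>.\<close>

lemma fix_frac_diff_le_tv_dist:
  assumes "1 \<le> n"
  shows "\<bar>fix_frac n f Q - fix_frac n g Q\<bar> \<le> tv_dist (fix_law n f Q) (fix_law n g Q)"
proof -
  have prob: "measure_pmf.prob (fix_law n h Q) {Q} = fix_frac n h Q" for h :: "'a \<Rightarrow> nat \<Rightarrow> nat"
  proof -
    have "{\<gamma> \<in> Q. h \<gamma> x = x} \<in> {Q} \<longleftrightarrow> (\<forall>q\<in>Q. h q x = x)" for x by auto
    then show ?thesis unfolding prob_fix_law[OF assms] fix_frac_def by simp
  qed
  show ?thesis using abs_prob_diff_le_tv_dist[of "fix_law n f Q" "{Q}" "fix_law n g Q"] unfolding prob .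
qed

lemma fix_frac_image: "fix_frac n f (p ` Q) = fix_frac n (\<lambda>w. f (p w)) Q"
  by (simp add: fix_frac_def)

text \<open>A point fixed by all of \<open>Q\<close> under \<open>a\<close> is also fixed under
  \<open>b\<close>, unless \<open>a\<close> and \<open>b\<close> disagree there on some element of
  \<open>Q\<close>; a union bound counts the exceptions.\<close>

lemma fix_frac_le_add_perm_dist:
  assumes "finite Q"
  shows "fix_frac n a Q \<le> fix_frac n b Q + (\<Sum>q\<in>Q. perm_dist n n (a q) (b q))"
proof -
  let ?E = "\<lambda>q. {x \<in> {1..n}. a q x \<noteq> b q x}"
  have "card {x \<in> {1..n}. \<forall>q\<in>Q. a q x = x} \<le> card ({x \<in> {1..n}. \<forall>q\<in>Q. b q x = x} \<union> (\<Union>q\<in>Q. ?E q))"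
    using assms by (intro card_mono) auto
  also have "\<dots> \<le> card {x \<in> {1..n}. \<forall>q\<in>Q. b q x = x} + card (\<Union>q\<in>Q. ?E q)" by (rule card_Un_le)
  also have "card (\<Union>q\<in>Q. ?E q) \<le> (\<Sum>q\<in>Q. card (?E q))" by (rule card_UN_le[OF assms])
  finally have "real (card {x \<in> {1..n}. \<forall>q\<in>Q. a q x = x}) \<le>
      real (card {x \<in> {1..n}. \<forall>q\<in>Q. b q x = x} + (\<Sum>q\<in>Q. card (?E q)))" by (simp only: of_nat_le_iff)
  then have "fix_frac n a Q \<le> real (card {x \<in> {1..n}. \<forall>q\<in>Q. b q x = x} + (\<Sum>q\<in>Q. card (?E q))) / real n"
    unfolding fix_frac_def by (rule divide_right_mono) simp
  then show ?thesis
    by (simp only: perm_dist_eq[OF order_refl] fix_frac_def of_nat_add of_nat_sum add_divide_distrib sum_divide_distrib)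
qed

lemma fix_frac_diff_tendsto:
  assumes "finite Q" "\<And>q. q \<in> Q \<Longrightarrow> (\<lambda>l. perm_dist (n l) (n l) (a l q) (b l q)) \<longlonglongrightarrow> 0"
  shows "(\<lambda>l. fix_frac (n l) (a l) Q - fix_frac (n l) (b l) Q) \<longlonglongrightarrow> 0"
proof (rule Lim_null_comparison)
  show "eventually (\<lambda>l. norm (fix_frac (n l) (a l) Q - fix_frac (n l) (b l) Q) \<le>
      (\<Sum>q\<in>Q. perm_dist (n l) (n l) (a l q) (b l q))) sequentially"
  proof (intro always_eventually allI)
    fix l
    show "norm (fix_frac (n l) (a l) Q - fix_frac (n l) (b l) Q) \<le> (\<Sum>q\<in>Q. perm_dist (n l) (n l) (a l q) (b l q))"
      using fix_frac_le_add_perm_dist[OF assms(1), of "n l" "a l" "b l"]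
        fix_frac_le_add_perm_dist[OF assms(1), of "n l" "b l" "a l"]
      by (simp add: perm_dist_commute[of _ "b l _"] abs_le_iff)
  qed
  have "(\<lambda>l. \<Sum>q\<in>Q. perm_dist (n l) (n l) (a l q) (b l q)) \<longlonglongrightarrow> (\<Sum>q\<in>Q. 0)"
    by (rule tendsto_sum) (rule assms(2))
  then show "(\<lambda>l. \<Sum>q\<in>Q. perm_dist (n l) (n l) (a l q) (b l q)) \<longlonglongrightarrow> 0" by simp
qed

section \<open>Limit laws for the three classes of asymptotic homomorphisms\<close>

context marked_group
begin

lemma countable_F: "countable (carrier F)"
  by (rule countable_free_group[OF countable_finite[OF S]])

lemma countable_G: "countable (carrier G)"
  by (rule epi_countable_carrier[OF S epi])

lemma shadow_law_diff:
  assumes shadow: "\<And>w. w \<in> carrier F \<Longrightarrow>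
      (\<lambda>l. perm_dist (n l) (n l) (f l (\<pi> w)) (\<alpha> l w)) \<longlonglongrightarrow> 0"
    and Q: "finite Q" "Q \<subseteq> carrier F"
  shows "(\<lambda>l. fix_frac (n l) (\<alpha> l) Q - fix_frac (n l) (f l) (\<pi> ` Q)) \<longlonglongrightarrow> 0"
proof -
  have "(\<lambda>l. perm_dist (n l) (n l) (\<alpha> l w) (f l (\<pi> w))) \<longlonglongrightarrow> 0" if "w \<in> Q" for w
    using shadow[of w] Q(2) that by (simp add: perm_dist_commute[of _ "f _ (\<pi> w)"] subset_iff)
  then show ?thesis
    unfolding fix_frac_image by (rule fix_frac_diff_tendsto[OF Q(1)])
qed

lemma image_lift: "Q \<subseteq> carrier G \<Longrightarrow> \<pi> ` lift ` Q = Q"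
  by (auto simp: image_image lift subset_iff intro!: image_eqI)

text \<open>Compactness is applied to the free group, where stabilizer laws of the shadow actions
  are available. Kernel words asymptotically fix almost all points, which puts the limit under
  \<open>IRS_descend\<close>.\<close>

lemma stable_law:
  assumes f: "asymptotic_hom G n f"
    and \<alpha>: "\<And>l. \<alpha> l \<in> hom F (sym_group (n l))"
    and shadow: "\<And>w. w \<in> carrier F \<Longrightarrow>
        (\<lambda>l. perm_dist (n l) (n l) (f l (\<pi> w)) (\<alpha> l w)) \<longlonglongrightarrow> 0"
  shows "\<exists>r. strict_mono r \<and> limit_law (IRS G) (n \<circ> r) (\<alpha> \<circ> r)"
proof -
  interpret F: group F by (rule group_free_group)
  interpret \<pi>: group_hom F G \<pi> by (rule group_hom_free_group[OF G hom])
  have n: "1 \<le> n l" for l using f by (simp add: asymptotic_hom_def)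
  define \<mu>s where "\<mu>s l = stab_law F {1..n l} (\<lambda>g. restrict (\<alpha> l g) {1..n l})" for l
  have IRS: "\<mu>s l \<in> IRS F" for l
    unfolding \<mu>s_def by (rule stab_law_in_IRS[OF finite_gset_of_sym_hom[OF group_free_group \<alpha> n] countable_F])
  have \<mu>s: "measure (\<mu>s l) (above F Q) = fix_frac (n l) (\<alpha> l) Q"
    if "finite Q" "Q \<subseteq> carrier F" for l Q
    unfolding \<mu>s_def by (rule measure_stab_law_sym_hom[OF group_free_group \<alpha> n that])
  from F.IRS_sequentially_compact[OF countable_F, of \<mu>s, OF IRS] obtain r \<mu> where
    r: "strict_mono r" and \<mu>: "\<mu> \<in> IRS F" and
    lim: "\<forall>Q. finite Q \<and> Q \<subseteq> carrier F \<longrightarrow>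
       (\<lambda>l. measure (\<mu>s (r l)) (above F Q)) \<longlonglongrightarrow> measure \<mu> (above F Q)"
    by (elim exE conjE)
  have lim': "(\<lambda>l. fix_frac (n (r l)) (\<alpha> (r l)) Q) \<longlonglongrightarrow> measure \<mu> (above F Q)"
    if "finite Q" "Q \<subseteq> carrier F" for Q
    using lim[rule_format, of Q] that by (simp add: \<mu>s)
  have "measure \<mu> (above F {w}) = 1"
    if w: "w \<in> carrier F" "\<pi> w = \<one>\<^bsub>G\<^esub>" for w
  proof -
    \<comment> \<open>The identity word and \<open>w\<close> have the same image in
      \<open>G\<close>, so both of their permutations are close to the same permutation
      \<open>f l (\<pi> w)\<close>.\<close>
    have "(\<lambda>l. perm_dist (n l) (n l) (\<alpha> l \<one>\<^bsub>F\<^esub>) (\<alpha> l w)) \<longlonglongrightarrow> 0"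
    proof (rule tendsto_0_le)
      show "(\<lambda>l. perm_dist (n l) (n l) (f l (\<pi> \<one>\<^bsub>F\<^esub>)) (\<alpha> l \<one>\<^bsub>F\<^esub>) +
          perm_dist (n l) (n l) (f l (\<pi> w)) (\<alpha> l w)) \<longlonglongrightarrow> 0"
        using tendsto_add[OF shadow[OF F.one_closed] shadow[OF w(1)]] by simp
      show "perm_dist (n l) (n l) (\<alpha> l \<one>\<^bsub>F\<^esub>) (\<alpha> l w) \<le>
          perm_dist (n l) (n l) (f l (\<pi> \<one>\<^bsub>F\<^esub>)) (\<alpha> l \<one>\<^bsub>F\<^esub>) +
          perm_dist (n l) (n l) (f l (\<pi> w)) (\<alpha> l w)" for l
        using perm_dist_triangle[of "n l" "n l" "\<alpha> l \<one>\<^bsub>F\<^esub>" "\<alpha> l w" "f l (\<pi> w)"] w(2)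
        by (simp add: perm_dist_commute[of "n l" "f l \<one>\<^bsub>G\<^esub>" "\<alpha> l \<one>\<^bsub>F\<^esub>"])
    qed (rule perm_dist_nonneg)
    then have "(\<lambda>l. 1 - perm_dist (n l) (n l) (\<alpha> l \<one>\<^bsub>F\<^esub>) (\<alpha> l w)) \<longlonglongrightarrow> 1 - 0"
      by (intro tendsto_diff tendsto_const)
    then have "(\<lambda>l. fix_frac (n l) (\<alpha> l) {w}) \<longlonglongrightarrow> 1"
      using w(1) by (simp add: perm_dist_eq_fix_frac[OF n \<alpha> F.one_closed w(1)])
    from LIMSEQ_subseq_LIMSEQ[OF this r] show ?thesis
      using LIMSEQ_unique[OF lim'[of "{w}"]] w(1) by (simp add: comp_def)
  qed
  from IRS_descend[OF group_free_group G epi countable_F countable_G \<mu> this] obtain \<mu>' where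
    \<mu>': "\<mu>' \<in> IRS G" "\<forall>Q. finite Q \<longrightarrow> Q \<subseteq> carrier F \<longrightarrow>
      measure \<mu>' (above G (\<pi> ` Q)) = measure \<mu> (above F Q)" by (rule bexE)
  have "limit_law (IRS G) (n \<circ> r) (\<alpha> \<circ> r)"
    unfolding limit_law_def using n \<alpha> \<mu>' lim' by (intro conjI allI bexI[of _ \<mu>']) simp_all
  then show ?thesis using r by (intro exI conjI)
qed

text \<open>The limit is taken for the comparison homomorphisms \<open>g\<close>, directly in
  \<open>IRS G\<close>: their stabilizer laws are carried by subgroups of finite index and so
  witness co-soficity themselves. The law of \<alpha> has the same limit.\<close>

lemma BS_rigid_law:
  assumes g: "\<And>l. g l \<in> hom G (sym_group (n l))" and n: "\<And>l. 1 \<le> n l"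
    and tv: "\<And>Q. finite Q \<Longrightarrow> Q \<subseteq> carrier G \<Longrightarrow>
      (\<lambda>l. tv_dist (fix_law (n l) (f l) Q) (fix_law (n l) (g l) Q)) \<longlonglongrightarrow> 0"
    and \<alpha>: "\<And>l. \<alpha> l \<in> hom F (sym_group (n l))"
    and shadow: "\<And>w. w \<in> carrier F \<Longrightarrow>
        (\<lambda>l. perm_dist (n l) (n l) (f l (\<pi> w)) (\<alpha> l w)) \<longlonglongrightarrow> 0"
  shows "\<exists>r. strict_mono r \<and> limit_law {\<mu> \<in> IRS G. co_sofic G \<mu>} (n \<circ> r) (\<alpha> \<circ> r)"
proof -
  interpret G: group G by (rule G)
  define \<mu>s where "\<mu>s l = stab_law G {1..n l} (\<lambda>x. restrict (g l x) {1..n l})" for l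
  have gset: "finite_gset G {1..n l} (\<lambda>x. restrict (g l x) {1..n l})" for l
    by (rule finite_gset_of_sym_hom[OF G g n])
  have IRS: "\<mu>s l \<in> IRS G" for l
    unfolding \<mu>s_def by (rule stab_law_in_IRS[OF gset countable_G])
  have ae: "AE H in \<mu>s l. finite (rcosets\<^bsub>G\<^esub> H)" for l
    unfolding \<mu>s_def by (rule AE_stab_law_finite_index[OF gset countable_G])
  have \<mu>s: "measure (\<mu>s l) (above G Q) = fix_frac (n l) (g l) Q" if "finite Q" "Q \<subseteq> carrier G" for l Q
    unfolding \<mu>s_def by (rule measure_stab_law_sym_hom[OF G g n that])
  from G.IRS_sequentially_compact[OF countable_G, of \<mu>s, OF IRS] obtain r \<mu> where
    r: "strict_mono r" and \<mu>: "\<mu> \<in> IRS G" and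
    lim: "\<forall>Q. finite Q \<and> Q \<subseteq> carrier G \<longrightarrow>
       (\<lambda>l. measure (\<mu>s (r l)) (above G Q)) \<longlonglongrightarrow> measure \<mu> (above G Q)"
    by (elim exE conjE)
  have "limitin (IRS_topology G) (\<lambda>l. \<mu>s (r l)) \<mu> sequentially"
    unfolding G.limitin_IRS_iff[OF countable_G] using \<mu> IRS lim by (intro conjI) simp_all
  then have "co_sofic G \<mu>"
    unfolding co_sofic_def using IRS ae by (intro exI[of _ "\<lambda>l. \<mu>s (r l)"] conjI allI)
  moreover have "(\<lambda>l. fix_frac ((n \<circ> r) l) ((\<alpha> \<circ> r) l) Q) \<longlonglongrightarrow> measure \<mu> (above G (\<pi> ` Q))"
    if Q: "finite Q" "Q \<subseteq> carrier F" for Q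
  proof -
    have Q': "finite (\<pi> ` Q)" "\<pi> ` Q \<subseteq> carrier G" using Q pi_closed by auto
    \<comment> \<open>The total variation hypothesis compares \<open>f\<close> with
      \<open>g\<close>; the shadow property then compares \<alpha> with \<open>f\<close>.\<close>
    have "(\<lambda>l. fix_frac (n l) (f l) (\<pi> ` Q) - fix_frac (n l) (g l) (\<pi> ` Q)) \<longlonglongrightarrow> 0"
    proof (rule Lim_null_comparison[OF _ tv[OF Q']])
      show "eventually (\<lambda>l. norm (fix_frac (n l) (f l) (\<pi> ` Q) - fix_frac (n l) (g l) (\<pi> ` Q)) \<le>
          tv_dist (fix_law (n l) (f l) (\<pi> ` Q)) (fix_law (n l) (g l) (\<pi> ` Q))) sequentially"
        unfolding real_norm_def by (intro always_eventually allI fix_frac_diff_le_tv_dist n)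
    qed
    from tendsto_add[OF shadow_law_diff[of n f \<alpha>, OF shadow Q] this]
    have "(\<lambda>l. fix_frac (n l) (\<alpha> l) Q - fix_frac (n l) (g l) (\<pi> ` Q)) \<longlonglongrightarrow> 0" by simp
    from LIMSEQ_subseq_LIMSEQ[OF this r]
    have "(\<lambda>l. fix_frac (n (r l)) (\<alpha> (r l)) Q - fix_frac (n (r l)) (g (r l)) (\<pi> ` Q)) \<longlonglongrightarrow> 0"
      by (simp add: comp_def)
    moreover have "(\<lambda>l. fix_frac (n (r l)) (g (r l)) (\<pi> ` Q)) \<longlonglongrightarrow> measure \<mu> (above G (\<pi> ` Q))"
      using lim[rule_format, of "\<pi> ` Q"] Q' by (simp add: \<mu>s)
    ultimately show ?thesis using tendsto_add by fastforce
  qed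
  ultimately have "limit_law {\<mu> \<in> IRS G. co_sofic G \<mu>} (n \<circ> r) (\<alpha> \<circ> r)"
    unfolding limit_law_def using n \<alpha> \<mu> by (intro conjI allI bexI[of _ \<mu>]) simp_all
  then show ?thesis using r by (intro exI conjI)
qed

text \<open>The actions supplied by co-soficity and the lifted \<alpha> have the same limiting fixed
  fractions, and for finite sets this is convergence in total variation.\<close>

lemma BS_rigid_lift:
  assumes law: "limit_law {\<mu> \<in> IRS G. co_sofic G \<mu>} n \<alpha>" and n: "filterlim n at_top sequentially"
  shows "\<exists>g. (\<forall>l. g l \<in> hom G (sym_group (n l))) \<and> (\<forall>Q. finite Q \<and> Q \<subseteq> carrier G \<longrightarrow>
    (\<lambda>l. tv_dist (fix_law (n l) (\<lambda>x. \<alpha> l (lift x)) Q) (fix_law (n l) (g l) Q)) \<longlonglongrightarrow> 0)"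
proof -
  interpret G: group G by (rule G)
  from law obtain \<mu> where \<mu>: "\<mu> \<in> {\<mu> \<in> IRS G. co_sofic G \<mu>}"
    "\<forall>Q. finite Q \<longrightarrow> Q \<subseteq> carrier F \<longrightarrow>
        (\<lambda>l. fix_frac (n l) (\<alpha> l) Q) \<longlonglongrightarrow> measure \<mu> (above G (\<pi> ` Q))"
    unfolding limit_law_def by (elim conjE bexE)
  have n1: "1 \<le> n l" for l using law by (simp add: limit_law_def)
  from \<mu>(1) have "co_sofic G \<mu>" by simp
  from G.co_sofic_imp_finite_actions[OF countable_G countable_finite_index_subgroups[OF G S epi] this n]
  obtain g where g: "\<forall>l. g l \<in> hom G (sym_group (n l))" "\<forall>Q. finite Q \<longrightarrow> Q \<subseteq> carrier G \<longrightarrow>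
      (\<lambda>l. fix_frac (n l) (g l) Q) \<longlonglongrightarrow> measure \<mu> (above G Q)" by (elim exE conjE)
  have diff: "(\<lambda>l. fix_frac (n l) (\<lambda>x. \<alpha> l (lift x)) Q - fix_frac (n l) (g l) Q) \<longlonglongrightarrow> 0"
    if Q: "finite Q" "Q \<subseteq> carrier G" for Q
  proof -
    have Q': "finite (lift ` Q)" "lift ` Q \<subseteq> carrier F" using Q lift(1) by auto
    have "(\<lambda>l. fix_frac (n l) (\<lambda>x. \<alpha> l (lift x)) Q) \<longlonglongrightarrow> measure \<mu> (above G Q)"
      using \<mu>(2)[rule_format, OF Q'] unfolding image_lift[OF Q(2)] fix_frac_image .
    from tendsto_diff[OF this g(2)[rule_format, OF Q]] show ?thesis by simp
  qed
  have "(\<lambda>l. tv_dist (fix_law (n l) (\<lambda>x. \<alpha> l (lift x)) Q) (fix_law (n l) (g l) Q)) \<longlonglongrightarrow> 0"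
    if Q: "finite Q" "Q \<subseteq> carrier G" for Q
    by (rule tv_dist_fix_law_tendsto[OF n1 Q diff])
  then show ?thesis using g(1) by (intro exI[of _ g] conjI) auto
qed

lemma perm_dist_id_eq:
  assumes "1 \<le> n" "\<alpha> \<in> hom F (sym_group n)" "w \<in> carrier F"
  shows "perm_dist n n (\<alpha> w) id = 1 - fix_frac n \<alpha> {w}"
proof -
  interpret F: group F by (rule group_free_group)
  show ?thesis
    using perm_dist_eq_fix_frac[OF assms(1,2) F.one_closed assms(3)] assms(3)
    by (simp add: sym_hom_one[OF group_free_group assms(2)] perm_dist_commute[of n "\<alpha> w" id])
qed

text \<open>The limit is prescribed, so the whole sequence converges without any extraction: kernel
  words become nearly trivial, and any other word fixes a vanishing fraction.\<close>

lemma weakly_stable_law: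
  assumes n: "\<And>l. 1 \<le> n l"
    and free: "\<And>g. g \<in> carrier G \<Longrightarrow> g \<noteq> \<one>\<^bsub>G\<^esub> \<Longrightarrow>
      (\<lambda>l. perm_dist (n l) (n l) (f l g) \<one>\<^bsub>sym_group (n l)\<^esub>) \<longlonglongrightarrow> 1"
    and f: "asymptotic_hom G n f"
    and \<alpha>: "\<And>l. \<alpha> l \<in> hom F (sym_group (n l))"
    and shadow: "\<And>w. w \<in> carrier F \<Longrightarrow>
        (\<lambda>l. perm_dist (n l) (n l) (f l (\<pi> w)) (\<alpha> l w)) \<longlonglongrightarrow> 0"
  shows "limit_law {dirac_trivial G} n \<alpha>"
proof -
  interpret G: group G by (rule G)
  interpret F: group F by (rule group_free_group)
  interpret \<pi>: group_hom F G \<pi> by (rule group_hom_free_group[OF G hom])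
  have one: "\<alpha> l \<one>\<^bsub>F\<^esub> = id" for l by (rule sym_hom_one[OF group_free_group \<alpha>])
  have "(\<lambda>l. fix_frac (n l) (\<alpha> l) Q) \<longlonglongrightarrow> measure (dirac_trivial G) (above G (\<pi> ` Q))"
    if Q: "finite Q" "Q \<subseteq> carrier F" for Q
  proof -
    have "finite (\<pi> ` Q)" "\<pi> ` Q \<subseteq> carrier G" using Q pi_closed by auto
    then have dirac: "measure (dirac_trivial G) (above G (\<pi> ` Q)) = of_bool (\<pi> ` Q \<subseteq> {\<one>\<^bsub>G\<^esub>})"
      by (rule G.measure_dirac_trivial_above)
    show ?thesis
    proof (cases "\<pi> ` Q \<subseteq> {\<one>\<^bsub>G\<^esub>}")
      case True
      have "(\<lambda>l. perm_dist (n l) (n l) (\<alpha> l w) id) \<longlonglongrightarrow> 0" if w: "w \<in> Q" for w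
      proof (rule tendsto_0_le)
        have wF: "w \<in> carrier F" and \<pi>w: "\<pi> w = \<one>\<^bsub>G\<^esub>" using w Q(2) True by auto
        show "(\<lambda>l. perm_dist (n l) (n l) (f l (\<pi> \<one>\<^bsub>F\<^esub>)) (\<alpha> l \<one>\<^bsub>F\<^esub>) +
            perm_dist (n l) (n l) (f l (\<pi> w)) (\<alpha> l w)) \<longlonglongrightarrow> 0"
          using tendsto_add[OF shadow[OF F.one_closed] shadow[OF wF]] by simp
        show "perm_dist (n l) (n l) (\<alpha> l w) id \<le>
            perm_dist (n l) (n l) (f l (\<pi> \<one>\<^bsub>F\<^esub>)) (\<alpha> l \<one>\<^bsub>F\<^esub>) +
            perm_dist (n l) (n l) (f l (\<pi> w)) (\<alpha> l w)" for l
          using perm_dist_triangle[of "n l" "n l" "\<alpha> l w" id "f l (\<pi> w)"] \<pi>w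
          by (simp add: one perm_dist_commute[of "n l" "f l \<one>\<^bsub>G\<^esub>" "\<alpha> l w"])
      qed (rule perm_dist_nonneg)
      then have "(\<lambda>l. fix_frac (n l) (\<alpha> l) Q - fix_frac (n l) (\<lambda>_. id) Q) \<longlonglongrightarrow> 0"
        by (rule fix_frac_diff_tendsto[OF Q(1)])
      moreover have "fix_frac (n l) (\<lambda>_. id) Q = 1" for l
      proof -
        have "{x \<in> {1..n l}. \<forall>q\<in>Q. id x = x} = {1..n l}" by auto
        then show ?thesis unfolding fix_frac_def using n[of l] by simp
      qed
      ultimately show ?thesis unfolding dirac using True by (simp add: LIM_zero_iff)
    next
      case False
      then obtain w where w: "w \<in> Q" "\<pi> w \<noteq> \<one>\<^bsub>G\<^esub>" by auto
      then have wF: "w \<in> carrier F" using Q(2) by blast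
      \<comment> \<open>One element of \<open>Q\<close> outside the kernel suffices, since its fixed
        points include all common fixed points of \<open>Q\<close>.\<close>
      have "(\<lambda>l. fix_frac (n l) (\<alpha> l) Q) \<longlonglongrightarrow> 0"
      proof (rule tendsto_0_le)
        have "(\<lambda>l. 1 - perm_dist (n l) (n l) (f l (\<pi> w)) id + perm_dist (n l) (n l) (f l (\<pi> w)) (\<alpha> l w)) \<longlonglongrightarrow> 1 - 1 + 0"
          using free[OF pi_closed[OF wF] w(2)] unfolding sym_group_one
          by (intro tendsto_add tendsto_diff tendsto_const shadow[OF wF])
        then show "(\<lambda>l. 1 - perm_dist (n l) (n l) (f l (\<pi> w)) id + perm_dist (n l) (n l) (f l (\<pi> w)) (\<alpha> l w)) \<longlonglongrightarrow> 0"
          by simp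
        fix l
        show "0 \<le> fix_frac (n l) (\<alpha> l) Q" by (simp add: fix_frac_def)
        have "fix_frac (n l) (\<alpha> l) Q \<le> fix_frac (n l) (\<alpha> l) {w}"
          unfolding fix_frac_def using w(1) by (intro divide_right_mono of_nat_mono card_mono) auto
        also have "\<dots> = 1 - perm_dist (n l) (n l) (\<alpha> l w) id"
          using perm_dist_id_eq[OF n \<alpha> wF, of l] by simp
        also have "\<dots> \<le> 1 - perm_dist (n l) (n l) (f l (\<pi> w)) id + perm_dist (n l) (n l) (f l (\<pi> w)) (\<alpha> l w)"
          using perm_dist_triangle[of "n l" "n l" "f l (\<pi> w)" id "\<alpha> l w"] by simp
        finally show "fix_frac (n l) (\<alpha> l) Q \<le>
            1 - perm_dist (n l) (n l) (f l (\<pi> w)) id + perm_dist (n l) (n l) (f l (\<pi> w)) (\<alpha> l w)" .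
      qed
      then show ?thesis unfolding dirac using False by simp
    qed
  qed
  then show ?thesis unfolding limit_law_def using n \<alpha> by simp
qed

lemma weakly_stable_lift:
  assumes law: "limit_law {dirac_trivial G} n \<alpha>" and g: "g \<in> carrier G" "g \<noteq> \<one>\<^bsub>G\<^esub>"
  shows "(\<lambda>l. perm_dist (n l) (n l) (\<alpha> l (lift g)) \<one>\<^bsub>sym_group (n l)\<^esub>) \<longlonglongrightarrow> 1"
proof -
  interpret G: group G by (rule G)
  have \<alpha>: "\<alpha> l \<in> hom F (sym_group (n l))" and n: "1 \<le> n l" for l
    using law by (simp_all add: limit_law_def)
  have L: "\<forall>Q. finite Q \<longrightarrow> Q \<subseteq> carrier F \<longrightarrow>
      (\<lambda>l. fix_frac (n l) (\<alpha> l) Q) \<longlonglongrightarrow> measure (dirac_trivial G) (above G (\<pi> ` Q))"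
    using law by (simp add: limit_law_def)
  have "(\<lambda>l. fix_frac (n l) (\<alpha> l) {lift g}) \<longlonglongrightarrow> measure (dirac_trivial G) (above G (\<pi> ` {lift g}))"
    using L[rule_format, of "{lift g}"] lift(1)[OF g(1)] by simp
  moreover have "measure (dirac_trivial G) (above G (\<pi> ` {lift g})) = 0"
    using G.measure_dirac_trivial_above[of "{g}"] g by (simp add: lift(2))
  ultimately have "(\<lambda>l. 1 - fix_frac (n l) (\<alpha> l) {lift g}) \<longlonglongrightarrow> 1 - 0"
    by (intro tendsto_diff tendsto_const) simp
  then show ?thesis
    by (simp add: sym_group_one perm_dist_id_eq[OF n \<alpha> lift(1)[OF g(1)]])
qed

end

section \<open>Challenges as limit laws, and the three equivalences\<close>

context marked_group
begin

lemma converges_to_iff: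
  assumes M: "\<mu> \<in> IRS G"
    and X: "\<And>n. finite_gset F (X n) (\<alpha> n)"
    and b: "\<And>n. bij_betw (b n) {1..card (X n)} (X n)"
    and \<alpha>': "\<And>n. \<alpha>' n \<in> hom F (sym_group (card (X n)))"
    and b\<alpha>: "\<And>n. \<forall>w\<in>carrier F. \<forall>i\<in>{1..card (X n)}. b n (\<alpha>' n w i) = \<alpha> n w (b n i)"
  shows "converges_to F X \<alpha> (IRS_embed F \<pi> \<mu>) \<longleftrightarrow>
    (\<forall>Q. finite Q \<longrightarrow> Q \<subseteq> carrier F \<longrightarrow>
        (\<lambda>n. fix_frac (card (X n)) (\<alpha>' n) Q) \<longlonglongrightarrow> measure \<mu> (above G (\<pi> ` Q)))"
proof -
  interpret F: group F by (rule group_free_group)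
  have sets: "sets \<mu> = sets (borel_of (Sub G))" using M by (simp add: IRS_def)
  have law: "measure (stab_law F (X n) (\<alpha> n)) (above F Q) = fix_frac (card (X n)) (\<alpha>' n) Q"
    if "finite Q" "Q \<subseteq> carrier F" for n Q
    by (rule fix_frac_transport[OF X b \<alpha>' b\<alpha> that])
  have emb: "measure (IRS_embed F \<pi> \<mu>) (above F Q) = measure \<mu> (above G (\<pi> ` Q))"
    if "finite Q" "Q \<subseteq> carrier F" for Q
    by (rule measure_IRS_embed_above[OF group_free_group G hom countable_F sets that])
  have IRS: "stab_law F (X n) (\<alpha> n) \<in> IRS F" for n
    by (rule stab_law_in_IRS[OF X countable_F])
  have "IRS_embed F \<pi> \<mu> \<in> IRS F"
    by (rule IRS_embed_in_IRS[OF group_free_group G hom countable_F countable_G M])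
  then show ?thesis
    unfolding converges_to_def F.limitin_IRS_iff[OF countable_F] using X IRS by (simp add: law emb imp_conjL cong: imp_cong)
qed

lemma sym_hom_transport:
  assumes "finite_gset F X \<alpha>"
  shows "\<exists>b \<alpha>'. bij_betw b {1..card X} X \<and> \<alpha>' \<in> hom F (sym_group (card X)) \<and>
    (\<forall>w\<in>carrier F. \<forall>i\<in>{1..card X}. b (\<alpha>' w i) = \<alpha> w (b i))"
proof -
  have "finite X" using assms by (rule finite_gsetD)
  then obtain b where b: "bij_betw b {1..card X} X" using ex_bij_betw_nat_finite_1 by (elim exE[rotated])
  from sym_hom_of_gset[OF assms b] obtain \<alpha>' where
    "\<alpha>' \<in> hom F (sym_group (card X))"
    "\<forall>w\<in>carrier F. \<forall>i\<in>{1..card X}. b (\<alpha>' w i) = \<alpha> w (b i)" by (rule bexE)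
  then show ?thesis using b by (intro exI conjI)
qed

text \<open>Passing between sets and degrees costs only a choice of labels, and both solvability and
  convergence depend only on the labelled permutations.\<close>

lemma challenges_iff:
  fixes \<nu> :: "real \<Rightarrow> nat \<Rightarrow> enat"
  assumes mono: "\<And>\<epsilon> \<epsilon>' n. 0 < \<epsilon> \<Longrightarrow> \<epsilon> \<le> \<epsilon>' \<Longrightarrow> 1 \<le> n \<Longrightarrow> \<nu> \<epsilon> n \<le> \<nu> \<epsilon>' n"
    and M: "M \<subseteq> IRS G"
  shows "(\<forall>(X :: nat \<Rightarrow> 'x::infinite set) \<alpha>.
      (\<exists>\<mu>\<in>M. converges_to F X \<alpha> (IRS_embed F \<pi> \<mu>)) \<longrightarrow>
      (\<exists>(Y :: nat \<Rightarrow> 'x set) \<beta>. flexible_solution \<nu> S G \<pi> X \<alpha> Y \<beta>)) \<longleftrightarrow>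
    (\<forall>n \<alpha>. limit_law M n \<alpha> \<longrightarrow> (\<forall>\<delta>>0. eventually (\<lambda>l. nearly_action \<nu> S G \<pi> \<delta> (n l) (\<alpha> l)) sequentially))"
    (is "?L \<longleftrightarrow> ?R")
proof
  assume L: ?L
  show ?R
  proof (intro allI impI)
    fix n :: "nat \<Rightarrow> nat" and \<alpha>' :: "nat \<Rightarrow> 's word \<Rightarrow> nat \<Rightarrow> nat" and \<delta> :: real
    assume law: "limit_law M n \<alpha>'" and \<delta>: "0 < \<delta>"
    have \<alpha>': "\<alpha>' l \<in> hom F (sym_group (n l))" and n: "1 \<le> n l" for l
      using law by (simp_all add: limit_law_def)
    from law obtain \<mu> where \<mu>: "\<mu> \<in> M" "\<forall>Q. finite Q \<longrightarrow> Q \<subseteq> carrier F \<longrightarrow>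
        (\<lambda>l. fix_frac (n l) (\<alpha>' l) Q) \<longlonglongrightarrow> measure \<mu> (above G (\<pi> ` Q))"
      unfolding limit_law_def by (elim conjE bexE)
    \<comment> \<open>An infinite type contains a copy of the naturals, so sets of every required
      degree exist inside it and a single injection labels them all.\<close>
    obtain \<iota> :: "nat \<Rightarrow> 'x" where \<iota>: "inj \<iota>"
      using infinite_countable_subset[OF infinite_UNIV[where 'a = 'x]] by auto
    define X where "X l = \<iota> ` {1..n l}" for l
    have b: "bij_betw \<iota> {1..n l} (X l)" for l
      unfolding X_def using inj_on_subset[OF \<iota>, of "{1..n l}"] by (intro inj_on_imp_bij_betw) simp
    have card: "card (X l) = n l" for l using bij_betw_same_card[OF b] by simp
    have "\<forall>l. \<exists>\<alpha>. finite_gset F (X l) \<alpha> \<and>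
        (\<forall>w\<in>carrier F. \<forall>i\<in>{1..n l}. \<iota> (\<alpha>' l w i) = \<alpha> w (\<iota> i))"
      by (intro allI gset_of_sym_hom[OF group_free_group \<alpha>' b n])
    from choice[OF this] obtain \<alpha> where \<alpha>: "\<forall>l. finite_gset F (X l) (\<alpha> l) \<and>
        (\<forall>w\<in>carrier F. \<forall>i\<in>{1..n l}. \<iota> (\<alpha>' l w i) = \<alpha> l w (\<iota> i))" ..
    have X: "finite_gset F (X l) (\<alpha> l)" for l using \<alpha> by simp
    have b': "bij_betw \<iota> {1..card (X l)} (X l)" for l unfolding card by (rule b)
    have \<alpha>'': "\<alpha>' l \<in> hom F (sym_group (card (X l)))" for l unfolding card by (rule \<alpha>')
    have b\<alpha>: "\<forall>w\<in>carrier F. \<forall>i\<in>{1..card (X l)}. \<iota> (\<alpha>' l w i) = \<alpha> l w (\<iota> i)" for l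
      unfolding card using \<alpha> by simp
    have "\<mu> \<in> IRS G" using \<mu>(1) M by blast
    then have "converges_to F X \<alpha> (IRS_embed F \<pi> \<mu>)"
      using converges_to_iff[of \<mu> X \<alpha> "\<lambda>_. \<iota>" \<alpha>', OF _ X b' \<alpha>'' b\<alpha>] \<mu>(2) by (simp add: card)
    then have "\<exists>(Y :: nat \<Rightarrow> 'x set) \<beta>. flexible_solution \<nu> S G \<pi> X \<alpha> Y \<beta>"
      using L \<mu>(1) by blast
    moreover have "(\<exists>(Y :: nat \<Rightarrow> 'x set) \<beta>. flexible_solution \<nu> S G \<pi> X \<alpha> Y \<beta>) \<longleftrightarrow>
      (\<forall>\<delta>>0. eventually (\<lambda>l. nearly_action \<nu> S G \<pi> \<delta> (card (X l)) (\<alpha>' l)) sequentially)"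
    proof (rule flexible_solution_iff[OF G hom])
      show "\<nu> \<epsilon> k \<le> \<nu> \<epsilon>' k" if "0 < \<epsilon>" "\<epsilon> \<le> \<epsilon>'" "1 \<le> k" for \<epsilon> \<epsilon>' k using that by (rule mono)
    qed (rule X b' \<alpha>'' b\<alpha>)+
    ultimately show "eventually (\<lambda>l. nearly_action \<nu> S G \<pi> \<delta> (n l) (\<alpha>' l)) sequentially"
      using \<delta> by (simp add: card)
  qed
next
  assume R: ?R
  show ?L
  proof (intro allI impI)
    fix X :: "nat \<Rightarrow> 'x set" and \<alpha>
    assume "\<exists>\<mu>\<in>M. converges_to F X \<alpha> (IRS_embed F \<pi> \<mu>)"
    then obtain \<mu> where \<mu>: "\<mu> \<in> M" "converges_to F X \<alpha> (IRS_embed F \<pi> \<mu>)" by (rule bexE)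
    have X: "finite_gset F (X n) (\<alpha> n)" for n using \<mu>(2) by (simp add: converges_to_def)
    from sym_hom_transport[OF X] obtain b \<alpha>' where
      b: "\<And>n. bij_betw (b n) {1..card (X n)} (X n)" and
      \<alpha>': "\<And>n. \<alpha>' n \<in> hom F (sym_group (card (X n)))" and
      b\<alpha>: "\<And>n. \<forall>w\<in>carrier F. \<forall>i\<in>{1..card (X n)}. b n (\<alpha>' n w i) = \<alpha> n w (b n i)"
      by metis
    have pos: "1 \<le> card (X n)" for n
      using X[of n] by (simp add: finite_gset_def Suc_le_eq card_gt_0_iff)
    have "\<mu> \<in> IRS G" using \<mu>(1) M by blast
    from converges_to_iff[OF this X b \<alpha>' b\<alpha>] \<mu> have "limit_law M (\<lambda>n. card (X n)) \<alpha>'"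
      unfolding limit_law_def using pos \<alpha>' by (intro conjI allI bexI[of _ \<mu>]) simp_all
    then have "\<forall>\<delta>>0. eventually (\<lambda>l. nearly_action \<nu> S G \<pi> \<delta> (card (X l)) (\<alpha>' l)) sequentially"
      using R by simp
    moreover have "(\<exists>(Y :: nat \<Rightarrow> 'x set) \<beta>. flexible_solution \<nu> S G \<pi> X \<alpha> Y \<beta>) \<longleftrightarrow>
      (\<forall>\<delta>>0. eventually (\<lambda>l. nearly_action \<nu> S G \<pi> \<delta> (card (X l)) (\<alpha>' l)) sequentially)"
    proof (rule flexible_solution_iff[OF G hom])
      show "\<nu> \<epsilon> k \<le> \<nu> \<epsilon>' k" if "0 < \<epsilon>" "\<epsilon> \<le> \<epsilon>'" "1 \<le> k" for \<epsilon> \<epsilon>' k using that by (rule mono)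
    qed (rule X b \<alpha>' b\<alpha>)+
    ultimately show "\<exists>(Y :: nat \<Rightarrow> 'x set) \<beta>. flexible_solution \<nu> S G \<pi> X \<alpha> Y \<beta>" by simp
  qed
qed

lemma asymptotic_hom_subseq:
  assumes "asymptotic_hom G n f" "strict_mono r"
  shows "asymptotic_hom G (n \<circ> r) (f \<circ> r)"
  unfolding asymptotic_hom_def
proof (intro conjI ballI)
  show "\<forall>l. 1 \<le> (n \<circ> r) l \<and> (f \<circ> r) l \<in> carrier G \<rightarrow> carrier (sym_group ((n \<circ> r) l))"
    using assms(1) by (simp add: asymptotic_hom_def)
  have "filterlim n at_top sequentially" using assms(1) by (simp add: asymptotic_hom_def)
  from filterlim_compose[OF this filterlim_subseq[OF assms(2)]]
  show "filterlim (n \<circ> r) at_top sequentially" by (simp add: comp_def)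
  fix g h assume "g \<in> carrier G" "h \<in> carrier G"
  then have "(\<lambda>l. perm_dist (n l) (n l) (f l (g \<otimes>\<^bsub>G\<^esub> h)) (f l g \<otimes>\<^bsub>sym_group (n l)\<^esub> f l h)) \<longlonglongrightarrow> 0"
    using assms(1) by (simp add: asymptotic_hom_def)
  from LIMSEQ_subseq_LIMSEQ[OF this assms(2)]
  show "(\<lambda>l. perm_dist ((n \<circ> r) l) ((n \<circ> r) l) ((f \<circ> r) l (g \<otimes>\<^bsub>G\<^esub> h))
      ((f \<circ> r) l g \<otimes>\<^bsub>sym_group ((n \<circ> r) l)\<^esub> (f \<circ> r) l h)) \<longlonglongrightarrow> 0"
    by (simp add: comp_def)
qed

lemma stable_iff:
  fixes \<nu> :: "real \<Rightarrow> nat \<Rightarrow> enat"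
  assumes mono: "\<And>\<epsilon> \<epsilon>' n. 0 < \<epsilon> \<Longrightarrow> \<epsilon> \<le> \<epsilon>' \<Longrightarrow> 1 \<le> n \<Longrightarrow> \<nu> \<epsilon> n \<le> \<nu> \<epsilon>' n"
  shows "flexibly_stable \<nu> G \<longleftrightarrow>
    (\<forall>(X :: nat \<Rightarrow> 'x::infinite set) \<alpha>. stability_challenge S G \<pi> X \<alpha> \<longrightarrow>
      (\<exists>(Y :: nat \<Rightarrow> 'x set) \<beta>. flexible_solution \<nu> S G \<pi> X \<alpha> Y \<beta>))"
proof -
  have "flexibly_stable \<nu> G \<longleftrightarrow>
    (\<forall>n \<alpha>. limit_law (IRS G) n \<alpha> \<longrightarrow> (\<forall>\<delta>>0. eventually (\<lambda>l. nearly_action \<nu> S G \<pi> \<delta> (n l) (\<alpha> l)) sequentially))"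
    unfolding flexibly_stable_def
  proof (rule stability_iff_challenges)
    show "\<nu> \<epsilon> k \<le> \<nu> \<epsilon>' k" if "0 < \<epsilon>" "\<epsilon> \<le> \<epsilon>'" "1 \<le> k" for \<epsilon> \<epsilon>' k using that by (rule mono)
  qed (simp_all add: asymptotic_hom_subseq limit_law_asymptotic_hom stable_law)
  then show ?thesis
    unfolding stability_challenge_def using challenges_iff[of \<nu> "IRS G", OF mono, where 'x = 'x] by simp
qed

lemma BS_rigid_iff:
  fixes \<nu> :: "real \<Rightarrow> nat \<Rightarrow> enat"
  assumes mono: "\<And>\<epsilon> \<epsilon>' n. 0 < \<epsilon> \<Longrightarrow> \<epsilon> \<le> \<epsilon>' \<Longrightarrow> 1 \<le> n \<Longrightarrow> \<nu> \<epsilon> n \<le> \<nu> \<epsilon>' n"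
  shows "flexibly_BS_rigid \<nu> G \<longleftrightarrow>
    (\<forall>(X :: nat \<Rightarrow> 'x::infinite set) \<alpha>. BS_rigidity_challenge S G \<pi> X \<alpha> \<longrightarrow>
      (\<exists>(Y :: nat \<Rightarrow> 'x set) \<beta>. flexible_solution \<nu> S G \<pi> X \<alpha> Y \<beta>))"
proof -
  let ?M = "{\<mu> \<in> IRS G. co_sofic G \<mu>}"
  have M: "?M \<subseteq> IRS G" by blast
  have "flexibly_BS_rigid \<nu> G \<longleftrightarrow>
    (\<forall>n \<alpha>. limit_law ?M n \<alpha> \<longrightarrow> (\<forall>\<delta>>0. eventually (\<lambda>l. nearly_action \<nu> S G \<pi> \<delta> (n l) (\<alpha> l)) sequentially))"
    unfolding flexibly_BS_rigid_def
  proof (rule stability_iff_challenges[OF _ M])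
    show "\<nu> \<epsilon> k \<le> \<nu> \<epsilon>' k" if "0 < \<epsilon>" "\<epsilon> \<le> \<epsilon>'" "1 \<le> k" for \<epsilon> \<epsilon>' k using that by (rule mono)
  next
    fix n and f :: "nat \<Rightarrow> 'g \<Rightarrow> nat \<Rightarrow> nat" and r :: "nat \<Rightarrow> nat"
    assume A: "asymptotic_hom G n f \<and> (\<exists>g. (\<forall>l. g l \<in> hom G (sym_group (n l))) \<and>
      (\<forall>Q. finite Q \<and> Q \<subseteq> carrier G \<longrightarrow>
         (\<lambda>l. tv_dist (fix_law (n l) (f l) Q) (fix_law (n l) (g l) Q)) \<longlonglongrightarrow> 0))"
    then show "asymptotic_hom G n f" by simp
    assume r: "strict_mono r"
    from A obtain g where g: "\<forall>l. g l \<in> hom G (sym_group (n l))" "\<forall>Q. finite Q \<and> Q \<subseteq> carrier G \<longrightarrow>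
         (\<lambda>l. tv_dist (fix_law (n l) (f l) Q) (fix_law (n l) (g l) Q)) \<longlonglongrightarrow> 0" by (elim conjE exE)
    have "(\<lambda>l. tv_dist (fix_law ((n \<circ> r) l) ((f \<circ> r) l) Q) (fix_law ((n \<circ> r) l) ((g \<circ> r) l) Q)) \<longlonglongrightarrow> 0"
      if "finite Q \<and> Q \<subseteq> carrier G" for Q
      using LIMSEQ_subseq_LIMSEQ[OF g(2)[rule_format, OF that] r] by (simp add: comp_def)
    then show "asymptotic_hom G (n \<circ> r) (f \<circ> r) \<and> (\<exists>g. (\<forall>l. g l \<in> hom G (sym_group ((n \<circ> r) l))) \<and>
      (\<forall>Q. finite Q \<and> Q \<subseteq> carrier G \<longrightarrow>
         (\<lambda>l. tv_dist (fix_law ((n \<circ> r) l) ((f \<circ> r) l) Q) (fix_law ((n \<circ> r) l) (g l) Q)) \<longlonglongrightarrow> 0))"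
      using asymptotic_hom_subseq[OF conjunct1[OF A] r] g(1) by (intro conjI exI[of _ "g \<circ> r"] allI impI) simp_all
  next
    fix n \<alpha> assume "limit_law ?M n \<alpha>" "filterlim n at_top sequentially"
    then show "asymptotic_hom G n (\<lambda>l g. \<alpha> l (lift g)) \<and> (\<exists>g. (\<forall>l. g l \<in> hom G (sym_group (n l))) \<and>
      (\<forall>Q. finite Q \<and> Q \<subseteq> carrier G \<longrightarrow>
         (\<lambda>l. tv_dist (fix_law (n l) (\<lambda>g. \<alpha> l (lift g)) Q) (fix_law (n l) (g l) Q)) \<longlonglongrightarrow> 0))"
      by (intro conjI limit_law_asymptotic_hom[OF _ M] BS_rigid_lift)
  next
    fix n f \<alpha>
    assume A: "asymptotic_hom G n f \<and> (\<exists>g. (\<forall>l. g l \<in> hom G (sym_group (n l))) \<and>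
      (\<forall>Q. finite Q \<and> Q \<subseteq> carrier G \<longrightarrow>
         (\<lambda>l. tv_dist (fix_law (n l) (f l) Q) (fix_law (n l) (g l) Q)) \<longlonglongrightarrow> 0))"
      and \<alpha>: "\<And>l. \<alpha> l \<in> hom F (sym_group (n l))"
      and shadow: "\<And>w. w \<in> carrier F \<Longrightarrow>
        (\<lambda>l. perm_dist (n l) (n l) (f l (\<pi> w)) (\<alpha> l w)) \<longlonglongrightarrow> 0"
    from A obtain g where g: "\<forall>l. g l \<in> hom G (sym_group (n l))" "\<forall>Q. finite Q \<and> Q \<subseteq> carrier G \<longrightarrow>
         (\<lambda>l. tv_dist (fix_law (n l) (f l) Q) (fix_law (n l) (g l) Q)) \<longlonglongrightarrow> 0" by (elim conjE exE)
    have n: "1 \<le> n l" for l using A by (simp add: asymptotic_hom_def)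
    show "\<exists>r. strict_mono r \<and> limit_law ?M (n \<circ> r) (\<alpha> \<circ> r)"
      by (rule BS_rigid_law[of g n f, OF _ n _ \<alpha> shadow]) (use g in simp_all)
  qed
  moreover have "BS_rigidity_challenge S G \<pi> X \<alpha> \<longleftrightarrow>
      (\<exists>\<mu>\<in>?M. converges_to F X \<alpha> (IRS_embed F \<pi> \<mu>))"
    for X :: "nat \<Rightarrow> 'x set" and \<alpha>
    unfolding BS_rigidity_challenge_def by auto
  ultimately show ?thesis
    using challenges_iff[of \<nu> ?M, OF mono M, where 'x = 'x] by simp
qed

lemma weakly_stable_iff:
  fixes \<nu> :: "real \<Rightarrow> nat \<Rightarrow> enat"
  assumes mono: "\<And>\<epsilon> \<epsilon>' n. 0 < \<epsilon> \<Longrightarrow> \<epsilon> \<le> \<epsilon>' \<Longrightarrow> 1 \<le> n \<Longrightarrow> \<nu> \<epsilon> n \<le> \<nu> \<epsilon>' n"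
  shows "flexibly_weakly_stable \<nu> G \<longleftrightarrow>
    (\<forall>(X :: nat \<Rightarrow> 'x::infinite set) \<alpha>. sofic_approximation S G \<pi> X \<alpha> \<longrightarrow>
      (\<exists>(Y :: nat \<Rightarrow> 'x set) \<beta>. flexible_solution \<nu> S G \<pi> X \<alpha> Y \<beta>))"
proof -
  let ?M = "{dirac_trivial G}"
  have M: "?M \<subseteq> IRS G" using group.dirac_trivial_in_IRS[OF G countable_G] by simp
  have "flexibly_weakly_stable \<nu> G \<longleftrightarrow>
    (\<forall>n \<alpha>. limit_law ?M n \<alpha> \<longrightarrow> (\<forall>\<delta>>0. eventually (\<lambda>l. nearly_action \<nu> S G \<pi> \<delta> (n l) (\<alpha> l)) sequentially))"
    unfolding flexibly_weakly_stable_def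
  proof (rule stability_iff_challenges[OF _ M])
    show "\<nu> \<epsilon> k \<le> \<nu> \<epsilon>' k" if "0 < \<epsilon>" "\<epsilon> \<le> \<epsilon>'" "1 \<le> k" for \<epsilon> \<epsilon>' k using that by (rule mono)
  next
    fix n and f :: "nat \<Rightarrow> 'g \<Rightarrow> nat \<Rightarrow> nat" and r :: "nat \<Rightarrow> nat"
    assume A: "asymptotic_hom G n f \<and> (\<forall>g\<in>carrier G - {\<one>\<^bsub>G\<^esub>}.
      (\<lambda>l. perm_dist (n l) (n l) (f l g) \<one>\<^bsub>sym_group (n l)\<^esub>) \<longlonglongrightarrow> 1)"
    then show "asymptotic_hom G n f" by simp
    assume r: "strict_mono r"
    have "(\<lambda>l. perm_dist ((n \<circ> r) l) ((n \<circ> r) l) ((f \<circ> r) l g) \<one>\<^bsub>sym_group ((n \<circ> r) l)\<^esub>) \<longlonglongrightarrow> 1"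
      if "g \<in> carrier G - {\<one>\<^bsub>G\<^esub>}" for g
      using LIMSEQ_subseq_LIMSEQ[OF conjunct2[OF A, rule_format, OF that] r] by (simp add: comp_def)
    then show "asymptotic_hom G (n \<circ> r) (f \<circ> r) \<and> (\<forall>g\<in>carrier G - {\<one>\<^bsub>G\<^esub>}.
      (\<lambda>l. perm_dist ((n \<circ> r) l) ((n \<circ> r) l) ((f \<circ> r) l g) \<one>\<^bsub>sym_group ((n \<circ> r) l)\<^esub>) \<longlonglongrightarrow> 1)"
      using asymptotic_hom_subseq[OF conjunct1[OF A] r] by (intro conjI ballI)
  next
    fix n \<alpha> assume "limit_law ?M n \<alpha>" "filterlim n at_top sequentially"
    then show "asymptotic_hom G n (\<lambda>l g. \<alpha> l (lift g)) \<and> (\<forall>g\<in>carrier G - {\<one>\<^bsub>G\<^esub>}.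
      (\<lambda>l. perm_dist (n l) (n l) (\<alpha> l (lift g)) \<one>\<^bsub>sym_group (n l)\<^esub>) \<longlonglongrightarrow> 1)"
      by (intro conjI ballI limit_law_asymptotic_hom[OF _ M] weakly_stable_lift) simp_all
  next
    fix n f \<alpha>
    assume A: "asymptotic_hom G n f \<and> (\<forall>g\<in>carrier G - {\<one>\<^bsub>G\<^esub>}.
      (\<lambda>l. perm_dist (n l) (n l) (f l g) \<one>\<^bsub>sym_group (n l)\<^esub>) \<longlonglongrightarrow> 1)"
      and \<alpha>: "\<And>l. \<alpha> l \<in> hom F (sym_group (n l))"
      and shadow: "\<And>w. w \<in> carrier F \<Longrightarrow>
        (\<lambda>l. perm_dist (n l) (n l) (f l (\<pi> w)) (\<alpha> l w)) \<longlonglongrightarrow> 0"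
    have n: "1 \<le> n l" for l using A by (simp add: asymptotic_hom_def)
    have "limit_law ?M n \<alpha>"
      by (rule weakly_stable_law[of n f, OF n _ conjunct1[OF A] \<alpha> shadow]) (use A in simp_all)
    then show "\<exists>r. strict_mono r \<and> limit_law ?M (n \<circ> r) (\<alpha> \<circ> r)"
      by (intro exI[of _ id]) (simp add: strict_mono_id)
  qed
  then show ?thesis
    unfolding sofic_approximation_def using challenges_iff[of \<nu> ?M, OF mono M, where 'x = 'x] by simp
qed

end

theorem proposition3p2:
  fixes G :: "('g, 'm) monoid_scheme"
    and S :: "'s set"
    and \<pi> :: "'s word \<Rightarrow> 'g"
    and \<nu> :: "real \<Rightarrow> nat \<Rightarrow> enat"
  assumes "group G"
    and "finite S"
    and "\<pi> \<in> epi (free_group S) G"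
    and "\<And>\<epsilon> \<epsilon>' n. 0 < \<epsilon> \<Longrightarrow> \<epsilon> \<le> \<epsilon>' \<Longrightarrow> 1 \<le> n \<Longrightarrow> \<nu> \<epsilon> n \<le> \<nu> \<epsilon>' n"
  shows "((stable_group G \<longleftrightarrow>
           (\<forall>(X :: nat \<Rightarrow> 'x::infinite set) \<alpha>. stability_challenge S G \<pi> X \<alpha> \<longrightarrow>
              (\<exists>(Y :: nat \<Rightarrow> 'x set) \<beta>. solution S G \<pi> X \<alpha> Y \<beta>))) \<and>
          (flexibly_stable \<nu> G \<longleftrightarrow>
           (\<forall>(X :: nat \<Rightarrow> 'x set) \<alpha>. stability_challenge S G \<pi> X \<alpha> \<longrightarrow>
              (\<exists>(Y :: nat \<Rightarrow> 'x set) \<beta>. flexible_solution \<nu> S G \<pi> X \<alpha> Y \<beta>)))) \<and>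
         ((BS_rigid G \<longleftrightarrow>
           (\<forall>(X :: nat \<Rightarrow> 'x set) \<alpha>. BS_rigidity_challenge S G \<pi> X \<alpha> \<longrightarrow>
              (\<exists>(Y :: nat \<Rightarrow> 'x set) \<beta>. solution S G \<pi> X \<alpha> Y \<beta>))) \<and>
          (flexibly_BS_rigid \<nu> G \<longleftrightarrow>
           (\<forall>(X :: nat \<Rightarrow> 'x set) \<alpha>. BS_rigidity_challenge S G \<pi> X \<alpha> \<longrightarrow>
              (\<exists>(Y :: nat \<Rightarrow> 'x set) \<beta>. flexible_solution \<nu> S G \<pi> X \<alpha> Y \<beta>)))) \<and>
         ((weakly_stable G \<longleftrightarrow>
           (\<forall>(X :: nat \<Rightarrow> 'x set) \<alpha>. sofic_approximation S G \<pi> X \<alpha> \<longrightarrow>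
              (\<exists>(Y :: nat \<Rightarrow> 'x set) \<beta>. solution S G \<pi> X \<alpha> Y \<beta>))) \<and>
          (flexibly_weakly_stable \<nu> G \<longleftrightarrow>
           (\<forall>(X :: nat \<Rightarrow> 'x set) \<alpha>. sofic_approximation S G \<pi> X \<alpha> \<longrightarrow>
              (\<exists>(Y :: nat \<Rightarrow> 'x set) \<beta>. flexible_solution \<nu> S G \<pi> X \<alpha> Y \<beta>))))"
proof -
  interpret marked_group G S \<pi> using assms(1-3) by (rule marked_group.intro)
  have \<nu>: "\<nu> \<epsilon> n \<le> \<nu> \<epsilon>' n" if "0 < \<epsilon>" "\<epsilon> \<le> \<epsilon>'" "1 \<le> n" for \<epsilon> \<epsilon>' n using that by (rule assms(4))
  \<comment> \<open>The constant 0 is monotone, so the equivalences for exact solutions are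
    instances of the flexible ones.\<close>
  have zero: "(\<lambda>_ _. 0 :: enat) \<epsilon> n \<le> (\<lambda>_ _. 0) \<epsilon>' n" for \<epsilon> \<epsilon>' :: real and n :: nat by simp
  show ?thesis
    by (intro conjI stable_iff BS_rigid_iff weakly_stable_iff \<nu> zero)
qed

end
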